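(* Let $\sigma\in(\tfrac12,1)$. For every $k\in\mathbb{R}$ there exist $\omega>0$ and a nonzero function $Q_{\omega,k}\in H^1(\mathbb{R})$ solving $$\mathcal{P}_k Q_{\omega,k}+\omega^{2\sigma}Q_{\omega,k}-|Q_{\omega,k}|^{2}Q_{\omega,k}=0 \quad\text{on }\mathbb{R}.$$ Moreover $Q_{\omega,k}\in C^\infty(\mathbb{R})$. Consequently $u(t,x)=e^{-it(|k|^{2\sigma}-\omega^{2\sigma})}e^{ikx}Q_{\omega,k}(x-2t\sigma|k|^{2\sigma-2}k)$ is a traveling solution of $i\partial_tu-(-\Delta)^\sigma u+|u|^2u=0$.
   Context: For $k\in\mathbb{R}$, $\mathcal{P}_k$ is the Fourier multiplier operator $\widehat{\mathcal{P}_k f}(\xi)=p_k(\xi)\hat f(\xi)$ on functions on $\mathbb{R}$ with symbol $p_k(\xi)=|\xi+k|^{2\sigma}-|k|^{2\sigma}-2\sigma|k|^{2\sigma-2}k\xi$ (for $k=0$, $p_0(\xi)=|\xi|^{2\sigma}$, i.e. $\mathcal{P}_0=(-\Delta)^\sigma$). Equivalently $\mathcal{P}_k=e^{-ikx}(-\Delta)^\sigma e^{ikx}-|k|^{2\sigma}+2i\sigma|k|^{2\sigma-2}k\,\partial_x$. Here $(-\Delta)^\sigma$ is the fractional Laplacian with symbol $|\xi|^{2\sigma}$. *)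

theory Defs
  imports "HOL-Analysis.Analysis"
begin

definition fourier :: "(real \<Rightarrow> complex) \<Rightarrow> real \<Rightarrow> complex" where
  "fourier f \<xi> = (LINT x|lborel. exp (- \<i> * complex_of_real (x * \<xi>)) * f x)"

definition fmult :: "(real \<Rightarrow> real) \<Rightarrow> (real \<Rightarrow> complex) \<Rightarrow> real \<Rightarrow> complex" where
  "fmult p f x = complex_of_real (1 / (2 * pi)) *
     (LINT \<xi>|lborel. exp (\<i> * complex_of_real (x * \<xi>)) * complex_of_real (p \<xi>) * fourier f \<xi>)"

text \<open>Symbol p_k(xi) = |xi+k|^{2s} - |k|^{2s} - 2 s |k|^{2s-2} k xi  (for k = 0 this is |xi|^{2s}).\<close>
definition symP :: "real \<Rightarrow> real \<Rightarrow> real \<Rightarrow> real" where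
  "symP \<sigma> k \<xi> = \<bar>\<xi> + k\<bar> powr (2 * \<sigma>) - \<bar>k\<bar> powr (2 * \<sigma>)
                 - 2 * \<sigma> * \<bar>k\<bar> powr (2 * \<sigma> - 2) * k * \<xi>"

definition symL :: "real \<Rightarrow> real \<Rightarrow> real" where
  "symL \<sigma> \<xi> = \<bar>\<xi>\<bar> powr (2 * \<sigma>)"

definition smooth_fun :: "(real \<Rightarrow> complex) \<Rightarrow> bool" where
  "smooth_fun f \<longleftrightarrow> (\<exists>D. D 0 = f \<and>
      (\<forall>n x. (D n has_vector_derivative D (Suc n) x) (at x)))"

definition test_fun :: "(real \<Rightarrow> complex) \<Rightarrow> bool" where
  "test_fun \<phi> \<longleftrightarrow> smooth_fun \<phi> \<and> bounded {x. \<phi> x \<noteq> 0}"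

definition L2 :: "(real \<Rightarrow> complex) \<Rightarrow> bool" where
  "L2 f \<longleftrightarrow> f \<in> borel_measurable lborel \<and> integrable lborel (\<lambda>x. (cmod (f x))\<^sup>2)"

definition H1 :: "(real \<Rightarrow> complex) \<Rightarrow> bool" where
  "H1 f \<longleftrightarrow> L2 f \<and> (\<exists>g. L2 g \<and> (\<forall>\<phi>. test_fun \<phi> \<longrightarrow>
      (LINT x|lborel. f x * vector_derivative \<phi> (at x)) = - (LINT x|lborel. g x * \<phi> x)))"

text \<open>Weak (distributional) form of  P_k Q + w^{2s} Q - |Q|^2 Q = 0  (P_k has real symbol,
  hence is symmetric, so <P_k Q, phi> = <Q, P_k phi>).\<close>
definition weak_standing :: "real \<Rightarrow> real \<Rightarrow> real \<Rightarrow> (real \<Rightarrow> complex) \<Rightarrow> bool" where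
  "weak_standing \<sigma> k \<omega> Q \<longleftrightarrow> (\<forall>\<phi>. test_fun \<phi> \<longrightarrow>
      (LINT x|lborel. Q x * cnj (fmult (symP \<sigma> k) \<phi> x))
      + complex_of_real (\<omega> powr (2 * \<sigma>)) * (LINT x|lborel. Q x * cnj (\<phi> x))
      - (LINT x|lborel. complex_of_real ((cmod (Q x))\<^sup>2) * Q x * cnj (\<phi> x)) = 0)"

definition nls_solution :: "real \<Rightarrow> (real \<Rightarrow> real \<Rightarrow> complex) \<Rightarrow> bool" where
  "nls_solution \<sigma> u \<longleftrightarrow> (\<exists>ut. (\<forall>t x. ((\<lambda>s. u s x) has_vector_derivative ut t x) (at t)) \<and>
     (\<forall>t \<phi>. test_fun \<phi> \<longrightarrow>
        (LINT x|lborel. \<i> * ut t x * cnj (\<phi> x))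
        - (LINT x|lborel. u t x * cnj (fmult (symL \<sigma>) \<phi> x))
        + (LINT x|lborel. complex_of_real ((cmod (u t x))\<^sup>2) * u t x * cnj (\<phi> x)) = 0))"

end

theory Submission
  imports Defs "HOL-Probability.Probability"
begin

text \<open>
  The solution is built with nonnegative Fourier coefficients. On the torus of length \<open>2 * pi * m\<close>, with
  frequencies truncated to \<open>\<bar>\<xi>\<bar> \<le> m\<close>, maximise the quartic form \<open>\<Sum>s. (\<Sum>i. a\<^sub>i * a\<^bsub>s-i\<^esub>)\<^sup>2\<close> (the \<open>L\<^sup>4\<close> norm) under a
  bound on the quadratic form of \<open>w = symP + \<Omega>\<close>. Replacing \<open>a\<close> by \<open>\<bar>a\<bar>\<close> does not decrease the quartic form,
  so the maximiser may be taken nonnegative, and its Euler-Lagrange equation is the truncated equation.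
  A function with nonnegative Fourier coefficients attains its sup norm at the origin. This breaks the
  translation invariance: pairing the equation with the solution gives a lower bound for the value at \<open>0\<close>, so
  no mass can vanish in the limit \<open>m \<longrightarrow> \<infinity>\<close>. The coefficients, viewed as measures, have all moments bounded
  (by bootstrapping the equation), so a subsequence converges weakly to a measure \<open>M\<close>; its Fourier transform
  \<open>Q\<close> is smooth, satisfies \<open>Q 0 \<noteq> 0\<close>, lies in \<open>H\<^sup>1\<close> by Fatou's lemma, and solves the limit equation. Since
  \<open>\<Omega>\<close> is free, it is chosen large enough to make \<open>w\<close> coercive.
\<close>

section \<open>Test functions and their Fourier transforms\<close>

text \<open>For nonzero k the symbol is not even, so rearrangement in x offers no help; comparing a
  with |a| on the Fourier side only uses that the quadratic form sees the squares of the
  coefficients with positive weights. The condition 2 sigma > 1 enters three times: the drift term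
  of the symbol is then of lower order than its leading power, the sum of h / w is finite (this
  bounds the value at 0 from above), and the second derivative of the symbol is integrable at the
  kink xi = -k. The last point makes P_k of a test function integrable, so that it can be paired
  with a bounded function. All sums carry the frequency spacing h = 1/m as Riemann sums do, which is
  why the constants are uniform in m. The cutoff at index m^2 is the frequency m; what it removes
  from the equation is of size O(h). A linear pairing with \<open>Q\<close> always becomes an
  integral against \<open>M\<close> of a symbol times a conjugated transform: a bounded continuous
  integrand, as weak convergence requires. The same reduction carries the time-dependent equation
  over to the profile equation.\<close>

lemma smooth_fun_mult:
  assumes "smooth_fun f" "smooth_fun g"
  shows "smooth_fun (\<lambda>x. f x * g x)"
proof -
  obtain D where D: "D 0 = f" "\<And>n x. (D n has_vector_derivative D (Suc n) x) (at x)"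
    using assms(1) unfolding smooth_fun_def by blast
  obtain E where E: "E 0 = g" "\<And>n x. (E n has_vector_derivative E (Suc n) x) (at x)"
    using assms(2) unfolding smooth_fun_def by blast
  \<comment> \<open>Leibniz rule without binomials: \<open>P n j k\<close> is the n-th derivative of
    \<open>D j\<close> times \<open>E k\<close>. Keeping j and k free lets the induction on n
    close.\<close>
  define P where "P = rec_nat (\<lambda>j k x. D j x * E k x) (\<lambda>n p j k x. p (Suc j) k x + p j (Suc k) x)"
  have P0: "P 0 j k = (\<lambda>x. D j x * E k x)" for j k by (simp add: P_def fun_eq_iff)
  have PS: "P (Suc n) j k = (\<lambda>x. P n (Suc j) k x + P n j (Suc k) x)" for n j k
    by (simp add: P_def fun_eq_iff)
  have "(P n j k has_vector_derivative P (Suc n) j k x) (at x)" for n j k x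
  proof (induction n arbitrary: j k)
    case 0
    show ?case unfolding P0 PS
      by (rule has_vector_derivative_eq_rhs[OF has_vector_derivative_mult[OF D(2) E(2)]]) simp
  next
    case (Suc n)
    show ?case
      unfolding PS[of n j k] PS[of "Suc n"]
      by (rule has_vector_derivative_add[OF Suc.IH Suc.IH])
  qed
  then show ?thesis
    unfolding smooth_fun_def by (intro exI[of _ "\<lambda>n. P n 0 0"]) (auto simp: P0 D E)
qed

lemma smooth_fun_iexp: "smooth_fun (\<lambda>x. exp (\<i> * complex_of_real (c * x)))"
proof -
  have "((\<lambda>x. (\<i> * complex_of_real c) ^ n * exp (\<i> * complex_of_real (c * x))) has_vector_derivative
      (\<i> * complex_of_real c) ^ Suc n * exp (\<i> * complex_of_real (c * x))) (at x)" for n x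
    by (auto intro!: derivative_eq_intros has_vector_derivative_real_field simp: algebra_simps)
  then show ?thesis
    unfolding smooth_fun_def
    by (intro exI[of _ "\<lambda>n x. (\<i> * complex_of_real c) ^ n * exp (\<i> * complex_of_real (c * x))"]) auto
qed

lemma smooth_fun_const: "smooth_fun (\<lambda>x. c)"
  unfolding smooth_fun_def
  by (intro exI[of _ "\<lambda>n x. if n = 0 then c else 0"]) (auto intro!: derivative_eq_intros)

lemma smooth_fun_of_real: "smooth_fun complex_of_real"
  unfolding smooth_fun_def
proof (intro exI[of _ "\<lambda>n x. if n = 0 then complex_of_real x else if n = 1 then 1 else 0"] conjI allI)
  fix n x
  have "(complex_of_real has_vector_derivative 1) (at x)"
    by (auto intro!: derivative_eq_intros)
  then show "((\<lambda>x. if n = 0 then complex_of_real x else if n = 1 then 1 else 0) has_vector_derivative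
      (if Suc n = 0 then complex_of_real x else if Suc n = 1 then 1 else 0)) (at x)"
    by (cases "n = 0") auto
qed auto

lemma smooth_fun_shift:
  assumes "smooth_fun f"
  shows "smooth_fun (\<lambda>x. f (x + c))"
proof -
  obtain D where D: "D 0 = f" "\<And>n x. (D n has_vector_derivative D (Suc n) x) (at x)"
    using assms unfolding smooth_fun_def by blast
  have "((\<lambda>x. D n (x + c)) has_vector_derivative D (Suc n) (x + c)) (at x)" for n x
  proof -
    have "((\<lambda>x. x + c) has_vector_derivative 1) (at x)"
      by (auto intro!: derivative_eq_intros)
    from vector_diff_chain_at[OF this D(2)[of n "x + c"]] show ?thesis by (simp add: o_def)
  qed
  then show ?thesis
    unfolding smooth_fun_def using D(1) by (intro exI[of _ "\<lambda>n x. D n (x + c)"]) auto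
qed

lemma smooth_fun_derivE:
  assumes "smooth_fun f"
  obtains f' where "smooth_fun f'" "\<And>x. (f has_vector_derivative f' x) (at x)"
proof -
  obtain D where D: "D 0 = f" "\<And>n x. (D n has_vector_derivative D (Suc n) x) (at x)"
    using assms unfolding smooth_fun_def by blast
  have "smooth_fun (D 1)" unfolding smooth_fun_def
    by (rule exI[of _ "\<lambda>n. D (Suc n)"]) (use D(2) in auto)
  then show thesis using that[of "D 1"] D by (metis One_nat_def)
qed

lemma smooth_fun_continuous: "smooth_fun f \<Longrightarrow> continuous_on S f"
  by (erule smooth_fun_derivE) (auto intro!: continuous_at_imp_continuous_on has_vector_derivative_continuous)

lemma smooth_fun_measurable: "smooth_fun f \<Longrightarrow> f \<in> borel_measurable borel"
  by (intro borel_measurable_continuous_onI smooth_fun_continuous)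

lemma test_fun_smooth: "test_fun \<phi> \<Longrightarrow> smooth_fun \<phi>"
  by (simp add: test_fun_def)

lemma test_fun_supportE:
  assumes "test_fun \<phi>"
  obtains R where "0 < R" "\<And>x. R \<le> \<bar>x\<bar> \<Longrightarrow> \<phi> x = 0"
proof -
  obtain a where "\<forall>x\<in>{x. \<phi> x \<noteq> 0}. norm x \<le> a"
    using assms unfolding test_fun_def bounded_iff by blast
  then show thesis by (intro that[of "\<bar>a\<bar> + 1"]) force+
qed

lemma test_funI:
  assumes "smooth_fun \<phi>" "\<And>x. R \<le> \<bar>x\<bar> \<Longrightarrow> \<phi> x = 0"
  shows "test_fun \<phi>"
proof -
  have "norm x \<le> R" if "\<phi> x \<noteq> 0" for x using assms(2)[of x] that by (cases "R \<le> \<bar>x\<bar>") auto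
  then show ?thesis unfolding test_fun_def bounded_iff using assms(1) by blast
qed

lemma test_fun_mult:
  assumes "smooth_fun f" "test_fun \<phi>"
  shows "test_fun (\<lambda>x. f x * \<phi> x)"
proof -
  obtain R where "\<And>x. R \<le> \<bar>x\<bar> \<Longrightarrow> \<phi> x = 0" using test_fun_supportE[OF assms(2)] by metis
  then show ?thesis
    by (intro test_funI[of _ R] smooth_fun_mult[OF assms(1) test_fun_smooth[OF assms(2)]]) auto
qed

lemma test_fun_shift:
  assumes "test_fun \<phi>"
  shows "test_fun (\<lambda>x. \<phi> (x + c))"
proof -
  obtain R where R: "\<And>x. R \<le> \<bar>x\<bar> \<Longrightarrow> \<phi> x = 0" using test_fun_supportE[OF assms] by metis
  show ?thesis
  proof (rule test_funI[of _ "R + \<bar>c\<bar>"])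
    show "smooth_fun (\<lambda>x. \<phi> (x + c))" by (rule smooth_fun_shift[OF test_fun_smooth[OF assms]])
  qed (use R in auto)
qed

lemma test_fun_derivE:
  assumes "test_fun \<phi>"
  obtains \<phi>' where "test_fun \<phi>'" "\<And>x. (\<phi> has_vector_derivative \<phi>' x) (at x)"
proof -
  obtain R where R: "\<And>x. R \<le> \<bar>x\<bar> \<Longrightarrow> \<phi> x = 0" using test_fun_supportE[OF assms] by metis
  obtain \<phi>' where \<phi>': "smooth_fun \<phi>'" "\<And>x. (\<phi> has_vector_derivative \<phi>' x) (at x)"
    using smooth_fun_derivE[OF test_fun_smooth[OF assms]] by metis
  \<comment> \<open>The margin 1 puts the whole unit ball around x into the region where the
    function vanishes, so the derivative at x is that of a constant.\<close>
  have "\<phi>' x = 0" if "R + 1 \<le> \<bar>x\<bar>" for x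
  proof -
    have "(\<phi> has_vector_derivative 0) (at x)"
    proof (rule has_vector_derivative_transform_within_open[of "\<lambda>_. 0" 0 x "ball x 1"])
      show "0 = \<phi> y" if "y \<in> ball x 1" for y
        using R[of y] that \<open>R + 1 \<le> \<bar>x\<bar>\<close> by (auto simp: dist_real_def)
    qed auto
    then show ?thesis using \<phi>'(2)[of x] vector_derivative_unique_at by blast
  qed
  then have "test_fun \<phi>'" using \<phi>'(1) by (intro test_funI)
  then show thesis using that \<phi>'(2) by blast
qed

lemma test_fun_integrable:
  assumes "test_fun \<phi>"
  shows "integrable lborel \<phi>"
proof -
  obtain R where R: "\<And>x. R \<le> \<bar>x\<bar> \<Longrightarrow> \<phi> x = 0" using test_fun_supportE[OF assms] by metis
  have "integrable lborel (\<lambda>x. indicator {-R..R} x *\<^sub>R \<phi> x)"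
    by (intro borel_integrable_compact smooth_fun_continuous test_fun_smooth assms) auto
  moreover have "(\<lambda>x. indicator {-R..R} x *\<^sub>R \<phi> x) = \<phi>"
    using R by (auto simp: fun_eq_iff indicator_def)
  ultimately show ?thesis by simp
qed

lemma test_fun_integral_deriv:
  assumes "test_fun \<phi>" and d: "\<And>x. (\<phi> has_vector_derivative \<phi>' x) (at x)"
  shows "(LINT x|lborel. \<phi>' x) = 0"
proof -
  obtain \<psi> where \<psi>: "test_fun \<psi>" "\<And>x. (\<phi> has_vector_derivative \<psi> x) (at x)"
    using test_fun_derivE[OF assms(1)] by metis
  have "\<phi>' = \<psi>" using d \<psi>(2) vector_derivative_unique_at by blast
  then have t: "test_fun \<phi>'" using \<psi> by simp
  obtain R where R: "0 < R" "\<And>x. R \<le> \<bar>x\<bar> \<Longrightarrow> \<phi> x = 0" using test_fun_supportE[OF assms(1)] by metis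
  obtain R' where R': "0 < R'" "\<And>x. R' \<le> \<bar>x\<bar> \<Longrightarrow> \<phi>' x = 0" using test_fun_supportE[OF t] by metis
  let ?R = "max R R'"
  have "(LINT x|lborel. \<phi>' x) = (LINT x|lborel. indicator {-?R..?R} x *\<^sub>R \<phi>' x)"
    using R' by (intro Bochner_Integration.integral_cong) (auto simp: indicator_def)
  also have "\<dots> = \<phi> ?R - \<phi> (-?R)"
  proof (rule integral_FTC_Icc)
    show "continuous_on {-?R..?R} \<phi>'" by (intro smooth_fun_continuous test_fun_smooth t)
  qed (use R d in \<open>auto intro: has_vector_derivative_at_within\<close>)
  also have "\<dots> = 0" using R by auto
  finally show ?thesis .
qed

lemma test_fun_integrate_by_parts:
  assumes "smooth_fun f" "test_fun \<phi>"
    and f': "\<And>x. (f has_vector_derivative f' x) (at x)" and \<phi>': "\<And>x. (\<phi> has_vector_derivative \<phi>' x) (at x)"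
  shows "(LINT x|lborel. f x * \<phi>' x) = - (LINT x|lborel. f' x * \<phi> x)"
proof -
  obtain g where g: "smooth_fun g" "\<And>x. (f has_vector_derivative g x) (at x)"
    using smooth_fun_derivE[OF assms(1)] by metis
  obtain \<psi> where \<psi>: "test_fun \<psi>" "\<And>x. (\<phi> has_vector_derivative \<psi> x) (at x)"
    using test_fun_derivE[OF assms(2)] by metis
  have "g = f'" using g(2) f' vector_derivative_unique_at by blast
  moreover have "\<psi> = \<phi>'" using \<psi>(2) \<phi>' vector_derivative_unique_at by blast
  ultimately have "smooth_fun f'" "test_fun \<phi>'" using g \<psi> by auto
  then have i: "integrable lborel (\<lambda>x. f x * \<phi>' x)" "integrable lborel (\<lambda>x. f' x * \<phi> x)"
    using assms by (auto intro!: test_fun_integrable test_fun_mult)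
  have "(LINT x|lborel. f x * \<phi>' x + f' x * \<phi> x) = 0"
    by (rule test_fun_integral_deriv[OF test_fun_mult[OF assms(1,2)]])
      (rule has_vector_derivative_mult[OF f' \<phi>'])
  then show ?thesis using i by (simp add: add_eq_0_iff)
qed

section \<open>Differentiation of Fourier integrals and decay of the transforms of test
  functions\<close>

lemma norm_iexp_approx: "cmod (exp (\<i> * complex_of_real u) - 1 - \<i> * complex_of_real u) \<le> u\<^sup>2 / 2"
  using iexp_approx1[of u 1] by (simp add: numeral_2_eq_2 diff_diff_eq)

text \<open>The Taylor remainder of the exponential is at most (c (s - t) x)^2 / 2, so a finite
  second moment gives a quadratic error directly. The measure stays general: Lebesgue measure with c
  = -1 serves the transforms of test functions, the limit measure with c = 1 serves the
  profile.\<close>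

lemma has_vector_derivative_integral_iexp:
  fixes f :: "real \<Rightarrow> complex"
  assumes M: "sets M = sets borel" and i: "integrable M f" "integrable M (\<lambda>x. complex_of_real x * f x)"
    "integrable M (\<lambda>x. complex_of_real (x\<^sup>2) * f x)"
  shows "((\<lambda>t. LINT x|M. exp (\<i> * complex_of_real (c * t * x)) * f x) has_vector_derivative
    (LINT x|M. exp (\<i> * complex_of_real (c * t * x)) * (\<i> * complex_of_real (c * x) * f x))) (at t)"
proof -
  have [measurable]: "f \<in> borel_measurable M" "(\<lambda>x. x) \<in> borel_measurable M"
    using i(1) M by (auto simp: measurable_cong_sets[OF M refl])
  have int_e: "integrable M (\<lambda>x. exp (\<i> * complex_of_real (c * s * x)) * g x)" if "integrable M g" for s g
  proof (rule Bochner_Integration.integrable_bound[OF that])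
    show "AE x in M. norm (exp (\<i> * complex_of_real (c * s * x)) * g x) \<le> norm (g x)"
      by (simp add: norm_mult)
  qed (use that in measurable)
  let ?F = "\<lambda>t. LINT x|M. exp (\<i> * complex_of_real (c * t * x)) * f x"
  let ?D = "LINT x|M. exp (\<i> * complex_of_real (c * t * x)) * (\<i> * complex_of_real (c * x) * f x)"
  define K where "K = c\<^sup>2 / 2 * (LINT x|M. norm (complex_of_real (x\<^sup>2) * f x))"
  have ixf: "integrable M (\<lambda>x. \<i> * complex_of_real (c * x) * f x)"
    using integrable_mult_right[OF i(2), of "\<i> * complex_of_real c"] by (simp add: mult.assoc)
  have bnd: "norm (?F s - ?F t - (s - t) *\<^sub>R ?D) \<le> K * (s - t)\<^sup>2" for s
  proof -
    have int1: "integrable M (\<lambda>x. exp (\<i> * complex_of_real (c * s * x)) * f x - exp (\<i> * complex_of_real (c * t * x)) * f x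
          - (s - t) *\<^sub>R (exp (\<i> * complex_of_real (c * t * x)) * (\<i> * complex_of_real (c * x) * f x)))"
      by (intro Bochner_Integration.integrable_diff integrable_scaleR_right int_e i ixf)
    have int2: "integrable M (\<lambda>x. c\<^sup>2 / 2 * (s - t)\<^sup>2 * norm (complex_of_real (x\<^sup>2) * f x))"
      by (intro integrable_mult_right integrable_norm i)
    have eq: "?F s - ?F t - (s - t) *\<^sub>R ?D
      = (LINT x|M. exp (\<i> * complex_of_real (c * s * x)) * f x - exp (\<i> * complex_of_real (c * t * x)) * f x
          - (s - t) *\<^sub>R (exp (\<i> * complex_of_real (c * t * x)) * (\<i> * complex_of_real (c * x) * f x)))"
      using int_e[OF i(1)] int_e[OF ixf] by simp
    have "norm (?F s - ?F t - (s - t) *\<^sub>R ?D) \<le> (LINT x|M. c\<^sup>2 / 2 * (s - t)\<^sup>2 * norm (complex_of_real (x\<^sup>2) * f x))"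
      unfolding eq
    proof (rule Bochner_Integration.integral_norm_bound_integral[OF int1 int2])
      fix x
      have "exp (\<i> * complex_of_real (c * s * x)) = exp (\<i> * complex_of_real (c * t * x)) * exp (\<i> * complex_of_real (c * (s - t) * x))"
        by (simp add: exp_add[symmetric] algebra_simps)
      then have "exp (\<i> * complex_of_real (c * s * x)) * f x - exp (\<i> * complex_of_real (c * t * x)) * f x
          - (s - t) *\<^sub>R (exp (\<i> * complex_of_real (c * t * x)) * (\<i> * complex_of_real (c * x) * f x))
        = exp (\<i> * complex_of_real (c * t * x)) * f x * (exp (\<i> * complex_of_real (c * (s - t) * x)) - 1 - \<i> * complex_of_real (c * (s - t) * x))"
        by (simp add: scaleR_conv_of_real algebra_simps)
      also have "norm \<dots> = norm (f x) * cmod (exp (\<i> * complex_of_real (c * (s - t) * x)) - 1 - \<i> * complex_of_real (c * (s - t) * x))"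
        by (simp add: norm_mult)
      also have "\<dots> \<le> norm (f x) * ((c * (s - t) * x)\<^sup>2 / 2)"
        by (intro mult_left_mono norm_iexp_approx) auto
      also have "\<dots> = c\<^sup>2 / 2 * (s - t)\<^sup>2 * norm (complex_of_real (x\<^sup>2) * f x)"
        by (simp add: norm_mult norm_power power_mult_distrib)
      finally show "norm (exp (\<i> * complex_of_real (c * s * x)) * f x - exp (\<i> * complex_of_real (c * t * x)) * f x
          - (s - t) *\<^sub>R (exp (\<i> * complex_of_real (c * t * x)) * (\<i> * complex_of_real (c * x) * f x)))
        \<le> c\<^sup>2 / 2 * (s - t)\<^sup>2 * norm (complex_of_real (x\<^sup>2) * f x)" .
    qed
    also have "\<dots> = c\<^sup>2 / 2 * (s - t)\<^sup>2 * (LINT x|M. norm (complex_of_real (x\<^sup>2) * f x))"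
      by (rule integral_mult_right_zero)
    also have "\<dots> = K * (s - t)\<^sup>2" by (simp add: K_def)
    finally show ?thesis .
  qed
  show ?thesis
    unfolding has_vector_derivative_def
  proof (rule has_derivativeI_sandwich[of 1])
    show "bounded_linear (\<lambda>s. s *\<^sub>R ?D)" by (rule bounded_linear_scaleR_left)
    show "((\<lambda>s. K * \<bar>s - t\<bar>) \<longlongrightarrow> 0) (at t)"
      by (auto intro!: tendsto_eq_intros)
    fix s assume "s \<noteq> t"
    show "norm (?F s - ?F t - (s - t) *\<^sub>R ?D) / norm (s - t) \<le> K * \<bar>s - t\<bar>"
    proof -
      have sq: "K * (s - t)\<^sup>2 = K * \<bar>s - t\<bar> * norm (s - t)" by (simp add: power2_eq_square)
      have "0 < norm (s - t)" using \<open>s \<noteq> t\<close> by simp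
      then show ?thesis using bnd[of s] unfolding sq by (rule pos_divide_le_eq[THEN iffD2])
    qed
  qed auto
qed

lemma integrable_iexp_mult:
  fixes f :: "real \<Rightarrow> complex"
  assumes "sets M = sets borel" "integrable M f"
  shows "integrable M (\<lambda>x. exp (\<i> * complex_of_real (c * x)) * f x)"
proof (rule Bochner_Integration.integrable_bound[OF assms(2)])
  have [measurable]: "f \<in> borel_measurable M" "(\<lambda>x. x) \<in> borel_measurable M"
    using assms by (auto simp: measurable_cong_sets[OF assms(1) refl])
  show "(\<lambda>x. exp (\<i> * complex_of_real (c * x)) * f x) \<in> borel_measurable M" by measurable
qed (simp add: norm_mult)

lemma fourier_alt: "fourier f \<xi> = (LINT x|lborel. exp (\<i> * complex_of_real ((-1) * \<xi> * x)) * f x)"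
  unfolding fourier_def by (simp add: mult.commute)

lemma test_fun_x: "test_fun \<phi> \<Longrightarrow> test_fun (\<lambda>x. complex_of_real x * \<phi> x)"
  by (intro test_fun_mult smooth_fun_of_real)

lemma fourier_deriv:
  assumes "test_fun \<phi>"
  shows "(fourier \<phi> has_vector_derivative fourier (\<lambda>x. - \<i> * (complex_of_real x * \<phi> x)) \<xi>) (at \<xi>)"
proof -
  have x2: "(\<lambda>x. complex_of_real (x\<^sup>2) * \<phi> x) = (\<lambda>x. complex_of_real x * (complex_of_real x * \<phi> x))"
    by (simp add: power2_eq_square mult.assoc)
  have x1: "(\<lambda>x. - \<i> * (complex_of_real x * \<phi> x)) = (\<lambda>x. \<i> * complex_of_real ((-1) * x) * \<phi> x)"
    by (simp add: mult.assoc)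
  show ?thesis
    unfolding fourier_alt[abs_def] x1
  proof (rule has_vector_derivative_integral_iexp)
    show "integrable lborel (\<lambda>x. complex_of_real (x\<^sup>2) * \<phi> x)"
      unfolding x2 by (intro test_fun_integrable test_fun_x assms)
  qed (use assms in \<open>auto intro!: test_fun_integrable test_fun_x\<close>)
qed

lemma fourier_of_deriv:
  assumes "test_fun \<phi>" "\<And>x. (\<phi> has_vector_derivative \<phi>' x) (at x)"
  shows "fourier \<phi>' \<xi> = \<i> * complex_of_real \<xi> * fourier \<phi> \<xi>"
proof -
  let ?e = "\<lambda>x. exp (\<i> * complex_of_real ((- \<xi>) * x))"
  have "(LINT x|lborel. ?e x * \<phi>' x) = - (LINT x|lborel. (- \<i> * complex_of_real \<xi> * ?e x) * \<phi> x)"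
  proof (rule test_fun_integrate_by_parts[OF smooth_fun_iexp assms(1) _ assms(2)])
    show "(?e has_vector_derivative - \<i> * complex_of_real \<xi> * ?e x) (at x)" for x
      by (auto intro!: derivative_eq_intros has_vector_derivative_real_field simp: algebra_simps)
  qed
  also have "\<dots> = \<i> * complex_of_real \<xi> * (LINT x|lborel. ?e x * \<phi> x)"
    by (simp add: mult.assoc)
  finally show ?thesis unfolding fourier_alt by simp
qed

lemma norm_fourier_le: "cmod (fourier f \<xi>) \<le> (LINT x|lborel. cmod (f x))"
  unfolding fourier_alt
  by (rule order_trans[OF integral_norm_bound]) (simp add: norm_mult)

text \<open>Each derivative of the function is a factor \<xi> on its transform. Order four is chosen
  so that a symbol of size 1 + \<xi>^2 can be multiplied on and a decay like 1 / (1 + \<xi>^2),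
  hence integrability, remains.\<close>

lemma fourier_decay:
  assumes "test_fun \<phi>"
  obtains C where "0 \<le> C" "\<And>\<xi>. cmod (fourier \<phi> \<xi>) * (1 + \<xi> ^ 4) \<le> C"
proof -
  obtain \<phi>1 where 1: "test_fun \<phi>1" "\<And>x. (\<phi> has_vector_derivative \<phi>1 x) (at x)"
    using test_fun_derivE[OF assms] by metis
  obtain \<phi>2 where 2: "test_fun \<phi>2" "\<And>x. (\<phi>1 has_vector_derivative \<phi>2 x) (at x)"
    using test_fun_derivE[OF 1(1)] by metis
  obtain \<phi>3 where 3: "test_fun \<phi>3" "\<And>x. (\<phi>2 has_vector_derivative \<phi>3 x) (at x)"
    using test_fun_derivE[OF 2(1)] by metis
  obtain \<phi>4 where 4: "test_fun \<phi>4" "\<And>x. (\<phi>3 has_vector_derivative \<phi>4 x) (at x)"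
    using test_fun_derivE[OF 3(1)] by metis
  have "fourier \<phi>4 \<xi> = complex_of_real (\<xi> ^ 4) * fourier \<phi> \<xi>" for \<xi>
    by (simp add: fourier_of_deriv[OF 1(1) 2(2)] fourier_of_deriv[OF assms 1(2)]
        fourier_of_deriv[OF 2(1) 3(2)] fourier_of_deriv[OF 3(1) 4(2)] power4_eq_xxxx algebra_simps)
  then have "\<xi> ^ 4 * cmod (fourier \<phi> \<xi>) = cmod (fourier \<phi>4 \<xi>)" for \<xi>
    by (simp add: norm_mult norm_power)
  then have "cmod (fourier \<phi> \<xi>) * (1 + \<xi> ^ 4) \<le> (LINT x|lborel. cmod (\<phi> x)) + (LINT x|lborel. cmod (\<phi>4 x))" for \<xi>
    using norm_fourier_le[of \<phi> \<xi>] norm_fourier_le[of \<phi>4 \<xi>] by (simp add: algebra_simps)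
  then show thesis
    by (intro that[of "(LINT x|lborel. cmod (\<phi> x)) + (LINT x|lborel. cmod (\<phi>4 x))"]) auto
qed

section \<open>Fourier inversion\<close>

text \<open>The exponential has modulus one, so the product of the two integrable norms dominates
  the double integral. The measure is a parameter because this exchange is made against Lebesgue
  measure in the inversion formula and later against the limit measure.\<close>

lemma fubini_iexp:
  fixes A B :: "real \<Rightarrow> complex"
  assumes "sigma_finite_measure M" and M: "sets M = sets borel" and A: "integrable lborel A" and B: "integrable M B"
  shows "(LINT x|lborel. A x * (LINT \<xi>|M. iexp (x * \<xi>) * B \<xi>)) = (LINT \<xi>|M. B \<xi> * (LINT x|lborel. iexp (x * \<xi>) * A x))"
proof -
  interpret M: sigma_finite_measure M by fact
  interpret pair_sigma_finite lborel M ..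
  have [measurable]: "A \<in> borel_measurable lborel" "B \<in> borel_measurable M"
    using A B by auto
  have [measurable]: "(\<lambda>x. x) \<in> borel_measurable M"
    by (simp add: measurable_cong_sets[OF M refl])
  have meas: "(\<lambda>(x, \<xi>). A x * (iexp (x * \<xi>) * B \<xi>)) \<in> borel_measurable (lborel \<Otimes>\<^sub>M M)"
    by measurable
  have "integrable (lborel \<Otimes>\<^sub>M M) (\<lambda>(x, \<xi>). A x * (iexp (x * \<xi>) * B \<xi>))"
  proof (rule Fubini_integrable[OF meas])
    have "(\<lambda>x. LINT \<xi>|M. norm (case (x, \<xi>) of (x, \<xi>) \<Rightarrow> A x * (iexp (x * \<xi>) * B \<xi>)))
      = (\<lambda>x. norm (A x) * (LINT \<xi>|M. norm (B \<xi>)))"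
      by (simp add: norm_mult)
    then show "integrable lborel (\<lambda>x. LINT \<xi>|M. norm (case (x, \<xi>) of (x, \<xi>) \<Rightarrow> A x * (iexp (x * \<xi>) * B \<xi>)))"
      using A by simp
    show "AE x in lborel. integrable M (\<lambda>\<xi>. case (x, \<xi>) of (x, \<xi>) \<Rightarrow> A x * (iexp (x * \<xi>) * B \<xi>))"
      using integrable_iexp_mult[OF M B] by (intro AE_I2) (simp only: prod.case integrable_mult_right)
  qed
  from Fubini_integral[OF this]
  have "(LINT \<xi>|M. LINT x|lborel. A x * (iexp (x * \<xi>) * B \<xi>)) = (LINT x|lborel. LINT \<xi>|M. A x * (iexp (x * \<xi>) * B \<xi>))" .
  moreover have "(LINT x|lborel. A x * (iexp (x * \<xi>) * B \<xi>)) = B \<xi> * (LINT x|lborel. iexp (x * \<xi>) * A x)" for \<xi>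
    by (subst integral_mult_right_zero[symmetric]) (simp only: mult.assoc mult.left_commute mult.commute)
  ultimately show ?thesis by (simp only: integral_mult_right_zero)
qed

lemma gaussian_integrable:
  assumes "0 < e"
  shows "integrable lborel (\<lambda>x. complex_of_real (exp (- (e * x)\<^sup>2 / 2)))"
proof -
  have "integrable lborel (\<lambda>x. sqrt (2 * pi) * std_normal_density x)"
    by (intro integrable_mult_right integrable_normal_density) auto
  then have "integrable lborel (\<lambda>x::real. exp (- x\<^sup>2 / 2))" by (simp add: std_normal_density_def)
  from lborel_integrable_real_affine[OF this, of e 0] assms
  have "integrable lborel (\<lambda>x. exp (- (e * x)\<^sup>2 / 2))" by simp
  then show ?thesis by (rule integrable_of_real)
qed

text \<open>Read off from the characteristic function of the standard normal law, then rescaled by x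
  = y / e.\<close>

lemma gaussian_transform:
  assumes e: "0 < e"
  shows "(LINT x|lborel. iexp (t * x) * complex_of_real (exp (- (e * x)\<^sup>2 / 2)))
    = complex_of_real (sqrt (2 * pi) / e * exp (- (t / e)\<^sup>2 / 2))"
proof -
  have std: "(LINT x|lborel. iexp (t * x) * complex_of_real (exp (- x\<^sup>2 / 2)))
    = complex_of_real (sqrt (2 * pi) * exp (- t\<^sup>2 / 2))" for t
  proof -
    have "complex_of_real (exp (- t\<^sup>2 / 2)) = char std_normal_distribution t"
      by (simp add: char_std_normal_distribution)
    also have "\<dots> = (LINT x|lborel. std_normal_density x *\<^sub>R iexp (t * x))"
      unfolding char_def by (rule integral_density) auto
    also have "\<dots> = (LINT x|lborel. complex_of_real (1 / sqrt (2 * pi)) * (iexp (t * x) * complex_of_real (exp (- x\<^sup>2 / 2))))"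
      by (intro Bochner_Integration.integral_cong refl) (simp add: std_normal_density_def scaleR_conv_of_real mult_ac)
    also have "\<dots> = complex_of_real (1 / sqrt (2 * pi)) * (LINT x|lborel. iexp (t * x) * complex_of_real (exp (- x\<^sup>2 / 2)))"
      by (rule integral_mult_right_zero)
    finally have "complex_of_real (sqrt (2 * pi)) * complex_of_real (exp (- t\<^sup>2 / 2))
      = complex_of_real (sqrt (2 * pi)) * (complex_of_real (1 / sqrt (2 * pi)) * (LINT x|lborel. iexp (t * x) * complex_of_real (exp (- x\<^sup>2 / 2))))"
      by simp
    then show ?thesis by (simp add: mult.assoc[symmetric] of_real_mult[symmetric] del: of_real_mult)
  qed
  have "(LINT x|lborel. iexp (t * x) * complex_of_real (exp (- (e * x)\<^sup>2 / 2)))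
    = \<bar>1 / e\<bar> *\<^sub>R (LINT x|lborel. iexp (t * (0 + 1 / e * x)) * complex_of_real (exp (- (e * (0 + 1 / e * x))\<^sup>2 / 2)))"
    by (rule lborel_integral_real_affine) (use e in auto)
  also have "(LINT x|lborel. iexp (t * (0 + 1 / e * x)) * complex_of_real (exp (- (e * (0 + 1 / e * x))\<^sup>2 / 2)))
    = (LINT x|lborel. iexp ((t / e) * x) * complex_of_real (exp (- x\<^sup>2 / 2)))"
    using e by simp
  also have "\<dots> = complex_of_real (sqrt (2 * pi) * exp (- (t / e)\<^sup>2 / 2))" by (rule std)
  finally show ?thesis using e by (simp add: scaleR_conv_of_real)
qed

text \<open>The direction fits \<open>fmult\<close>, which is an inverse integral by definition and
  whose transform is wanted. A Gaussian factor makes the double integral absolutely convergent;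
  after the exchange \<open>J e\<close> is the average of g around \<eta> against a normal law of
  width e, and both expressions for \<open>J e\<close> have a limit as e tends to 0.\<close>

lemma fourier_inversion:
  fixes g \<psi> :: "real \<Rightarrow> complex"
  assumes cont: "continuous_on UNIV g" and g: "integrable lborel g" and B: "\<And>\<xi>. cmod (g \<xi>) \<le> B"
    and \<psi>: "\<And>x. \<psi> x = complex_of_real (1 / (2 * pi)) * (LINT \<xi>|lborel. iexp (x * \<xi>) * g \<xi>)"
    and int: "integrable lborel \<psi>"
  shows "fourier \<psi> \<eta> = g \<eta>"
proof -
  have [measurable]: "g \<in> borel_measurable borel" "\<psi> \<in> borel_measurable borel"
    using g int by auto
  define J where "J e = (LINT x|lborel. \<psi> x * (iexp (- \<eta> * x) * complex_of_real (exp (- (e * x)\<^sup>2 / 2))))" for e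
  have J: "J e = (LINT z|lborel. std_normal_density z *\<^sub>R g (\<eta> + e * z))" if e: "0 < e" for e
  proof -
    let ?G = "\<lambda>x. complex_of_real (exp (- (e * x)\<^sup>2 / 2))"
    let ?A = "\<lambda>x. iexp (- \<eta> * x) * ?G x"
    have "J e = (LINT x|lborel. complex_of_real (1 / (2 * pi)) * (?A x * (LINT \<xi>|lborel. iexp (x * \<xi>) * g \<xi>)))"
      unfolding J_def \<psi> by (simp only: mult_ac)
    also have "\<dots> = complex_of_real (1 / (2 * pi)) * (LINT x|lborel. ?A x * (LINT \<xi>|lborel. iexp (x * \<xi>) * g \<xi>))"
      by (rule integral_mult_right_zero)
    finally have J1: "J e = complex_of_real (1 / (2 * pi)) * (LINT x|lborel. ?A x * (LINT \<xi>|lborel. iexp (x * \<xi>) * g \<xi>))" .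
    have "(LINT x|lborel. ?A x * (LINT \<xi>|lborel. iexp (x * \<xi>) * g \<xi>))
       = (LINT \<xi>|lborel. g \<xi> * (LINT x|lborel. iexp (x * \<xi>) * ?A x))"
      by (intro fubini_iexp g integrable_iexp_mult gaussian_integrable e sigma_finite_lborel) auto
    also have "\<dots> = (LINT \<xi>|lborel. g \<xi> * complex_of_real (sqrt (2 * pi) / e * exp (- ((\<xi> - \<eta>) / e)\<^sup>2 / 2)))"
    proof (intro Bochner_Integration.integral_cong refl arg_cong2[where f="(*)"])
      fix \<xi>
      have "(\<lambda>x. iexp (x * \<xi>) * ?A x) = (\<lambda>x. iexp ((\<xi> - \<eta>) * x) * ?G x)"
      proof
        fix x
        have "iexp (x * \<xi>) * iexp (- \<eta> * x) = iexp ((\<xi> - \<eta>) * x)"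
          by (simp add: exp_add[symmetric] algebra_simps)
        then show "iexp (x * \<xi>) * ?A x = iexp ((\<xi> - \<eta>) * x) * ?G x" by (simp only: mult.assoc[symmetric])
      qed
      then show "(LINT x|lborel. iexp (x * \<xi>) * ?A x) = complex_of_real (sqrt (2 * pi) / e * exp (- ((\<xi> - \<eta>) / e)\<^sup>2 / 2))"
        by (simp only: gaussian_transform[OF e])
    qed
    also have "\<dots> = \<bar>e\<bar> *\<^sub>R (LINT z|lborel. g (\<eta> + e * z) * complex_of_real (sqrt (2 * pi) / e * exp (- ((\<eta> + e * z - \<eta>) / e)\<^sup>2 / 2)))"
      by (rule lborel_integral_real_affine) (use e in auto)
    also have "\<dots> = (LINT z|lborel. complex_of_real (sqrt (2 * pi)) * (complex_of_real (exp (- z\<^sup>2 / 2)) * g (\<eta> + e * z)))"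
      unfolding integral_scaleR_right[symmetric] using e
      by (intro Bochner_Integration.integral_cong refl) (simp add: scaleR_conv_of_real)
    finally have "J e = (LINT z|lborel. complex_of_real (1 / (2 * pi)) * (complex_of_real (sqrt (2 * pi)) * (complex_of_real (exp (- z\<^sup>2 / 2)) * g (\<eta> + e * z))))"
      unfolding J1 by (simp only: integral_mult_right_zero)
    also have "\<dots> = (LINT z|lborel. std_normal_density z *\<^sub>R g (\<eta> + e * z))"
    proof (intro Bochner_Integration.integral_cong refl)
      fix z
      \<comment> \<open>The 1/(2 pi) of the inverse transform and the sqrt (2 pi) of the Gaussian
        integral combine to the normalising constant of the standard normal density.\<close>
      have "complex_of_real (1 / (2 * pi)) * complex_of_real (sqrt (2 * pi)) = complex_of_real (1 / sqrt (2 * pi))"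
      proof -
        have "1 / (s * s) * s = 1 / s" if "0 < s" for s :: real using that by simp
        from this[of "sqrt (2 * pi)"] have "1 / (2 * pi) * sqrt (2 * pi) = 1 / sqrt (2 * pi)" by simp
        then show ?thesis unfolding of_real_mult[symmetric] by (rule arg_cong)
      qed
      then show "complex_of_real (1 / (2 * pi)) * (complex_of_real (sqrt (2 * pi)) * (complex_of_real (exp (- z\<^sup>2 / 2)) * g (\<eta> + e * z)))
         = std_normal_density z *\<^sub>R g (\<eta> + e * z)"
        unfolding std_normal_density_def scaleR_conv_of_real of_real_mult by (simp only: mult.assoc[symmetric])
    qed
    finally show ?thesis .
  qed
  define e where "e n = inverse (real (Suc n))" for n
  have e0: "0 < e n" for n by (simp add: e_def)
  have elim: "e \<longlonglongrightarrow> 0" unfolding e_def by (rule LIMSEQ_inverse_real_of_nat)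
  have "(\<lambda>n. J (e n)) \<longlonglongrightarrow> (LINT x|lborel. \<psi> x * iexp (- \<eta> * x))"
    unfolding J_def
  proof (rule integral_dominated_convergence[where w="\<lambda>x. norm (\<psi> x)"])
    show "AE x in lborel. (\<lambda>n. \<psi> x * (iexp (- \<eta> * x) * complex_of_real (exp (- (e n * x)\<^sup>2 / 2)))) \<longlonglongrightarrow> \<psi> x * iexp (- \<eta> * x)"
    proof (rule AE_I2)
      fix x
      have "(\<lambda>n. \<psi> x * (iexp (- \<eta> * x) * complex_of_real (exp (- (e n * x)\<^sup>2 / 2)))) \<longlonglongrightarrow> \<psi> x * (iexp (- \<eta> * x) * complex_of_real (exp (- (0 * x)\<^sup>2 / 2)))"
        by (intro tendsto_intros elim) auto
      then show "(\<lambda>n. \<psi> x * (iexp (- \<eta> * x) * complex_of_real (exp (- (e n * x)\<^sup>2 / 2)))) \<longlonglongrightarrow> \<psi> x * iexp (- \<eta> * x)"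
        by simp
    qed
    show "AE x in lborel. norm (\<psi> x * (iexp (- \<eta> * x) * complex_of_real (exp (- (e n * x)\<^sup>2 / 2)))) \<le> norm (\<psi> x)" for n
      by (intro AE_I2) (simp add: norm_mult mult_left_le)
  qed (use int in auto)
  moreover have "(LINT x|lborel. \<psi> x * iexp (- \<eta> * x)) = fourier \<psi> \<eta>"
    unfolding fourier_alt by (intro Bochner_Integration.integral_cong refl) (simp add: mult.commute)
  moreover have "(\<lambda>n. J (e n)) \<longlonglongrightarrow> g \<eta>"
  proof -
    have "(\<lambda>n. LINT z|lborel. std_normal_density z *\<^sub>R g (\<eta> + e n * z)) \<longlonglongrightarrow> (LINT z|lborel. std_normal_density z *\<^sub>R g \<eta>)"
    proof (rule integral_dominated_convergence[where w="\<lambda>z. std_normal_density z * B"])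
      show "AE z in lborel. (\<lambda>n. std_normal_density z *\<^sub>R g (\<eta> + e n * z)) \<longlonglongrightarrow> std_normal_density z *\<^sub>R g \<eta>"
      proof (rule AE_I2)
        fix z
        have "(\<lambda>n. \<eta> + e n * z) \<longlonglongrightarrow> \<eta> + 0 * z" by (intro tendsto_intros elim)
        then have "(\<lambda>n. g (\<eta> + e n * z)) \<longlonglongrightarrow> g \<eta>"
          using cont by (intro isCont_tendsto_compose[of \<eta> g]) (auto simp: continuous_on_eq_continuous_at)
        then show "(\<lambda>n. std_normal_density z *\<^sub>R g (\<eta> + e n * z)) \<longlonglongrightarrow> std_normal_density z *\<^sub>R g \<eta>"
          by (intro tendsto_intros)
      qed
      show "AE z in lborel. norm (std_normal_density z *\<^sub>R g (\<eta> + e n * z)) \<le> std_normal_density z * B" for n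
        using B by (intro AE_I2) (auto intro!: mult_left_mono)
      show "integrable lborel (\<lambda>z. std_normal_density z * B)"
        by (intro integrable_mult_left integrable_normal_density) auto
    qed auto
    moreover have "(LINT z|lborel. std_normal_density z *\<^sub>R g \<eta>) = g \<eta>"
      by (subst integral_scaleR_left) (auto intro!: integrable_normal_density simp: integral_normal_density)
    ultimately show ?thesis using J[OF e0] by simp
  qed
  ultimately show ?thesis using LIMSEQ_unique by metis
qed

section \<open>The multiplier operator on test functions\<close>

lemma integrable_inverse_square: "integrable lborel (\<lambda>x::real. 1 / (1 + x\<^sup>2))"
  using integrable_inverse_1_plus_square
  by (simp add: set_integrable_def einterval_def inverse_eq_divide)

lemma integrable_of_decay:
  fixes f :: "real \<Rightarrow> complex"
  assumes "f \<in> borel_measurable borel" "\<And>x. cmod (f x) * (1 + x\<^sup>2) \<le> C"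
  shows "integrable lborel f"
proof (rule Bochner_Integration.integrable_bound)
  show "integrable lborel (\<lambda>x. C * (1 / (1 + x\<^sup>2)))"
    by (intro integrable_mult_right integrable_inverse_square)
  have "0 < 1 + x\<^sup>2" for x :: real by (smt (verit) zero_le_power2)
  then have "cmod (f x) \<le> C * (1 / (1 + x\<^sup>2))" for x
    using assms(2)[of x] by (simp add: pos_le_divide_eq)
  then show "AE x in lborel. norm (f x) \<le> norm (C * (1 / (1 + x\<^sup>2)))"
    by (intro AE_I2) (smt (verit) real_norm_def)
qed (use assms in auto)

lemma tendsto_of_decay:
  fixes f :: "real \<Rightarrow> complex"
  assumes "\<And>x. cmod (f x) * (1 + x\<^sup>2) \<le> C"
  shows "(f \<longlongrightarrow> 0) at_top" "(f \<longlongrightarrow> 0) at_bot"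
proof -
  have pos: "0 < 1 + x\<^sup>2" for x :: real by (smt (verit) zero_le_power2)
  have b: "cmod (f x) \<le> C / (1 + x\<^sup>2)" for x
    using assms(1)[of x] pos[of x] by (simp add: pos_le_divide_eq)
  have "((\<lambda>x::real. C / (1 + x\<^sup>2)) \<longlongrightarrow> 0) at_top"
    by real_asymp
  then show "(f \<longlongrightarrow> 0) at_top"
    by (rule Lim_null_comparison[rotated]) (use b in auto)
  have "((\<lambda>x::real. C / (1 + x\<^sup>2)) \<longlongrightarrow> 0) at_bot"
    by real_asymp
  then show "(f \<longlongrightarrow> 0) at_bot"
    by (rule Lim_null_comparison[rotated]) (use b in auto)
qed

text \<open>Two integrations by parts trade x^2 for the second derivative. The point s stands for a
  kink of g1: the continuity of g1 there makes the boundary contributions from the two sides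
  cancel.\<close>

lemma inverse_fourier_decay:
  fixes g g1 g2 :: "real \<Rightarrow> complex"
  assumes d0: "\<And>\<xi>. (g has_vector_derivative g1 \<xi>) (at \<xi>)"
    and d1: "\<And>\<xi>. \<xi> \<noteq> s \<Longrightarrow> (g1 has_vector_derivative g2 \<xi>) (at \<xi>)"
    and c1: "isCont g1 s" and c2: "\<And>\<xi>. \<xi> \<noteq> s \<Longrightarrow> isCont g2 \<xi>"
    and i0: "integrable lborel g" and i2: "integrable lborel g2"
    and lim: "(g \<longlongrightarrow> 0) at_top" "(g \<longlongrightarrow> 0) at_bot" "(g1 \<longlongrightarrow> 0) at_top" "(g1 \<longlongrightarrow> 0) at_bot"
  shows "cmod (LINT \<xi>|lborel. iexp (x * \<xi>) * g \<xi>) * x\<^sup>2 \<le> (LINT \<xi>|lborel. cmod (g2 \<xi>))"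
proof (cases "x = 0")
  case False
  \<comment> \<open>Both integrations by parts at once: F collects the two boundary terms, and in
    its derivative the g1 contributions cancel because 1/(i x) + i/x = 0.\<close>
  define F where "F \<xi> = iexp (x * \<xi>) * (g \<xi> / (\<i> * x) + g1 \<xi> / complex_of_real (x\<^sup>2))" for \<xi>
  define f where "f \<xi> = iexp (x * \<xi>) * g \<xi> + iexp (x * \<xi>) * (g2 \<xi> / complex_of_real (x\<^sup>2))" for \<xi>
  have dF: "(F has_vector_derivative f \<xi>) (at \<xi>)" if "\<xi> \<noteq> s" for \<xi>
  proof -
    have e: "((\<lambda>\<xi>. iexp (x * \<xi>)) has_vector_derivative iexp (x * \<xi>) * (\<i> * x)) (at \<xi>)"
      by (auto intro!: derivative_eq_intros has_vector_derivative_real_field)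
    have "((\<lambda>\<xi>. g \<xi> / (\<i> * x) + g1 \<xi> / complex_of_real (x\<^sup>2)) has_vector_derivative g1 \<xi> / (\<i> * x) + g2 \<xi> / complex_of_real (x\<^sup>2)) (at \<xi>)"
      by (intro has_vector_derivative_add has_vector_derivative_divide d0 d1 that)
    from has_vector_derivative_mult[OF e this]
    have "(F has_vector_derivative iexp (x * \<xi>) * (g1 \<xi> / (\<i> * x) + g2 \<xi> / complex_of_real (x\<^sup>2))
       + iexp (x * \<xi>) * (\<i> * x) * (g \<xi> / (\<i> * x) + g1 \<xi> / complex_of_real (x\<^sup>2))) (at \<xi>)"
      unfolding F_def .
    moreover have "g1 \<xi> / (\<i> * x) + (\<i> * x) * (g1 \<xi> / complex_of_real (x\<^sup>2)) = 0"
      using False by (simp add: field_simps power2_eq_square)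
    then have "iexp (x * \<xi>) * (g1 \<xi> / (\<i> * x) + g2 \<xi> / complex_of_real (x\<^sup>2))
       + iexp (x * \<xi>) * (\<i> * x) * (g \<xi> / (\<i> * x) + g1 \<xi> / complex_of_real (x\<^sup>2)) = f \<xi>"
    proof -
      assume z: "g1 \<xi> / (\<i> * x) + (\<i> * x) * (g1 \<xi> / complex_of_real (x\<^sup>2)) = 0"
      have "iexp (x * \<xi>) * (g1 \<xi> / (\<i> * x) + g2 \<xi> / complex_of_real (x\<^sup>2))
       + iexp (x * \<xi>) * (\<i> * x) * (g \<xi> / (\<i> * x) + g1 \<xi> / complex_of_real (x\<^sup>2))
        = iexp (x * \<xi>) * ((g1 \<xi> / (\<i> * x) + (\<i> * x) * (g1 \<xi> / complex_of_real (x\<^sup>2))) + ((\<i> * x) * (g \<xi> / (\<i> * x)) + g2 \<xi> / complex_of_real (x\<^sup>2)))"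
        by (simp only: distrib_left mult.assoc add_ac)
      also have "\<dots> = f \<xi>" unfolding z f_def using False by (simp add: distrib_left)
      finally show ?thesis .
    qed
    ultimately show ?thesis by simp
  qed
  have cg: "isCont g \<xi>" for \<xi> using d0 has_vector_derivative_continuous by blast
  have cf: "isCont f \<xi>" if "\<xi> \<noteq> s" for \<xi>
    unfolding f_def using that False by (intro continuous_intros cg c2) auto
  have i2': "integrable lborel (\<lambda>\<xi>. iexp (x * \<xi>) * (g2 \<xi> / complex_of_real (x\<^sup>2)))"
    by (intro integrable_iexp_mult integrable_divide i2) auto
  have i0': "integrable lborel (\<lambda>\<xi>. iexp (x * \<xi>) * g \<xi>)"
    by (intro integrable_iexp_mult i0) auto
  have intf: "integrable lborel f" unfolding f_def by (intro Bochner_Integration.integrable_add i0' i2')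
  have sintf: "set_integrable lborel A f" if "A \<in> sets borel" for A
    unfolding set_integrable_def using that by (intro integrable_mult_indicator intf) auto
  have cF: "isCont F s"
    unfolding F_def using False by (intro continuous_intros cg c1) auto
  have lF: "(F \<longlongrightarrow> 0) A" if "(g \<longlongrightarrow> 0) A" "(g1 \<longlongrightarrow> 0) A" for A
  proof -
    have "((\<lambda>\<xi>. g \<xi> / (\<i> * x) + g1 \<xi> / complex_of_real (x\<^sup>2)) \<longlongrightarrow> 0 / (\<i> * x) + 0 / complex_of_real (x\<^sup>2)) A"
      using False by (intro tendsto_intros that) auto
    then have "((\<lambda>\<xi>. g \<xi> / (\<i> * x) + g1 \<xi> / complex_of_real (x\<^sup>2)) \<longlongrightarrow> 0) A" by simp
    then show ?thesis
      by (rule Lim_null_comparison[rotated, OF tendsto_norm_zero]) (simp add: F_def norm_mult)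
  qed
  \<comment> \<open>The fundamental theorem is applied on each side of s separately, since F need
    not be differentiable at s. The values F s occur with opposite signs.\<close>
  have L: "(LBINT \<xi>=-\<infinity>..ereal s. f \<xi>) = F s - 0"
  proof (rule interval_integral_FTC_integrable)
    show "((F \<circ> real_of_ereal) \<longlongrightarrow> 0) (at_right (- \<infinity>))"
      unfolding ereal_tendsto_simps by (intro lF lim)
    show "((F \<circ> real_of_ereal) \<longlongrightarrow> F s) (at_left (ereal s))"
      unfolding ereal_tendsto_simps using cF by (simp add: isCont_def filterlim_at_split)
  qed (use dF cf sintf in auto)
  have R: "(LBINT \<xi>=ereal s..\<infinity>. f \<xi>) = 0 - F s"
  proof (rule interval_integral_FTC_integrable)
    show "((F \<circ> real_of_ereal) \<longlongrightarrow> 0) (at_left \<infinity>)"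
      unfolding ereal_tendsto_simps by (intro lF lim)
    show "((F \<circ> real_of_ereal) \<longlongrightarrow> F s) (at_right (ereal s))"
      unfolding ereal_tendsto_simps using cF by (simp add: isCont_def filterlim_at_split)
  qed (use dF cf sintf in auto)
  have "(LBINT \<xi>=-\<infinity>..ereal s. f \<xi>) + (LBINT \<xi>=ereal s..\<infinity>. f \<xi>) = (LBINT \<xi>=-\<infinity>..\<infinity>. f \<xi>)"
    by (rule interval_integral_sum) (auto simp: interval_lebesgue_integrable_def intro: sintf)
  also have "\<dots> = (LINT \<xi>|lborel. f \<xi>)"
    by (simp add: interval_lebesgue_integral_def einterval_def set_lebesgue_integral_def)
  finally have "(LINT \<xi>|lborel. f \<xi>) = 0" using L R by simp
  then have "(LINT \<xi>|lborel. iexp (x * \<xi>) * g \<xi>) = - (LINT \<xi>|lborel. iexp (x * \<xi>) * (g2 \<xi> / complex_of_real (x\<^sup>2)))"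
    unfolding f_def Bochner_Integration.integral_add[OF i0' i2'] by (rule eq_neg_iff_add_eq_0[THEN iffD2])
  then have "cmod (LINT \<xi>|lborel. iexp (x * \<xi>) * g \<xi>) = cmod (LINT \<xi>|lborel. iexp (x * \<xi>) * (g2 \<xi> / complex_of_real (x\<^sup>2)))"
    by simp
  also have "\<dots> \<le> (LINT \<xi>|lborel. cmod (iexp (x * \<xi>) * (g2 \<xi> / complex_of_real (x\<^sup>2))))"
    by (rule integral_norm_bound)
  also have "\<dots> = (LINT \<xi>|lborel. cmod (g2 \<xi>)) / x\<^sup>2"
    by (simp add: norm_mult norm_divide norm_power)
  finally show ?thesis using False by (simp add: pos_le_divide_eq)
qed simp

section \<open>Calculus and growth bounds for the powers occurring in the symbol\<close>

lemma integrable_abs_powr_near_0: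
  assumes "- 1 < a"
  shows "integrable lborel (\<lambda>y::real. indicator {-1..1} y * \<bar>y\<bar> powr a)"
proof -
  have "set_integrable lebesgue {0..1} (\<lambda>y::real. y powr a)"
    using assms by (intro nonnegative_absolutely_integrable_1 integrable_on_powr_from_0) auto
  then have i: "integrable lborel (\<lambda>y::real. indicator {0..1} y * y powr a)"
    unfolding set_integrable_def by (subst (asm) integrable_completion) auto
  from lborel_integrable_real_affine[OF this, of "-1" 0]
  have i': "integrable lborel (\<lambda>y::real. indicator {0..1} (-y) * (-y) powr a)" by simp
  have "integrable lborel (\<lambda>y::real. indicator {0..1} y * y powr a + indicator {0..1} (-y) * (-y) powr a)"
    by (intro Bochner_Integration.integrable_add i i')
  moreover have "(\<lambda>y::real. indicator {0..1} y * y powr a + indicator {0..1} (-y) * (-y) powr a)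
    = (\<lambda>y. indicator {-1..1} y * \<bar>y\<bar> powr a)"
    by (rule ext) (auto simp: indicator_def)
  ultimately show ?thesis by simp
qed

lemma DERIV_abs_powr:
  fixes r y :: real
  assumes r: "1 < r"
  shows "((\<lambda>y. \<bar>y\<bar> powr r) has_real_derivative r * sgn y * \<bar>y\<bar> powr (r - 1)) (at y)"
proof -
  consider "0 < y" | "y < 0" | "y = 0" by linarith
  then show ?thesis
  proof cases
    case 1
    have "((\<lambda>y. y powr r) has_real_derivative r * y powr (r - 1)) (at y)"
      using 1 by (rule has_real_derivative_powr)
    then show ?thesis
      using 1 by (subst DERIV_cong_ev[OF refl _ refl, of _ "\<lambda>y. y powr r"])
        (auto intro!: eventually_mono[OF eventually_nhds_in_open[of "{0<..}"]])
  next
    case 2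
    have "((\<lambda>y. (-y) powr r) has_real_derivative r * (- y) powr (r - 1) * (- 1)) (at y)"
      using 2 by (intro DERIV_chain2[of "\<lambda>y. y powr r"] has_real_derivative_powr) (auto intro!: derivative_eq_intros)
    then show ?thesis
      using 2 by (subst DERIV_cong_ev[OF refl _ refl, of _ "\<lambda>y. (-y) powr r"])
        (auto intro!: eventually_mono[OF eventually_nhds_in_open[of "{..<0}"]])
  next
    \<comment> \<open>At the kink the claimed derivative is 0 because \<open>sgn 0 = 0\<close>; the
      difference quotient is at most |h| to the power r - 1, which tends to 0 as r > 1.\<close>
    case 3
    have "((\<lambda>h::real. \<bar>h\<bar> powr (r - 1)) \<longlongrightarrow> 0) (at 0)"
      using r by (auto intro!: tendsto_eq_intros)
    then have "((\<lambda>h::real. \<bar>h\<bar> powr r / h) \<longlongrightarrow> 0) (at 0)"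
    proof (rule Lim_null_comparison[rotated])
      show "\<forall>\<^sub>F h::real in at 0. norm (\<bar>h\<bar> powr r / h) \<le> \<bar>h\<bar> powr (r - 1)"
        by (auto simp: eventually_at_filter powr_diff)
    qed
    then show ?thesis using 3 by (simp add: has_field_derivative_iff)
  qed
qed

lemma DERIV_sgn_abs_powr:
  fixes r y :: real
  assumes "y \<noteq> 0"
  shows "((\<lambda>y. sgn y * \<bar>y\<bar> powr (r - 1)) has_real_derivative (r - 1) * \<bar>y\<bar> powr (r - 2)) (at y)"
proof (cases "0 < y")
  case True
  have "((\<lambda>y. y powr (r - 1)) has_real_derivative (r - 1) * y powr (r - 1 - 1)) (at y)"
    using True by (rule has_real_derivative_powr)
  then show ?thesis
    using True by (subst DERIV_cong_ev[OF refl _ refl, of _ "\<lambda>y. y powr (r - 1)"])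
      (auto intro!: eventually_mono[OF eventually_nhds_in_open[of "{0<..}"]])
next
  case False
  then have y: "y < 0" using assms by simp
  have "((\<lambda>y. - ((-y) powr (r - 1))) has_real_derivative - ((r - 1) * (- y) powr (r - 1 - 1) * (- 1))) (at y)"
    using y by (intro DERIV_minus DERIV_chain2[of "\<lambda>y. y powr (r - 1)"] has_real_derivative_powr) (auto intro!: derivative_eq_intros)
  then show ?thesis
    using y by (subst DERIV_cong_ev[OF refl _ refl, of _ "\<lambda>y. - ((-y) powr (r - 1))"])
      (auto intro!: eventually_mono[OF eventually_nhds_in_open[of "{..<0}"]])
qed

lemma isCont_sgn_abs_powr:
  fixes r y :: real
  assumes "1 < r"
  shows "isCont (\<lambda>y. sgn y * \<bar>y\<bar> powr (r - 1)) y"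
proof (cases "y = 0")
  case True
  have "((\<lambda>h::real. \<bar>h\<bar> powr (r - 1)) \<longlongrightarrow> 0) (at 0)"
    using assms by (auto intro!: tendsto_eq_intros)
  then have "((\<lambda>h::real. sgn h * \<bar>h\<bar> powr (r - 1)) \<longlongrightarrow> 0) (at 0)"
    by (rule Lim_null_comparison[rotated]) (auto simp: eventually_at_filter abs_mult abs_sgn_eq)
  then show ?thesis using True by (simp add: isCont_def)
qed (use DERIV_sgn_abs_powr DERIV_isCont in blast)

lemma abs_powr_le:
  fixes y a :: real
  assumes "0 < a" "a \<le> 2"
  shows "\<bar>y\<bar> powr a \<le> 1 + y\<^sup>2"
proof (cases "\<bar>y\<bar> \<le> 1")
  case True
  then have "\<bar>y\<bar> powr a \<le> 1" using assms by (intro powr_le1) auto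
  then show ?thesis by (smt (verit) zero_le_power2)
next
  case False
  then have "\<bar>y\<bar> powr a \<le> \<bar>y\<bar> powr 2" using assms by (intro powr_mono) auto
  also have "\<dots> = y\<^sup>2" using False by simp
  finally show ?thesis by simp
qed


lemma abs_shift_powr_le:
  fixes \<xi> k a :: real
  assumes "0 < a" "a \<le> 2"
  shows "\<bar>\<xi> + k\<bar> powr a \<le> (2 + 2 * k\<^sup>2) * (1 + \<xi>\<^sup>2)"
proof -
  have "(2 + 2 * k\<^sup>2) * (1 + \<xi>\<^sup>2) - (1 + (\<xi> + k)\<^sup>2) = 1 + (\<xi> - k)\<^sup>2 + 2 * (k\<^sup>2 * \<xi>\<^sup>2)"
    by (simp add: power2_eq_square algebra_simps)
  moreover have "0 \<le> 1 + (\<xi> - k)\<^sup>2 + 2 * (k\<^sup>2 * \<xi>\<^sup>2)" by simp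
  ultimately show ?thesis using abs_powr_le[OF assms, of "\<xi> + k"] by linarith
qed

lemma abs_le_1_plus_square: "\<bar>\<xi>\<bar> \<le> 1 + \<xi>\<^sup>2" for \<xi> :: real
  using zero_le_power2[of "\<bar>\<xi>\<bar> - 1"] by (simp add: power2_eq_square algebra_simps)

lemma symP_bound:
  assumes \<sigma>: "1/2 < \<sigma>" "\<sigma> < 1"
  shows "\<bar>symP \<sigma> k \<xi>\<bar> \<le> (2 + 2 * k\<^sup>2 + \<bar>k\<bar> powr (2 * \<sigma>) + \<bar>2 * \<sigma> * \<bar>k\<bar> powr (2 * \<sigma> - 2) * k\<bar>) * (1 + \<xi>\<^sup>2)"
proof -
  define c where "c = 2 * \<sigma> * \<bar>k\<bar> powr (2 * \<sigma> - 2) * k"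
  have "\<bar>symP \<sigma> k \<xi>\<bar> \<le> \<bar>\<xi> + k\<bar> powr (2 * \<sigma>) + \<bar>k\<bar> powr (2 * \<sigma>) * 1 + \<bar>c\<bar> * \<bar>\<xi>\<bar>"
    unfolding symP_def c_def[symmetric]
    using abs_mult[of c \<xi>] powr_ge_zero[of "\<bar>\<xi> + k\<bar>" "2 * \<sigma>"] powr_ge_zero[of "\<bar>k\<bar>" "2 * \<sigma>"] by linarith
  also have "\<dots> \<le> (2 + 2 * k\<^sup>2) * (1 + \<xi>\<^sup>2) + \<bar>k\<bar> powr (2 * \<sigma>) * (1 + \<xi>\<^sup>2) + \<bar>c\<bar> * (1 + \<xi>\<^sup>2)"
    using \<sigma> by (intro add_mono abs_shift_powr_le mult_left_mono abs_le_1_plus_square) auto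
  finally show ?thesis unfolding c_def distrib_right[symmetric] .
qed

lemma isCont_symP:
  assumes "1/2 < \<sigma>"
  shows "isCont (symP \<sigma> k) \<xi>"
proof -
  have 1: "isCont (\<lambda>\<xi>. \<bar>\<xi> + k\<bar> powr (2 * \<sigma>)) \<xi>"
    by (rule isCont_o2[OF _ DERIV_isCont[OF DERIV_abs_powr]]) (use assms in \<open>auto intro!: continuous_intros\<close>)
  have 2: "isCont (\<lambda>\<xi>. 2 * \<sigma> * \<bar>k\<bar> powr (2 * \<sigma> - 2) * k * \<xi>) \<xi>"
    by (rule isCont_mult[OF continuous_const continuous_ident])
  from isCont_diff[OF isCont_diff[OF 1 continuous_const] 2] show ?thesis
    unfolding symP_def[abs_def] .
qed

lemma norm_mult_decay:
  fixes a b :: complex and \<xi> :: real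
  assumes "cmod a \<le> K * (1 + \<xi>\<^sup>2)" "cmod b * (1 + \<xi> ^ 4) \<le> C" "0 \<le> K"
  shows "cmod (a * b) * (1 + \<xi>\<^sup>2) \<le> 2 * K * C"
proof -
  have sq: "(1 + \<xi>\<^sup>2) * (1 + \<xi>\<^sup>2) \<le> 2 * (1 + \<xi> ^ 4)"
    using zero_le_power2[of "\<xi>\<^sup>2 - 1"] by (simp add: power2_eq_square power4_eq_xxxx algebra_simps)
  have "cmod (a * b) * (1 + \<xi>\<^sup>2) = cmod a * (cmod b * (1 + \<xi>\<^sup>2))" by (simp add: norm_mult)
  also have "\<dots> \<le> (K * (1 + \<xi>\<^sup>2)) * (cmod b * (1 + \<xi>\<^sup>2))"
    by (intro mult_right_mono assms) auto
  also have "\<dots> = (K * cmod b) * ((1 + \<xi>\<^sup>2) * (1 + \<xi>\<^sup>2))" by (simp only: mult_ac)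
  also have "\<dots> \<le> (K * cmod b) * (2 * (1 + \<xi> ^ 4))"
    using assms by (intro mult_left_mono sq) auto
  also have "\<dots> = 2 * K * (cmod b * (1 + \<xi> ^ 4))" by (simp only: mult_ac)
  also have "\<dots> \<le> 2 * K * C" using assms by (intro mult_left_mono) auto
  finally show ?thesis .
qed

text \<open>P_k of a test function is no longer compactly supported, so its integrability has to be
  earned. The symbol has one continuous derivative, and its second derivative behaves like |\<xi> +
  k|^(2\<sigma> - 2) near -k; \<open>inverse_fourier_decay\<close> then gives decay of order x^(-2),
  and with integrability available \<open>fourier_inversion\<close> identifies the
  transform.\<close>

lemma fmult_symP_aux:
  assumes \<sigma>: "1/2 < \<sigma>" "\<sigma> < 1" and \<phi>: "test_fun \<phi>"
  shows "integrable lborel (fmult (symP \<sigma> k) \<phi>)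
    \<and> (\<forall>\<eta>. fourier (fmult (symP \<sigma> k) \<phi>) \<eta> = complex_of_real (symP \<sigma> k \<eta>) * fourier \<phi> \<eta>)"
proof -
  define r where "r = 2 * \<sigma>"
  have r: "1 < r" "r < 2" using \<sigma> by (auto simp: r_def)
  define c where "c = r * \<bar>k\<bar> powr (r - 2) * k"
  define p where "p = symP \<sigma> k"
  have p: "p \<xi> = \<bar>\<xi> + k\<bar> powr r - \<bar>k\<bar> powr r - c * \<xi>" for \<xi>
    by (simp add: p_def symP_def r_def c_def)
  define p1 where "p1 \<xi> = r * (sgn (\<xi> + k) * \<bar>\<xi> + k\<bar> powr (r - 1)) - c" for \<xi>
  \<comment> \<open>The second derivative away from -k. Its exponent r - 2 exceeds -1 exactly
    because \<sigma> > 1/2, so the singularity is integrable.\<close>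
  define p2 where "p2 \<xi> = r * ((r - 1) * \<bar>\<xi> + k\<bar> powr (r - 2))" for \<xi>
  have dp: "(p has_real_derivative p1 \<xi>) (at \<xi>)" for \<xi>
    unfolding p[abs_def] p1_def
    by (rule derivative_eq_intros DERIV_chain2[OF DERIV_abs_powr[OF r(1)]] refl | simp)+
  have dp1: "(p1 has_real_derivative p2 \<xi>) (at \<xi>)" if "\<xi> \<noteq> - k" for \<xi>
  proof -
    have "((\<lambda>\<xi>. sgn (\<xi> + k) * \<bar>\<xi> + k\<bar> powr (r - 1)) has_real_derivative (r - 1) * \<bar>\<xi> + k\<bar> powr (r - 2) * 1) (at \<xi>)"
      by (rule DERIV_chain2[OF DERIV_sgn_abs_powr]) (use that in \<open>auto intro!: derivative_eq_intros\<close>)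
    from DERIV_diff[OF DERIV_cmult[OF this, of r] DERIV_const[of c]] show ?thesis
      unfolding p1_def[abs_def] p2_def by simp
  qed
  have cp1: "isCont p1 \<xi>" for \<xi>
    unfolding p1_def[abs_def]
    by (intro continuous_intros isCont_o2[OF _ isCont_sgn_abs_powr[OF r(1)], of \<xi> "\<lambda>\<xi>. \<xi> + k"])
  have cp: "isCont p \<xi>" for \<xi> using dp DERIV_isCont by blast
  have cp2: "isCont p2 \<xi>" if "\<xi> \<noteq> - k" for \<xi>
    unfolding p2_def[abs_def] using that by (intro continuous_intros) auto
  define K where "K = 4 + 4 * k\<^sup>2 + \<bar>k\<bar> powr r + \<bar>c\<bar>"
  have K0: "0 \<le> K" by (simp add: K_def)
  have ab: "\<bar>\<xi> + k\<bar> powr a \<le> (2 + 2 * k\<^sup>2) * (1 + \<xi>\<^sup>2)" if "0 < a" "a \<le> 2" for \<xi> a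
    by (rule abs_shift_powr_le[OF that])
  have ge1: "1 \<le> 1 + \<xi>\<^sup>2" for \<xi> :: real by simp
  have pK: "\<bar>p \<xi>\<bar> \<le> K * (1 + \<xi>\<^sup>2)" for \<xi>
  proof (unfold p_def, rule order_trans[OF symP_bound[OF \<sigma>]], rule mult_right_mono)
    show "2 + 2 * k\<^sup>2 + \<bar>k\<bar> powr (2 * \<sigma>) + \<bar>2 * \<sigma> * \<bar>k\<bar> powr (2 * \<sigma> - 2) * k\<bar> \<le> K"
      unfolding K_def c_def r_def by simp
  qed auto
  have p1K: "\<bar>p1 \<xi>\<bar> \<le> K * (1 + \<xi>\<^sup>2)" for \<xi>
  proof -
    have "\<bar>sgn (\<xi> + k) * \<bar>\<xi> + k\<bar> powr (r - 1)\<bar> \<le> \<bar>\<xi> + k\<bar> powr (r - 1)"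
      by (simp add: abs_mult abs_sgn_eq)
    then have "r * \<bar>sgn (\<xi> + k) * \<bar>\<xi> + k\<bar> powr (r - 1)\<bar> \<le> 2 * \<bar>\<xi> + k\<bar> powr (r - 1)"
      using r by (intro mult_mono) auto
    moreover have "\<bar>p1 \<xi>\<bar> \<le> r * \<bar>sgn (\<xi> + k) * \<bar>\<xi> + k\<bar> powr (r - 1)\<bar> + \<bar>c\<bar>"
      unfolding p1_def using r abs_triangle_ineq4[of "r * (sgn (\<xi> + k) * \<bar>\<xi> + k\<bar> powr (r - 1))" c] by (simp add: abs_mult)
    ultimately have "\<bar>p1 \<xi>\<bar> \<le> 2 * \<bar>\<xi> + k\<bar> powr (r - 1) + \<bar>c\<bar> * 1" by linarith
    also have "\<dots> \<le> 2 * ((2 + 2 * k\<^sup>2) * (1 + \<xi>\<^sup>2)) + \<bar>c\<bar> * (1 + \<xi>\<^sup>2)"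
      using r by (intro add_mono ab mult_left_mono ge1) auto
    also have "\<dots> = (4 + 4 * k\<^sup>2 + \<bar>c\<bar>) * (1 + \<xi>\<^sup>2)" by (simp add: algebra_simps)
    also have "\<dots> \<le> K * (1 + \<xi>\<^sup>2)"
      unfolding K_def by (intro mult_right_mono) auto
    finally show ?thesis .
  qed
  define \<phi>1 where "\<phi>1 x = - \<i> * (complex_of_real x * \<phi> x)" for x
  define \<phi>2 where "\<phi>2 x = - \<i> * (complex_of_real x * \<phi>1 x)" for x
  have t1: "test_fun \<phi>1" unfolding \<phi>1_def by (intro test_fun_mult[OF smooth_fun_const] test_fun_x \<phi>)
  have t2: "test_fun \<phi>2" unfolding \<phi>2_def by (intro test_fun_mult[OF smooth_fun_const] test_fun_x t1)
  obtain C0 where C0: "\<And>\<xi>. cmod (fourier \<phi> \<xi>) * (1 + \<xi> ^ 4) \<le> C0" using fourier_decay[OF \<phi>] by metis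
  obtain C1 where C1: "\<And>\<xi>. cmod (fourier \<phi>1 \<xi>) * (1 + \<xi> ^ 4) \<le> C1" using fourier_decay[OF t1] by metis
  obtain C2 where C2: "\<And>\<xi>. cmod (fourier \<phi>2 \<xi>) * (1 + \<xi> ^ 4) \<le> C2" using fourier_decay[OF t2] by metis
  have d\<Phi>: "(fourier \<phi> has_vector_derivative fourier \<phi>1 \<xi>) (at \<xi>)" for \<xi>
    unfolding \<phi>1_def by (rule fourier_deriv[OF \<phi>])
  have d\<Phi>1: "(fourier \<phi>1 has_vector_derivative fourier \<phi>2 \<xi>) (at \<xi>)" for \<xi>
    unfolding \<phi>2_def by (rule fourier_deriv[OF t1])
  have c\<Phi>: "isCont (fourier \<phi>) \<xi>" "isCont (fourier \<phi>1) \<xi>" "isCont (fourier \<phi>2) \<xi>" for \<xi>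
    using fourier_deriv \<phi> t1 t2 has_vector_derivative_continuous by blast+
  define g where "g \<xi> = complex_of_real (p \<xi>) * fourier \<phi> \<xi>" for \<xi>
  define g1 where "g1 \<xi> = complex_of_real (p \<xi>) * fourier \<phi>1 \<xi> + complex_of_real (p1 \<xi>) * fourier \<phi> \<xi>" for \<xi>
  define g2 where "g2 \<xi> = (complex_of_real (p \<xi>) * fourier \<phi>2 \<xi> + complex_of_real (p1 \<xi>) * fourier \<phi>1 \<xi>)
    + (complex_of_real (p1 \<xi>) * fourier \<phi>1 \<xi> + complex_of_real (p2 \<xi>) * fourier \<phi> \<xi>)" for \<xi>
  have vdp: "((\<lambda>\<xi>. complex_of_real (p \<xi>)) has_vector_derivative complex_of_real (p1 \<xi>)) (at \<xi>)" for \<xi>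
    using dp by (intro has_vector_derivative_of_real) (simp add: has_real_derivative_iff_has_vector_derivative)
  have vdp1: "((\<lambda>\<xi>. complex_of_real (p1 \<xi>)) has_vector_derivative complex_of_real (p2 \<xi>)) (at \<xi>)" if "\<xi> \<noteq> - k" for \<xi>
    using dp1[OF that] by (intro has_vector_derivative_of_real) (simp add: has_real_derivative_iff_has_vector_derivative)
  have d0: "(g has_vector_derivative g1 \<xi>) (at \<xi>)" for \<xi>
    unfolding g_def[abs_def] g1_def by (intro has_vector_derivative_mult vdp d\<Phi>)
  have d1: "(g1 has_vector_derivative g2 \<xi>) (at \<xi>)" if "\<xi> \<noteq> - k" for \<xi>
    unfolding g1_def[abs_def] g2_def
    by (intro has_vector_derivative_add has_vector_derivative_mult vdp vdp1 that d\<Phi> d\<Phi>1)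
  have cg: "isCont g \<xi>" for \<xi> using d0 has_vector_derivative_continuous by blast
  have cg1: "isCont g1 \<xi>" for \<xi>
    unfolding g1_def[abs_def] by (intro continuous_intros cp cp1 c\<Phi>)
  have cg2: "isCont g2 \<xi>" if "\<xi> \<noteq> - k" for \<xi>
    unfolding g2_def[abs_def] by (intro continuous_intros cp cp1 cp2[OF that] c\<Phi>)
  have contg: "continuous_on UNIV g" using cg by (simp add: continuous_on_eq_continuous_at)
  have mg: "f \<in> borel_measurable borel" if "\<And>\<xi>. isCont f \<xi>" for f :: "real \<Rightarrow> complex"
    using that by (intro borel_measurable_continuous_onI) (simp add: continuous_at_imp_continuous_on)
  have bp: "cmod (complex_of_real (p \<xi>)) \<le> K * (1 + \<xi>\<^sup>2)" "cmod (complex_of_real (p1 \<xi>)) \<le> K * (1 + \<xi>\<^sup>2)" for \<xi>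
    using pK p1K by auto
  note dec = norm_mult_decay[OF bp(1) C0 K0] norm_mult_decay[OF bp(1) C1 K0] norm_mult_decay[OF bp(1) C2 K0]
     norm_mult_decay[OF bp(2) C0 K0] norm_mult_decay[OF bp(2) C1 K0]
  have bg: "cmod (g \<xi>) * (1 + \<xi>\<^sup>2) \<le> 2 * K * C0" for \<xi> unfolding g_def by (rule dec)
  have bg1: "cmod (g1 \<xi>) * (1 + \<xi>\<^sup>2) \<le> 2 * K * C1 + 2 * K * C0" for \<xi>
  proof -
    have "cmod (g1 \<xi>) * (1 + \<xi>\<^sup>2) \<le> (cmod (complex_of_real (p \<xi>) * fourier \<phi>1 \<xi>) + cmod (complex_of_real (p1 \<xi>) * fourier \<phi> \<xi>)) * (1 + \<xi>\<^sup>2)"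
      unfolding g1_def by (intro mult_right_mono norm_triangle_ineq) auto
    then show ?thesis using dec(2,4)[of \<xi>] unfolding distrib_right by linarith
  qed
  have ig: "integrable lborel g" by (rule integrable_of_decay[OF mg[OF cg] bg])
  have ip\<Phi>2: "integrable lborel (\<lambda>\<xi>. complex_of_real (p \<xi>) * fourier \<phi>2 \<xi>)"
    by (rule integrable_of_decay[OF mg dec(3)]) (intro continuous_intros cp c\<Phi>)
  have ip\<Phi>1: "integrable lborel (\<lambda>\<xi>. complex_of_real (p1 \<xi>) * fourier \<phi>1 \<xi>)"
    by (rule integrable_of_decay[OF mg dec(5)]) (intro continuous_intros cp1 c\<Phi>)
  have [measurable]: "fourier \<phi> \<in> borel_measurable borel" by (rule mg[OF c\<Phi>(1)])
  have b\<Phi>: "cmod (fourier \<phi> \<xi>) \<le> C0" for \<xi>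
  proof -
    have "cmod (fourier \<phi> \<xi>) * 1 \<le> cmod (fourier \<phi> \<xi>) * (1 + \<xi> ^ 4)"
      by (intro mult_left_mono) auto
    then show ?thesis using C0[of \<xi>] by linarith
  qed
  have i\<Phi>: "integrable lborel (fourier \<phi>)"
  proof (rule integrable_of_decay[of _ "2 * 1 * C0"])
    show "cmod (fourier \<phi> \<xi>) * (1 + \<xi>\<^sup>2) \<le> 2 * 1 * C0" for \<xi>
      using norm_mult_decay[of 1 1 \<xi>, OF _ C0] by simp
  qed auto
  \<comment> \<open>Within distance 1 of -k the transform is bounded by \<open>C0\<close> and the
    singular power is integrable; further away the power is at most 1 and the transform itself is
    integrable.\<close>
  have ip2: "integrable lborel (\<lambda>\<xi>. complex_of_real (p2 \<xi>) * fourier \<phi> \<xi>)"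
  proof (rule Bochner_Integration.integrable_bound)
    have "integrable lborel (\<lambda>\<xi>. indicator {-1..1} (k + 1 * \<xi>) * \<bar>k + 1 * \<xi>\<bar> powr (r - 2))"
      by (rule lborel_integrable_real_affine[OF integrable_abs_powr_near_0]) (use r in auto)
    then show "integrable lborel (\<lambda>\<xi>. r * (r - 1) * (C0 * (indicator {-1..1} (k + 1 * \<xi>) * \<bar>k + 1 * \<xi>\<bar> powr (r - 2)) + cmod (fourier \<phi> \<xi>)))"
      by (intro integrable_mult_right Bochner_Integration.integrable_add integrable_norm i\<Phi>)
    show "(\<lambda>\<xi>. complex_of_real (p2 \<xi>) * fourier \<phi> \<xi>) \<in> borel_measurable lborel"
      unfolding p2_def by measurable
    show "AE \<xi> in lborel. norm (complex_of_real (p2 \<xi>) * fourier \<phi> \<xi>) \<le>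
      norm (r * (r - 1) * (C0 * (indicator {-1..1} (k + 1 * \<xi>) * \<bar>k + 1 * \<xi>\<bar> powr (r - 2)) + cmod (fourier \<phi> \<xi>)))"
    proof (rule AE_I2)
      fix \<xi>
      have C00: "0 \<le> C0" using b\<Phi>[of \<xi>] norm_ge_zero order_trans by blast
      have key: "\<bar>\<xi> + k\<bar> powr (r - 2) * cmod (fourier \<phi> \<xi>)
         \<le> C0 * (indicator {-1..1} (k + 1 * \<xi>) * \<bar>k + 1 * \<xi>\<bar> powr (r - 2)) + cmod (fourier \<phi> \<xi>)"
      proof (cases "\<bar>\<xi> + k\<bar> \<le> 1")
        case True
        have "\<bar>\<xi> + k\<bar> powr (r - 2) * cmod (fourier \<phi> \<xi>) \<le> \<bar>\<xi> + k\<bar> powr (r - 2) * C0"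
          by (intro mult_left_mono b\<Phi>) auto
        moreover have "indicator {-1..1} (k + 1 * \<xi>) = (1::real)" using True by (auto simp: indicator_def)
        ultimately show ?thesis by (simp add: add.commute[of k] mult.commute[of C0] add_increasing2)
      next
        case False
        then have "\<bar>\<xi> + k\<bar> powr (r - 2) \<le> \<bar>\<xi> + k\<bar> powr 0" using r by (intro powr_mono) auto
        then have "\<bar>\<xi> + k\<bar> powr (r - 2) * cmod (fourier \<phi> \<xi>) \<le> 1 * cmod (fourier \<phi> \<xi>)"
          by (intro mult_right_mono) (auto split: if_splits)
        then show ?thesis using C00 by (simp add: add_increasing)
      qed
      have "0 \<le> p2 \<xi>" using r by (simp add: p2_def)
      then have "norm (complex_of_real (p2 \<xi>) * fourier \<phi> \<xi>) = p2 \<xi> * cmod (fourier \<phi> \<xi>)"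
        by (simp add: norm_mult)
      also have "\<dots> = r * (r - 1) * (\<bar>\<xi> + k\<bar> powr (r - 2) * cmod (fourier \<phi> \<xi>))"
        by (simp only: p2_def mult.assoc)
      also have "\<dots> \<le> r * (r - 1) * (C0 * (indicator {-1..1} (k + 1 * \<xi>) * \<bar>k + 1 * \<xi>\<bar> powr (r - 2)) + cmod (fourier \<phi> \<xi>))"
        using r by (intro mult_left_mono key) auto
      finally show "norm (complex_of_real (p2 \<xi>) * fourier \<phi> \<xi>) \<le>
         norm (r * (r - 1) * (C0 * (indicator {-1..1} (k + 1 * \<xi>) * \<bar>k + 1 * \<xi>\<bar> powr (r - 2)) + cmod (fourier \<phi> \<xi>)))"
        by simp
    qed
  qed
  have ig2: "integrable lborel g2"
    unfolding g2_def by (intro Bochner_Integration.integrable_add ip\<Phi>2 ip\<Phi>1 ip2)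
  have dx: "cmod (LINT \<xi>|lborel. iexp (x * \<xi>) * g \<xi>) * x\<^sup>2 \<le> (LINT \<xi>|lborel. cmod (g2 \<xi>))" for x
    using d0 d1 cg1 cg2 ig ig2 tendsto_of_decay[OF bg] tendsto_of_decay[OF bg1]
    by (rule inverse_fourier_decay)
  have b0: "cmod (LINT \<xi>|lborel. iexp (x * \<xi>) * g \<xi>) \<le> (LINT \<xi>|lborel. cmod (g \<xi>))" for x
    by (rule order_trans[OF integral_norm_bound]) (simp add: norm_mult)
  have fm: "fmult (symP \<sigma> k) \<phi> x = complex_of_real (1 / (2 * pi)) * (LINT \<xi>|lborel. iexp (x * \<xi>) * g \<xi>)" for x
    unfolding fmult_def g_def p_def by (simp only: mult.assoc)
  have [measurable]: "g \<in> borel_measurable borel" by (rule mg[OF cg])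
  have ifm: "integrable lborel (fmult (symP \<sigma> k) \<phi>)"
  proof (rule integrable_of_decay)
    show "fmult (symP \<sigma> k) \<phi> \<in> borel_measurable borel"
      unfolding fm[abs_def] by measurable
    fix x
    have n: "cmod (complex_of_real (1 / (2 * pi))) = 1 / (2 * pi)" unfolding norm_of_real by simp
    have "cmod (fmult (symP \<sigma> k) \<phi> x) * (1 + x\<^sup>2)
      = 1 / (2 * pi) * (cmod (LINT \<xi>|lborel. iexp (x * \<xi>) * g \<xi>) + cmod (LINT \<xi>|lborel. iexp (x * \<xi>) * g \<xi>) * x\<^sup>2)"
      unfolding fm norm_mult n by (simp only: distrib_left mult.assoc mult_1_right)
    also have "\<dots> \<le> 1 / (2 * pi) * ((LINT \<xi>|lborel. cmod (g \<xi>)) + (LINT \<xi>|lborel. cmod (g2 \<xi>)))"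
      by (intro mult_left_mono add_mono b0 dx) auto
    finally show "cmod (fmult (symP \<sigma> k) \<phi> x) * (1 + x\<^sup>2)
       \<le> 1 / (2 * pi) * ((LINT \<xi>|lborel. cmod (g \<xi>)) + (LINT \<xi>|lborel. cmod (g2 \<xi>)))" .
  qed
  have bdd: "cmod (g \<xi>) \<le> 2 * K * C0" for \<xi>
  proof -
    have "cmod (g \<xi>) * 1 \<le> cmod (g \<xi>) * (1 + \<xi>\<^sup>2)" by (intro mult_left_mono) auto
    then show ?thesis using bg[of \<xi>] by linarith
  qed
  have "fourier (fmult (symP \<sigma> k) \<phi>) \<eta> = g \<eta>" for \<eta>
    by (rule fourier_inversion[OF contg ig bdd fm ifm])
  then show ?thesis using ifm by (simp add: g_def p_def)
qed

lemmas integrable_fmult_symP = fmult_symP_aux[THEN conjunct1]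
  and fourier_fmult_symP = fmult_symP_aux[THEN conjunct2, rule_format]

section \<open>Truncated periodic ground states\<close>

text \<open>For a supported in \<open>{-N..N}\<close> this is the coefficient at frequency s of u^2,
  where u is the trigonometric polynomial with coefficients a.\<close>

definition selfconv :: "int \<Rightarrow> (int \<Rightarrow> real) \<Rightarrow> int \<Rightarrow> real" where
  "selfconv N a s = (\<Sum>i\<in>{-N..N}. a i * a (s - i))"

definition quartic :: "int \<Rightarrow> (int \<Rightarrow> real) \<Rightarrow> real" where
  "quartic N a = (\<Sum>s\<in>{-2*N..2*N}. (selfconv N a s)\<^sup>2)"

text \<open>For real a supported in \<open>{-N..N}\<close> this is the coefficient at frequency n of
  |u|^2 u: the factor with index l = i + j - n comes from the conjugate of u.\<close>

definition cubic :: "int \<Rightarrow> (int \<Rightarrow> real) \<Rightarrow> int \<Rightarrow> real" where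
  "cubic N a n = (\<Sum>i\<in>{-N..N}. \<Sum>j\<in>{-N..N}. a i * a j * a (i + j - n))"

text \<open>A shift of the index moves a sum off the box \<open>{-N..N}\<close>, but the summand
  vanishes off the box, so nothing changes as long as the shifted range covers it. The inequality
  that follows is for nonnegative summands and ranges that may miss part of the box.\<close>

lemma sum_reindex_supp_eq:
  fixes f :: "'b \<Rightarrow> 'c::comm_monoid_add"
  assumes "finite A" "inj_on g A" "I \<subseteq> g ` A" "\<And>x. x \<notin> I \<Longrightarrow> f x = 0"
  shows "(\<Sum>x\<in>A. f (g x)) = sum f I"
proof -
  have "(\<Sum>x\<in>A. f (g x)) = sum f (g ` A)"
    using assms by (simp add: sum.reindex)
  also have "\<dots> = sum f I"
    by (rule sum.mono_neutral_right) (use assms in auto)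
  finally show ?thesis .
qed

lemma sum_reindex_supp_le:
  fixes f :: "'b \<Rightarrow> real"
  assumes "finite A" "inj_on g A" "finite I" "\<And>x. 0 \<le> f x" "\<And>x. x \<notin> I \<Longrightarrow> f x = 0"
  shows "(\<Sum>x\<in>A. f (g x)) \<le> sum f I"
proof -
  have "(\<Sum>x\<in>A. f (g x)) = sum f (g ` A)"
    using assms by (simp add: sum.reindex)
  also have "\<dots> = sum f (g ` A \<inter> I)"
    by (rule sum.mono_neutral_right) (use assms in auto)
  also have "\<dots> \<le> sum f I"
    by (rule sum_mono2) (use assms in auto)
  finally show ?thesis .
qed

text \<open>Reads |u|^2 u as u^2 times the conjugate of u, with s = i + j as the frequency of
  u^2.\<close>

lemma cubic_eq_selfconv:
  assumes "\<forall>n. n \<notin> {-N..N} \<longrightarrow> a n = 0"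
  shows "(\<Sum>s\<in>{-2*N..2*N}. selfconv N a s * a (s - n)) = cubic N a n"
proof -
  have "(\<Sum>s\<in>{-2*N..2*N}. selfconv N a s * a (s - n))
      = (\<Sum>i\<in>{-N..N}. \<Sum>s\<in>{-2*N..2*N}. a i * a (s - i) * a (s - n))"
    unfolding selfconv_def sum_distrib_right by (rule sum.swap)
  also have "\<dots> = cubic N a n"
    unfolding cubic_def
  proof (rule sum.cong)
    fix i assume i: "i \<in> {-N..N}"
    have "(\<Sum>s\<in>{-2*N..2*N}. (\<lambda>j. a i * a j * a (i + j - n)) (s - i)) = (\<Sum>j\<in>{-N..N}. a i * a j * a (i + j - n))"
    proof (rule sum_reindex_supp_eq)
      show "{-N..N} \<subseteq> (\<lambda>s. s - i) ` {-2*N..2*N}"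
      proof
        fix x assume "x \<in> {-N..N}"
        then show "x \<in> (\<lambda>s. s - i) ` {-2*N..2*N}"
          using i by (intro image_eqI[of _ _ "x + i"]) auto
      qed
    qed (use assms in \<open>auto simp: inj_on_def\<close>)
    then show "(\<Sum>s\<in>{-2*N..2*N}. a i * a (s - i) * a (s - n)) = (\<Sum>j\<in>{-N..N}. a i * a j * a (i + j - n))"
      by simp
  qed simp
  finally show ?thesis .
qed

text \<open>Pairing |u|^2 u with u gives the integral of |u|^4. On coefficients: sum first over n,
  and \<open>cubic\<close> becomes a second copy of \<open>selfconv\<close>.\<close>

lemma quartic_eq_cubic:
  assumes "\<forall>n. n \<notin> {-N..N} \<longrightarrow> a n = 0"
  shows "quartic N a = (\<Sum>n\<in>{-N..N}. a n * cubic N a n)"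
proof -
  have "(\<Sum>n\<in>{-N..N}. a n * cubic N a n)
      = (\<Sum>n\<in>{-N..N}. \<Sum>s\<in>{-2*N..2*N}. selfconv N a s * (a n * a (s - n)))"
    by (simp add: cubic_eq_selfconv[OF assms, symmetric] sum_distrib_left algebra_simps)
  also have "\<dots> = (\<Sum>s\<in>{-2*N..2*N}. selfconv N a s * selfconv N a s)"
    unfolding sum.swap[of _ _ "{-N..N}"] by (simp add: selfconv_def sum_distrib_left)
  finally show ?thesis by (simp add: quartic_def power2_eq_square)
qed

lemma selfconv_le:
  assumes "\<forall>n. n \<notin> {-N..N} \<longrightarrow> a n = 0"
  shows "selfconv N a s \<le> (\<Sum>n\<in>{-N..N}. (a n)\<^sup>2)"
proof -
  have "2 * selfconv N a s \<le> (\<Sum>i\<in>{-N..N}. (a i)\<^sup>2 + (a (s - i))\<^sup>2)"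
    unfolding selfconv_def sum_distrib_left
    by (rule sum_mono) (use sum_squares_bound in \<open>force simp: mult.assoc\<close>)
  also have "\<dots> \<le> (\<Sum>i\<in>{-N..N}. (a i)\<^sup>2) + (\<Sum>i\<in>{-N..N}. (a i)\<^sup>2)"
    unfolding sum.distrib
    using sum_reindex_supp_le[of "{-N..N}" "\<lambda>i. s - i" "{-N..N}" "\<lambda>i. (a i)\<^sup>2"] assms
    by (auto simp: inj_on_def)
  finally show ?thesis by simp
qed

lemma sum_shift_le:
  fixes f :: "int \<Rightarrow> real"
  assumes "finite A" "\<And>n. 0 \<le> f n" "\<forall>n. n \<notin> {-N..N} \<longrightarrow> f n = 0"
  shows "(\<Sum>s\<in>A. f (s - n)) \<le> sum f {-N..N}"
  using sum_reindex_supp_le[of A "\<lambda>s. s - n" "{-N..N}" f] assms by (auto simp: inj_on_def)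

lemma cubic_le:
  assumes a0: "\<And>n. 0 \<le> a n" and supp: "\<forall>n. n \<notin> {-N..N} \<longrightarrow> a n = 0"
  shows "cubic N a n \<le> (\<Sum>n\<in>{-N..N}. (a n)\<^sup>2) * (\<Sum>n\<in>{-N..N}. a n)"
proof -
  have "cubic N a n \<le> (\<Sum>s\<in>{-2*N..2*N}. (\<Sum>n\<in>{-N..N}. (a n)\<^sup>2) * a (s - n))"
    unfolding cubic_eq_selfconv[of N a, OF supp, symmetric]
    by (intro sum_mono mult_right_mono selfconv_le supp a0)
  also have "\<dots> \<le> (\<Sum>n\<in>{-N..N}. (a n)\<^sup>2) * (\<Sum>n\<in>{-N..N}. a n)"
    unfolding sum_distrib_left[symmetric]
    by (intro mult_left_mono sum_shift_le sum_nonneg) (use a0 supp in auto)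
  finally show ?thesis .
qed

lemma cubic_nonneg:
  assumes "\<And>n. 0 \<le> a n"
  shows "0 \<le> cubic N a n"
  unfolding cubic_def using assms by (intro sum_nonneg mult_nonneg_nonneg)

lemma quartic_nonneg: "0 \<le> quartic N a"
  unfolding quartic_def by (intro sum_nonneg) auto

text \<open>On the level of functions: the integral of |u|^4 is at most u(0)^2 times that of |u|^2,
  the sum of nonnegative coefficients being the maximum u(0). This inequality yields the lower bound
  for u(0).\<close>

lemma quartic_le:
  assumes a0: "\<And>n. 0 \<le> a n" and supp: "\<forall>n. n \<notin> {-N..N} \<longrightarrow> a n = 0"
  shows "quartic N a \<le> (\<Sum>n\<in>{-N..N}. (a n)\<^sup>2) * (\<Sum>n\<in>{-N..N}. a n)\<^sup>2"
proof -
  have "quartic N a \<le> (\<Sum>n\<in>{-N..N}. a n * ((\<Sum>n\<in>{-N..N}. (a n)\<^sup>2) * (\<Sum>n\<in>{-N..N}. a n)))"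
    unfolding quartic_eq_cubic[of N a, OF supp]
    by (intro sum_mono mult_left_mono cubic_le a0 supp)
  then show ?thesis by (simp add: sum_distrib_right[symmetric] power2_eq_square algebra_simps)
qed

text \<open>A submultiplicative weight at n = i + j - l can be distributed over the three factors,
  after which the sum over n is a shifted sum. Used with powers of 1 + |h n| for the moments and
  with weight 1 for the frequencies beyond the cutoff, hence the arbitrary finite range
  \<open>A\<close>.\<close>

lemma sum_weight_cubic_le:
  fixes v :: "int \<Rightarrow> real"
  assumes a0: "\<And>n. 0 \<le> a n" and supp: "\<forall>n. n \<notin> {-N..N} \<longrightarrow> a n = 0"
    and v0: "\<And>n. 0 \<le> v n" and v: "\<And>i j l. v (i + j - l) \<le> v i * v j * v l" and "finite A"
  shows "(\<Sum>n\<in>A. v n * cubic N a n) \<le> (\<Sum>n\<in>{-N..N}. v n * a n) ^ 3"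
proof -
  let ?S = "\<Sum>n\<in>{-N..N}. v n * a n"
  have S0: "0 \<le> ?S" using a0 v0 by (intro sum_nonneg) auto
  have "(\<Sum>n\<in>A. v n * cubic N a n) 
     \<le> (\<Sum>n\<in>A. \<Sum>i\<in>{-N..N}. \<Sum>j\<in>{-N..N}. (v i * a i) * (v j * a j) * (v (i + j - n) * a (i + j - n)))"
    unfolding cubic_def sum_distrib_left
  proof (intro sum_mono)
    fix n i j
    have "v n * (a i * a j * a (i + j - n)) \<le> (v i * v j * v (i + j - n)) * (a i * a j * a (i + j - n))"
      using v[of i j "i + j - n"] a0 by (intro mult_right_mono) auto
    then show "v n * (a i * a j * a (i + j - n)) \<le> (v i * a i) * (v j * a j) * (v (i + j - n) * a (i + j - n))"
      by (simp add: algebra_simps)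
  qed
  also have "\<dots> = (\<Sum>i\<in>{-N..N}. \<Sum>j\<in>{-N..N}. \<Sum>n\<in>A. (v i * a i) * (v j * a j) * (v (i + j - n) * a (i + j - n)))"
    by (subst sum.swap, rule sum.cong[OF refl], rule sum.swap)
  also have "\<dots> \<le> (\<Sum>i\<in>{-N..N}. \<Sum>j\<in>{-N..N}. (v i * a i) * (v j * a j) * ?S)"
  proof (intro sum_mono)
    fix i j
    have "(\<Sum>n\<in>A. v (i + j - n) * a (i + j - n)) \<le> ?S"
      using sum_reindex_supp_le[of A "\<lambda>n. i + j - n" "{-N..N}" "\<lambda>n. v n * a n"] assms
      by (auto simp: inj_on_def)
    then show "(\<Sum>n\<in>A. (v i * a i) * (v j * a j) * (v (i + j - n) * a (i + j - n))) \<le> (v i * a i) * (v j * a j) * ?S"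
      unfolding sum_distrib_left[symmetric] using a0 v0 by (intro mult_left_mono) auto
  qed
  also have "\<dots> = ?S ^ 3"
    by (simp add: sum_distrib_left[symmetric] sum_distrib_right[symmetric] power3_eq_cube)
  finally show ?thesis .
qed

text \<open>Collects the expanded triple product by its output frequency n = i + j - l, which ranges
  up to 3N although the factors stop at N.\<close>

lemma sum_triple_cubic:
  fixes f :: "int \<Rightarrow> complex"
  assumes supp: "\<forall>n. n \<notin> {-N..N} \<longrightarrow> a n = 0"
  shows "(\<Sum>i\<in>{-N..N}. \<Sum>j\<in>{-N..N}. \<Sum>l\<in>{-N..N}. of_real (a i * a j * a l) * f (i + j - l))
    = (\<Sum>n\<in>{-3*N..3*N}. of_real (cubic N a n) * f n)"
proof -
  have "(\<Sum>n\<in>{-3*N..3*N}. of_real (cubic N a n) * f n)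
    = (\<Sum>n\<in>{-3*N..3*N}. \<Sum>i\<in>{-N..N}. \<Sum>j\<in>{-N..N}. of_real (a i * a j * a (i + j - n)) * f n)"
    by (simp add: cubic_def sum_distrib_right)
  also have "\<dots> = (\<Sum>i\<in>{-N..N}. \<Sum>j\<in>{-N..N}. \<Sum>n\<in>{-3*N..3*N}. of_real (a i * a j * a (i + j - n)) * f n)"
    by (subst sum.swap, rule sum.cong[OF refl], rule sum.swap)
  also have "\<dots> = (\<Sum>i\<in>{-N..N}. \<Sum>j\<in>{-N..N}. \<Sum>l\<in>{-N..N}. of_real (a i * a j * a l) * f (i + j - l))"
  proof (rule sum.cong[OF refl], rule sum.cong[OF refl])
    fix i j assume ij: "i \<in> {-N..N}" "j \<in> {-N..N}"
    have "(\<Sum>n\<in>{-3*N..3*N}. (\<lambda>l. of_real (a i * a j * a l) * f (i + j - l)) (i + j - n))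
      = (\<Sum>l\<in>{-N..N}. of_real (a i * a j * a l) * f (i + j - l))"
    proof (rule sum_reindex_supp_eq)
      show "{-N..N} \<subseteq> (\<lambda>n. i + j - n) ` {-3*N..3*N}"
      proof
        fix x assume "x \<in> {-N..N}"
        then show "x \<in> (\<lambda>n. i + j - n) ` {-3*N..3*N}"
          using ij by (intro image_eqI[of _ _ "i + j - x"]) auto
      qed
    qed (use supp in \<open>auto simp: inj_on_def\<close>)
    then show "(\<Sum>n\<in>{-3*N..3*N}. of_real (a i * a j * a (i + j - n)) * f n)
      = (\<Sum>l\<in>{-N..N}. of_real (a i * a j * a l) * f (i + j - l))" by simp
  qed
  finally show ?thesis ..
qed

text \<open>Changing the single coefficient n by t gives two equal cross terms, and the square of
  the change contributes only at frequency 2n. This is the expansion differentiated in the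
  Euler-Lagrange equation.\<close>

lemma selfconv_upd:
  assumes supp: "\<forall>n. n \<notin> {-N..N} \<longrightarrow> a n = 0" and n: "n \<in> {-N..N}"
  shows "selfconv N (a(n := a n + t)) s = selfconv N a s + 2 * t * a (s - n) + t\<^sup>2 * (if s = 2 * n then 1 else 0)"
proof -
  define d where "d i = (if i = n then 1 else 0 :: real)" for i
  have upd: "(a(n := a n + t)) i = a i + t * d i" for i by (simp add: d_def)
  have "selfconv N (a(n := a n + t)) s = selfconv N a s + t * (\<Sum>i\<in>{-N..N}. d i * a (s - i))
     + t * (\<Sum>i\<in>{-N..N}. a i * d (s - i)) + t\<^sup>2 * (\<Sum>i\<in>{-N..N}. d i * d (s - i))"
    unfolding selfconv_def upd
    by (simp add: sum.distrib[symmetric] sum_distrib_left algebra_simps power2_eq_square)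
  moreover have "(\<Sum>i\<in>{-N..N}. d i * g i) = g n" for g :: "int \<Rightarrow> real"
  proof -
    have "(\<Sum>i\<in>{-N..N}. d i * g i) = (\<Sum>i\<in>{-N..N}. if i = n then g i else 0)"
      by (intro sum.cong) (auto simp: d_def)
    then show ?thesis using n by simp
  qed
  moreover have "(\<Sum>i\<in>{-N..N}. a i * d (s - i)) = a (s - n)"
  proof -
    have "(\<Sum>i\<in>{-N..N}. a i * d (s - i)) = (\<Sum>i\<in>{-N..N}. if i = s - n then a i else 0)"
      by (intro sum.cong) (auto simp: d_def)
    then show ?thesis using supp[rule_format, of "s - n"] by (auto simp del: atLeastAtMost_iff)
  qed
  moreover have "d (s - n) = (if s = 2 * n then 1 else 0)" by (auto simp: d_def)
  ultimately show ?thesis by (simp add: algebra_simps)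
qed

lemma quartic_scale: "quartic N (\<lambda>n. c * a n) = c ^ 4 * quartic N a"
proof -
  have "selfconv N (\<lambda>n. c * a n) s = c\<^sup>2 * selfconv N a s" for s
    by (simp add: selfconv_def sum_distrib_left power2_eq_square algebra_simps)
  then show ?thesis by (simp add: quartic_def power_mult_distrib sum_distrib_left)
qed

lemma cubic_scale: "cubic N (\<lambda>n. c * a n) n = c ^ 3 * cubic N a n"
  by (simp add: cubic_def sum_distrib_left power3_eq_cube algebra_simps)

lemma quartic_abs: "quartic N a \<le> quartic N (\<lambda>n. \<bar>a n\<bar>)"
  unfolding quartic_def
proof (rule sum_mono)
  fix s
  have "\<bar>selfconv N a s\<bar> \<le> selfconv N (\<lambda>n. \<bar>a n\<bar>) s"
    unfolding selfconv_def by (rule order_trans[OF sum_abs]) (simp add: abs_mult)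
  then show "(selfconv N a s)\<^sup>2 \<le> (selfconv N (\<lambda>n. \<bar>a n\<bar>) s)\<^sup>2"
    by (metis abs_ge_zero power2_abs power_mono)
qed

section \<open>The constrained maximiser and its Euler-Lagrange equation\<close>

lemma continuous_on_quartic: "continuous_on UNIV (quartic N)"
proof -
  have "continuous_on UNIV (\<lambda>a. \<Sum>s\<in>{-2*N..2*N}. (\<Sum>i\<in>{-N..N}. a i * a (s - i))\<^sup>2 :: real)"
    by (intro continuous_intros continuous_on_product_coordinates)
  then show ?thesis by (simp add: quartic_def[abs_def] selfconv_def)
qed

text \<open>Maximality is recorded in homogeneous form: the quartic form has degree 4 and the
  quadratic form degree 2, so the bound holds for every a in the box and a perturbed maximiser need
  not be normalised again.\<close>

lemma exists_quartic_maximizer: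
  fixes v :: "int \<Rightarrow> real"
  assumes N: "0 \<le> N" and v: "\<And>n. 0 < v n"
  obtains b where "\<And>n. 0 \<le> b n" "\<forall>n. n \<notin> {-N..N} \<longrightarrow> b n = 0" "(\<Sum>n\<in>{-N..N}. v n * (b n)\<^sup>2) = 1"
    "\<And>a. \<forall>n. n \<notin> {-N..N} \<longrightarrow> a n = 0 \<Longrightarrow> quartic N a \<le> quartic N b * (\<Sum>n\<in>{-N..N}. v n * (a n)\<^sup>2)\<^sup>2"
proof -
  define E where "E a = (\<Sum>n\<in>{-N..N}. v n * (a n)\<^sup>2)" for a :: "int \<Rightarrow> real"
  \<comment> \<open>Under the constraint each term of the quadratic form is at most 1, which
    confines coordinate n to this interval. Their product is compact by Tychonoff and contains the
    constraint set.\<close>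
  define S where "S n = (if n \<in> {-N..N} then {- (1 / sqrt (v n))..1 / sqrt (v n)} else {0})" for n
  have v0: "0 \<le> v n" for n using v[of n] by simp
  have E0: "0 \<le> E a" for a using v unfolding E_def by (intro sum_nonneg mult_nonneg_nonneg) (auto intro: less_imp_le)
  have Escale: "E (\<lambda>n. c * a n) = c\<^sup>2 * E a" for a c
    by (simp add: E_def sum_distrib_left power_mult_distrib algebra_simps)
  have "compactin (product_topology (\<lambda>i. euclidean) UNIV) (PiE UNIV S)"
    unfolding compactin_PiE by (auto simp: S_def)
  then have cpt: "compact (PiE UNIV S)" unfolding euclidean_product_topology by simp
  have contE: "continuous_on UNIV E"
    unfolding E_def[abs_def] by (intro continuous_intros continuous_on_product_coordinates)
  have "closed (E -` {1})"
    using contE by (simp add: continuous_on_closed_vimage)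
  then have K: "compact (PiE UNIV S \<inter> E -` {1})" using cpt by blast
  have inK: "a \<in> PiE UNIV S \<inter> E -` {1}" if supp: "\<forall>n. n \<notin> {-N..N} \<longrightarrow> a n = 0" and "E a = 1" for a
  proof -
    have "a n \<in> S n" for n
    proof (cases "n \<in> {-N..N}")
      case True
      have "v n * (a n)\<^sup>2 \<le> E a"
        unfolding E_def by (rule member_le_sum) (use True v0 in auto)
      then have "(sqrt (v n) * a n)\<^sup>2 \<le> 1" using v[of n] \<open>E a = 1\<close> by (simp add: power_mult_distrib)
      then have "\<bar>sqrt (v n) * a n\<bar> \<le> 1" by (simp add: abs_square_le_1)
      then have "\<bar>a n\<bar> \<le> 1 / sqrt (v n)" using v[of n] by (simp add: abs_mult field_simps)
      then show ?thesis using True by (auto simp: S_def)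
    qed (use supp in \<open>auto simp: S_def\<close>)
    then show ?thesis using \<open>E a = 1\<close> by auto
  qed
  \<comment> \<open>A normalised vector at frequency 0, showing that the constraint set is
    nonempty.\<close>
  define e where "e = (\<lambda>n::int. if n = 0 then 1 / sqrt (v 0) else 0)"
  have "E e = (\<Sum>n\<in>{-N..N}. if n = 0 then 1 else 0)"
    unfolding E_def using v[of 0] by (intro sum.cong) (auto simp: e_def power_divide)
  then have "E e = 1" using N by simp
  moreover have "\<forall>n. n \<notin> {-N..N} \<longrightarrow> e n = 0" using N by (auto simp: e_def)
  ultimately have "PiE UNIV S \<inter> E -` {1} \<noteq> {}" using inK by blast
  moreover have "continuous_on (PiE UNIV S \<inter> E -` {1}) (quartic N)"
    using continuous_on_quartic continuous_on_subset by blast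
  ultimately obtain b where b: "b \<in> PiE UNIV S \<inter> E -` {1}"
    and bmax: "\<And>a. a \<in> PiE UNIV S \<inter> E -` {1} \<Longrightarrow> quartic N a \<le> quartic N b"
    using continuous_attains_sup[OF K] by metis
  \<comment> \<open>Passing to absolute values preserves the constraint, and
    \<open>quartic_abs\<close> keeps the maximality.\<close>
  show thesis
  proof (rule that[of "\<lambda>n. \<bar>b n\<bar>"])
    show "\<forall>n. n \<notin> {-N..N} \<longrightarrow> \<bar>b n\<bar> = 0"
      using b by (auto simp: S_def PiE_iff Pi_iff split: if_splits)
    show "(\<Sum>n\<in>{-N..N}. v n * \<bar>b n\<bar>\<^sup>2) = 1" using b by (simp add: E_def)
    fix a :: "int \<Rightarrow> real" assume supp: "\<forall>n. n \<notin> {-N..N} \<longrightarrow> a n = 0"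
    have "quartic N a \<le> quartic N b * (E a)\<^sup>2"
    proof (cases "E a = 0")
      case True
      have "a n = 0" for n
      proof (cases "n \<in> {-N..N}")
        case True
        have "v n * (a n)\<^sup>2 \<le> E a"
          unfolding E_def by (rule member_le_sum) (use True v0 in auto)
        with \<open>E a = 0\<close> v[of n] show ?thesis
          by (simp add: mult_le_0_iff)
      qed (use supp in auto)
      then have "quartic N a = 0" by (simp add: quartic_def selfconv_def)
      then show ?thesis using True by simp
    next
      case False
      then have Ea: "0 < E a" using E0[of a] by simp
      let ?c = "1 / sqrt (E a)"
      have "E (\<lambda>n. ?c * a n) = 1" using Ea unfolding Escale by (simp add: power_divide)
      then have "quartic N (\<lambda>n. ?c * a n) \<le> quartic N b"
        using supp by (intro bmax inK) auto
      then have "?c ^ 4 * quartic N a \<le> quartic N b" unfolding quartic_scale .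
      moreover have "?c ^ 4 = 1 / (E a)\<^sup>2"
      proof -
        have "?c ^ 4 = (?c\<^sup>2)\<^sup>2" by simp
        then show ?thesis using Ea by (simp add: power_divide del: power_even_eq)
      qed
      ultimately show ?thesis using Ea by (simp add: field_simps)
    qed
    also have "\<dots> \<le> quartic N (\<lambda>n. \<bar>b n\<bar>) * (E a)\<^sup>2"
      by (intro mult_right_mono quartic_abs) auto
    finally show "quartic N a \<le> quartic N (\<lambda>n. \<bar>b n\<bar>) * (\<Sum>n\<in>{-N..N}. v n * (a n)\<^sup>2)\<^sup>2"
      unfolding E_def .
  qed auto
qed

text \<open>By homogeneous maximality \<open>f t\<close> is at most 0 for every t and vanishes at t
  = 0, so the derivative there is 0. With the constraint value 1 the Lagrange multiplier comes out
  as \<open>quartic N b\<close> itself.\<close>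

lemma quartic_euler_lagrange:
  fixes v :: "int \<Rightarrow> real"
  assumes supp: "\<forall>n. n \<notin> {-N..N} \<longrightarrow> b n = 0" and E1: "(\<Sum>n\<in>{-N..N}. v n * (b n)\<^sup>2) = 1"
    and bmax: "\<And>a. \<forall>n. n \<notin> {-N..N} \<longrightarrow> a n = 0 \<Longrightarrow>
      quartic N a \<le> quartic N b * (\<Sum>n\<in>{-N..N}. v n * (a n)\<^sup>2)\<^sup>2"
    and n: "n \<in> {-N..N}"
  shows "cubic N b n = quartic N b * v n * b n"
proof -
  define f where "f t = quartic N (b(n := b n + t)) - quartic N b * (\<Sum>i\<in>{-N..N}. v i * ((b(n := b n + t)) i)\<^sup>2)\<^sup>2" for t
  have E: "(\<Sum>i\<in>{-N..N}. v i * ((b(n := b n + t)) i)\<^sup>2) = 1 + v n * (2 * b n * t + t\<^sup>2)" for t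
  proof -
    have "(\<Sum>i\<in>{-N..N}. v i * ((b(n := b n + t)) i)\<^sup>2)
       = (\<Sum>i\<in>{-N..N}. v i * (b i)\<^sup>2 + (if i = n then v n * (2 * b n * t + t\<^sup>2) else 0))"
      by (intro sum.cong) (auto simp: power2_sum algebra_simps)
    then show ?thesis using n E1 by (simp add: sum.distrib)
  qed
  have f: "f t = (\<Sum>s\<in>{-2*N..2*N}. (selfconv N b s + 2 * t * b (s - n) + t\<^sup>2 * (if s = 2 * n then 1 else 0))\<^sup>2)
      - quartic N b * (1 + v n * (2 * b n * t + t\<^sup>2))\<^sup>2" for t
    unfolding f_def E unfolding quartic_def selfconv_upd[of N b, OF supp n] ..
  have "(f has_real_derivative 4 * (\<Sum>s\<in>{-2*N..2*N}. selfconv N b s * b (s - n)) - 4 * quartic N b * v n * b n) (at 0)"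
    unfolding f[abs_def]
    by (auto intro!: derivative_eq_intros simp: sum_distrib_left algebra_simps)
  moreover have "f t \<le> f 0" for t
  proof -
    have "f 0 = 0" by (simp add: f_def E1)
    moreover have "f t \<le> 0"
      unfolding f_def using bmax[of "b(n := b n + t)"] supp n by auto
    ultimately show ?thesis by simp
  qed
  ultimately have "4 * (\<Sum>s\<in>{-2*N..2*N}. selfconv N b s * b (s - n)) - 4 * quartic N b * v n * b n = 0"
    by (intro DERIV_local_max[of f _ 0 1]) auto
  then show ?thesis unfolding cubic_eq_selfconv[of N b, OF supp] by simp
qed

text \<open>Trial vector for the maximum. Each s in \<open>{0..int m}\<close> is reached by at least
  m pairs from the box, so the sum of squares grows like m^3, which cancels the factor h^3 of the
  Riemann-sum scaling.\<close>

lemma quartic_box_ge: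
  assumes "int m \<le> N"
  shows "real m ^ 3 \<le> quartic N (\<lambda>n. if n \<in> {- int m..int m} then 1 else 0)"
proof -
  let ?e = "\<lambda>n. if n \<in> {- int m..int m} then 1 else 0 :: real"
  have "real m \<le> selfconv N ?e s" if s: "s \<in> {0..int m}" for s
  proof -
    have "real m \<le> (\<Sum>i\<in>{0..int m}. 1::real)" by simp
    also have "\<dots> \<le> (\<Sum>i\<in>{0..int m}. ?e i * ?e (s - i))"
      using s by (intro sum_mono) auto
    also have "\<dots> \<le> selfconv N ?e s"
      unfolding selfconv_def by (intro sum_mono2) (use assms in auto)
    finally show ?thesis .
  qed
  then have "(\<Sum>s\<in>{0..int m}. (real m)\<^sup>2) \<le> (\<Sum>s\<in>{0..int m}. (selfconv N ?e s)\<^sup>2)"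
    by (intro sum_mono power_mono) auto
  also have "\<dots> \<le> quartic N ?e"
    unfolding quartic_def by (intro sum_mono2) (use assms in auto)
  finally have "(real m + 1) * (real m)\<^sup>2 \<le> quartic N ?e" by simp
  moreover have "real m ^ 3 \<le> (real m + 1) * (real m)\<^sup>2"
    by (simp add: power3_eq_cube power2_eq_square algebra_simps)
  ultimately show ?thesis by linarith
qed


text \<open>Integral comparison for a Riemann sum of (1 + |x|)^(-r); the lone h is the term at 0.
  The mean value theorem bounds every further term by a telescoping difference, and keeping the tail
  explicit makes the induction close. Dropping it leaves a bound independent of K.\<close>

lemma sum_powr_bound:
  fixes h r :: real
  assumes h: "0 < h" and r: "1 < r"
  shows "(\<Sum>n\<in>{- int K..int K}. h * (1 + h * \<bar>of_int n\<bar>) powr (- r))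
     \<le> h + 2 * (1 - (1 + h * real K) powr (1 - r)) / (r - 1)"
proof (induction K)
  case 0
  then show ?case by simp
next
  case (Suc K)
  let ?A = "1 + h * real K" and ?B = "1 + h * real (Suc K)"
  have A: "0 < ?A" "?A < ?B" using h by (auto simp: add_pos_nonneg)
  have "\<exists>z>?A. z < ?B \<and> ?B powr (1 - r) - ?A powr (1 - r) = (?B - ?A) * ((1 - r) * z powr (1 - r - 1))"
  proof (rule MVT2)
    fix x assume "?A \<le> x" "x \<le> ?B"
    then have "0 < x" using A by linarith
    then show "((\<lambda>x. x powr (1 - r)) has_real_derivative (1 - r) * x powr (1 - r - 1)) (at x)"
      by (rule has_real_derivative_powr)
  qed (use A in auto)
  then obtain z where z: "?A < z" "z < ?B" "?B powr (1 - r) - ?A powr (1 - r) = (?B - ?A) * ((1 - r) * z powr (1 - r - 1))"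
    by blast
  have "?B powr (- r) \<le> z powr (- r)"
    using z A r by (intro powr_mono2') auto
  then have "h * (r - 1) * ?B powr (- r) \<le> h * (r - 1) * z powr (- r)"
    using h r by (intro mult_left_mono) auto
  also have "\<dots> = ?A powr (1 - r) - ?B powr (1 - r)"
    using z(3) by (simp add: algebra_simps)
  finally have step: "h * ?B powr (- r) \<le> (?A powr (1 - r) - ?B powr (1 - r)) / (r - 1)"
    using r by (simp add: field_simps)
  have "{- int (Suc K)..int (Suc K)} = insert (int (Suc K)) (insert (- int (Suc K)) {- int K..int K})"
    by auto
  then have "(\<Sum>n\<in>{- int (Suc K)..int (Suc K)}. h * (1 + h * \<bar>of_int n\<bar>) powr (- r))
    = 2 * (h * ?B powr (- r)) + (\<Sum>n\<in>{- int K..int K}. h * (1 + h * \<bar>of_int n\<bar>) powr (- r))"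
    by (simp add: add.commute)
  also have "\<dots> \<le> 2 * ((?A powr (1 - r) - ?B powr (1 - r)) / (r - 1)) + (h + 2 * (1 - ?A powr (1 - r)) / (r - 1))"
    using step Suc.IH by linarith
  also have "\<dots> = h + 2 * (1 - ?B powr (1 - r)) / (r - 1)"
    by (simp add: diff_divide_distrib right_diff_distrib)
  finally show ?case .
qed

text \<open>The trigonometric polynomial with these coefficients, of period \<open>2 * pi * m\<close>, is a truncated
  periodic ground state.\<close>
lemma discrete_ground_state:
  fixes w :: "real \<Rightarrow> real" and m :: nat
  defines "h \<equiv> 1 / real m" and "N \<equiv> (int m)\<^sup>2"
  assumes c: "0 < c" and r: "1 < r" and w: "\<And>\<xi>. c * (1 + \<bar>\<xi>\<bar>) powr r \<le> w \<xi>"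
    and W: "\<And>\<xi>. \<bar>\<xi>\<bar> \<le> 1 \<Longrightarrow> w \<xi> \<le> W" and m: "1 \<le> m"
  obtains a where "\<And>n. 0 \<le> a n" "\<forall>n. n \<notin> {-N..N} \<longrightarrow> a n = 0"
    "\<And>n. n \<in> {-N..N} \<Longrightarrow> w (h * of_int n) * a n = h\<^sup>2 * cubic N a n"
    "(\<Sum>n\<in>{-N..N}. h * (a n)\<^sup>2) \<le> 9 * W\<^sup>2 / c"
    "sqrt c \<le> (\<Sum>n\<in>{-N..N}. h * a n)"
    "(\<Sum>n\<in>{-N..N}. h * a n) \<le> sqrt (9 * W\<^sup>2 / c * (1 + 2 / (r - 1)))"
proof -
  have h: "0 < h" "h \<le> 1" "h * real m = 1" using m by (auto simp: h_def)
  have N: "int m \<le> N" using m by (simp add: N_def power2_eq_square)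
  have wc: "c \<le> w \<xi>" for \<xi>
  proof -
    have "1 \<le> (1 + \<bar>\<xi>\<bar>) powr r" using r by (intro ge_one_powr_ge_zero) auto
    then have "c * 1 \<le> c * (1 + \<bar>\<xi>\<bar>) powr r" using c by (intro mult_left_mono) auto
    then show ?thesis using w[of \<xi>] by simp
  qed
  have w0: "0 < w \<xi>" for \<xi> using wc[of \<xi>] c by linarith
  have W0: "0 < W" using w0[of 0] W[of 0] by simp
  \<comment> \<open>With the factor h the quadratic form is a Riemann sum for the integral of w
    a^2.\<close>
  define v where "v n = h * w (h * of_int n)" for n :: int
  have v: "0 < v n" for n using w0 h by (simp add: v_def)
  define E where "E a = (\<Sum>n\<in>{-N..N}. v n * (a n)\<^sup>2)" for a :: "int \<Rightarrow> real"
  obtain b where b0: "\<And>n. 0 \<le> b n" and supp: "\<forall>n. n \<notin> {-N..N} \<longrightarrow> b n = 0"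
    and Eb: "E b = 1" and bmax: "\<And>a. \<forall>n. n \<notin> {-N..N} \<longrightarrow> a n = 0 \<Longrightarrow> quartic N a \<le> quartic N b * (E a)\<^sup>2"
    unfolding E_def by (rule exists_quartic_maximizer[of N v]) (use N v in \<open>auto simp del: atLeastAtMost_iff\<close>)
  have EL: "cubic N b n = quartic N b * v n * b n" if "n \<in> {-N..N}" for n
    by (rule quartic_euler_lagrange[OF supp]) (use Eb bmax that in \<open>auto simp: E_def\<close>)

  define e where "e n = (if n \<in> {- int m..int m} then 1 else 0 :: real)" for n
  have "E e = (\<Sum>n\<in>{- int m..int m}. v n)"
  proof -
    have "(\<Sum>n\<in>{- int m..int m}. v n) = (\<Sum>n\<in>{- int m..int m}. v n * (e n)\<^sup>2)"
      by (intro sum.cong) (auto simp: e_def)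
    also have "\<dots> = E e"
      unfolding E_def by (intro sum.mono_neutral_left) (use N in \<open>auto simp: e_def\<close>)
    finally show ?thesis ..
  qed
  also have "\<dots> \<le> (\<Sum>n\<in>{- int m..int m}. h * W)"
  proof (rule sum_mono)
    fix n assume n: "n \<in> {- int m..int m}"
    then have "\<bar>of_int n\<bar> \<le> real m" by (auto simp: abs_le_iff)
    then have "\<bar>h * of_int n\<bar> \<le> h * real m" using h(1) by (simp add: abs_mult)
    then show "v n \<le> h * W" unfolding v_def using h by (intro mult_left_mono W) auto
  qed
  also have "\<dots> = (2 * real m + 1) * (h * W)" by simp
  also have "\<dots> = 2 * (h * real m) * W + h * W" by (simp add: algebra_simps)
  also have "\<dots> \<le> 3 * W" using h W0 by simp
  finally have Ee: "E e \<le> 3 * W" .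
  have "0 \<le> E e" unfolding E_def using v by (intro sum_nonneg mult_nonneg_nonneg) (auto intro: less_imp_le)
  then have "(E e)\<^sup>2 \<le> (3 * W)\<^sup>2" using Ee by (intro power_mono)
  moreover have "real m ^ 3 \<le> quartic N b * (E e)\<^sup>2"
    using quartic_box_ge[OF N] bmax[of e] N by (force simp: e_def[abs_def])
  ultimately have "real m ^ 3 \<le> quartic N b * (3 * W)\<^sup>2"
    using quartic_nonneg[of N b] by (meson mult_left_mono order_trans)
  then have "h ^ 3 * real m ^ 3 \<le> h ^ 3 * (quartic N b * (3 * W)\<^sup>2)"
    using h by (intro mult_left_mono) auto
  then have F: "1 \<le> h ^ 3 * quartic N b * (9 * W\<^sup>2)"
    using h(3) by (simp add: power_mult_distrib[symmetric] power2_eq_square algebra_simps)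
  then have "h ^ 3 * quartic N b \<noteq> 0" by auto
  moreover have "0 \<le> h ^ 3 * quartic N b" using h quartic_nonneg by simp
  ultimately have F0: "0 < h ^ 3 * quartic N b" by linarith
  \<comment> \<open>The equation for b carries the multiplier. Since \<open>cubic\<close> has degree
    3, scaling by \<tau> with \<tau>^2 h^3 \<open>quartic N b\<close> = 1 absorbs it.\<close>
  define \<tau> where "\<tau> = 1 / sqrt (h ^ 3 * quartic N b)"
  have \<tau>0: "0 < \<tau>" using F0 by (simp add: \<tau>_def)
  have \<tau>2: "\<tau>\<^sup>2 = 1 / (h ^ 3 * quartic N b)" using F0 by (simp add: \<tau>_def power_divide)
  have \<tau>W: "\<tau>\<^sup>2 \<le> 9 * W\<^sup>2" unfolding \<tau>2 using F F0 by (simp add: field_simps)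
  define a where "a n = \<tau> * b n" for n
  have a0: "0 \<le> a n" for n using b0 \<tau>0 by (simp add: a_def)
  have asupp: "\<forall>n. n \<notin> {-N..N} \<longrightarrow> a n = 0" using supp by (simp add: a_def)
  have aEL: "w (h * of_int n) * a n = h\<^sup>2 * cubic N a n" if "n \<in> {-N..N}" for n
  proof -
    have "h\<^sup>2 * cubic N a n = \<tau> * (\<tau>\<^sup>2 * (h ^ 3 * quartic N b)) * (w (h * of_int n) * b n)"
      unfolding a_def[abs_def] cubic_scale EL[OF that] v_def
      by (simp add: power2_eq_square power3_eq_cube algebra_simps)
    also have "\<tau>\<^sup>2 * (h ^ 3 * quartic N b) = 1"
      unfolding \<tau>2 times_divide_eq_left mult_1 by (rule divide_self) (rule less_imp_neq[OF F0, symmetric])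
    also have "\<tau> * 1 * (w (h * of_int n) * b n) = w (h * of_int n) * a n" by (simp add: a_def)
    finally show ?thesis ..
  qed
  have Ea: "E a = \<tau>\<^sup>2"
  proof -
    have "E a = \<tau>\<^sup>2 * E b" by (simp add: E_def a_def power_mult_distrib sum_distrib_left algebra_simps)
    then show ?thesis using Eb by simp
  qed
  let ?S1 = "\<Sum>n\<in>{-N..N}. a n" and ?S2 = "\<Sum>n\<in>{-N..N}. (a n)\<^sup>2"
  have S2E: "c * (h * ?S2) \<le> E a"
  proof -
    have "c * (h * ?S2) = (\<Sum>n\<in>{-N..N}. h * (c * (a n)\<^sup>2))"
      by (simp add: sum_distrib_left algebra_simps)
    also have "\<dots> \<le> E a"
      unfolding E_def v_def mult.assoc
      using h wc by (intro sum_mono mult_left_mono mult_right_mono) auto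
    finally show ?thesis .
  qed
  \<comment> \<open>The chain is c h S2 <= E a = h^3 quartic(a) <= (h S1)^2 (h S2), the middle
    equality being the equation paired with a. Cancelling h S2 > 0 leaves a lower bound for u(0)
    that does not depend on m.\<close>
  have lower: "c \<le> (h * ?S1)\<^sup>2"
  proof -
    have "E a = (\<Sum>n\<in>{-N..N}. h ^ 3 * (a n * cubic N a n))"
      unfolding E_def
    proof (rule sum.cong)
      fix n assume "n \<in> {-N..N}"
      then have "v n * (a n)\<^sup>2 = h * (h\<^sup>2 * cubic N a n) * a n"
        using aEL[of n] by (simp add: v_def power2_eq_square)
      then show "v n * (a n)\<^sup>2 = h ^ 3 * (a n * cubic N a n)"
        by (simp add: power2_eq_square power3_eq_cube)
    qed simp
    also have "\<dots> = h ^ 3 * quartic N a"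
      by (simp add: quartic_eq_cubic[OF asupp] sum_distrib_left)
    also have "\<dots> \<le> h ^ 3 * (?S2 * ?S1\<^sup>2)"
      using h by (intro mult_left_mono quartic_le a0 asupp) auto
    also have "\<dots> = (h * ?S1)\<^sup>2 * (h * ?S2)"
      by (simp add: power2_eq_square power3_eq_cube algebra_simps)
    finally have 1: "E a \<le> (h * ?S1)\<^sup>2 * (h * ?S2)" .
    have "0 < E a" using Ea \<tau>0 by simp
    then have "h * ?S2 \<noteq> 0" using 1 by auto
    moreover have "0 \<le> h * ?S2" using h by (intro mult_nonneg_nonneg sum_nonneg) auto
    ultimately have pos: "0 < h * ?S2" by linarith
    have "c * (h * ?S2) \<le> (h * ?S1)\<^sup>2 * (h * ?S2)" using 1 S2E by linarith
    then show ?thesis using pos by (rule mult_right_le_imp_le)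
  qed
  have S1: "0 \<le> h * ?S1" using a0 h by (intro mult_nonneg_nonneg sum_nonneg) auto
  \<comment> \<open>A discrete Sobolev embedding: Cauchy-Schwarz with weight v splits off E a, and
    the other factor, the sum of h / w, is bounded uniformly because r > 1.\<close>
  have upper: "(h * ?S1)\<^sup>2 \<le> 9 * W\<^sup>2 / c * (1 + 2 / (r - 1))"
  proof -
    let ?K = "m\<^sup>2"
    have NK: "N = int ?K" by (simp add: N_def)
    have "h * ?S1 = (\<Sum>n\<in>{-N..N}. (sqrt (v n) * a n) * (h / sqrt (v n)))"
      unfolding sum_distrib_left using v by (intro sum.cong) (auto simp: less_imp_neq[THEN not_sym])
    also have "\<dots>\<^sup>2 \<le> (\<Sum>n\<in>{-N..N}. (sqrt (v n) * a n)\<^sup>2) * (\<Sum>n\<in>{-N..N}. (h / sqrt (v n))\<^sup>2)"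
      by (rule Cauchy_Schwarz_ineq_sum)
    also have "(\<Sum>n\<in>{-N..N}. (sqrt (v n) * a n)\<^sup>2) = E a"
      unfolding E_def using v by (intro sum.cong) (auto simp: power_mult_distrib less_imp_le)
    also have "(\<Sum>n\<in>{-N..N}. (h / sqrt (v n))\<^sup>2) \<le> (\<Sum>n\<in>{-N..N}. 1 / c * (h * (1 + h * \<bar>of_int n\<bar>) powr (- r)))"
    proof (rule sum_mono)
      fix n :: int
      have pp: "0 < (1 + h * \<bar>of_int n\<bar>) powr r" using h by (simp add: add_pos_nonneg less_imp_neq[THEN not_sym])
      have "(h / sqrt (v n))\<^sup>2 = h / w (h * of_int n)"
        using v[of n] h by (simp add: power_divide v_def power2_eq_square)
      also have "\<dots> \<le> h / (c * (1 + h * \<bar>of_int n\<bar>) powr r)"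
        using w[of "h * of_int n"] h c pp by (intro divide_left_mono mult_pos_pos w0) (auto simp: abs_mult)
      finally show "(h / sqrt (v n))\<^sup>2 \<le> 1 / c * (h * (1 + h * \<bar>of_int n\<bar>) powr (- r))"
        by (simp add: powr_minus_divide)
    qed
    also have "\<dots> = 1 / c * (\<Sum>n\<in>{-N..N}. h * (1 + h * \<bar>of_int n\<bar>) powr (- r))"
      by (simp add: sum_distrib_left)
    also have "\<dots> \<le> 1 / c * (h + 2 * (1 - (1 + h * real ?K) powr (1 - r)) / (r - 1))"
      unfolding NK using c by (intro mult_left_mono sum_powr_bound h r) auto
    also have "\<dots> \<le> 1 / c * (1 + 2 / (r - 1))"
      using c h r by (intro mult_left_mono add_mono divide_right_mono) auto
    finally have "(h * ?S1)\<^sup>2 \<le> E a * (1 / c * (1 + 2 / (r - 1)))"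
      using Ea by (simp add: mult_left_mono)
    also have "\<dots> \<le> (9 * W\<^sup>2) * (1 / c * (1 + 2 / (r - 1)))"
      unfolding Ea using \<tau>W c r by (intro mult_right_mono) auto
    finally show ?thesis by simp
  qed
  show thesis
  proof (rule that[of a])
    show "(\<Sum>n\<in>{-N..N}. h * (a n)\<^sup>2) \<le> 9 * W\<^sup>2 / c"
      using S2E \<tau>W c unfolding Ea by (simp add: sum_distrib_left[symmetric] field_simps)
    show "sqrt c \<le> (\<Sum>n\<in>{-N..N}. h * a n)"
      using lower S1 by (simp add: sum_distrib_left[symmetric] real_le_lsqrt)
    show "(\<Sum>n\<in>{-N..N}. h * a n) \<le> sqrt (9 * W\<^sup>2 / c * (1 + 2 / (r - 1)))"
      using upper by (simp add: sum_distrib_left[symmetric] real_le_rsqrt)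
  qed (use a0 asupp aEL in \<open>auto simp del: atLeastAtMost_iff\<close>)
qed

section \<open>Passage to the limit\<close>

text \<open>Serves the places without a dominating function: truncated moments, squares over growing
  periods, and difference quotients. It delivers integrability of the limit together with the
  bound.\<close>

lemma integrable_fatou:
  fixes f :: "nat \<Rightarrow> 'a \<Rightarrow> real"
  assumes f: "\<And>n. integrable M (f n)" and f0: "\<And>n x. 0 \<le> f n x" and B: "\<And>n. (LINT x|M. f n x) \<le> B"
    and lim: "\<And>x. (\<lambda>n. f n x) \<longlonglongrightarrow> g x"
  shows "integrable M g" "(LINT x|M. g x) \<le> B"
proof -
  have [measurable]: "f n \<in> borel_measurable M" for n using f by auto
  have [measurable]: "g \<in> borel_measurable M"
    by (rule borel_measurable_LIMSEQ_real[of M f]) (use lim in auto)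
  have g0: "0 \<le> g x" for x by (rule LIMSEQ_le_const[OF lim]) (use f0 in auto)
  have B0: "0 \<le> B" using B[of 0] Bochner_Integration.integral_nonneg[of M "f 0", OF f0] by linarith
  have "(\<integral>\<^sup>+x. ennreal (g x) \<partial>M) = (\<integral>\<^sup>+x. liminf (\<lambda>n. ennreal (f n x)) \<partial>M)"
    by (intro nn_integral_cong lim_imp_Liminf[symmetric] tendsto_ennrealI lim) simp
  also have "\<dots> \<le> liminf (\<lambda>n. \<integral>\<^sup>+x. ennreal (f n x) \<partial>M)"
    by (rule nn_integral_liminf) measurable
  also have "\<dots> \<le> liminf (\<lambda>n. ennreal B)"
    by (intro Liminf_mono always_eventually allI)
      (use f f0 B in \<open>auto simp: nn_integral_eq_integral intro!: ennreal_leI\<close>)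
  also have "\<dots> = ennreal B" by (simp add: Liminf_const)
  finally have le: "(\<integral>\<^sup>+x. ennreal (g x) \<partial>M) \<le> ennreal B" .
  show "integrable M g"
    by (rule integrableI_nonneg) (use le g0 in \<open>auto simp: le_less_trans\<close>)
  then have "ennreal (LINT x|M. g x) \<le> ennreal B"
    using le g0 by (simp add: nn_integral_eq_integral)
  then show "(LINT x|M. g x) \<le> B" using B0 by simp
qed

text \<open>Turns weighted sums over frequencies into integrals against probability laws on the real
  line, so that tightness and weak convergence become available. The map f will send an index n to
  its frequency h n.\<close>

lemma real_distribution_point:
  fixes p f :: "'a \<Rightarrow> real" and I :: "'a set"
  assumes I: "finite I" and p: "\<And>n. 0 \<le> p n" and sum: "sum p I = 1"
  defines "M \<equiv> distr (point_measure I p) borel f"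
  shows "real_distribution M"
    and "\<And>g :: real \<Rightarrow> 'b::{banach,second_countable_topology}. g \<in> borel_measurable borel \<Longrightarrow>
      (LINT \<xi>|M. g \<xi>) = (\<Sum>n\<in>I. p n *\<^sub>R g (f n))"
proof -
  have [measurable]: "f \<in> borel_measurable (point_measure I p)" by simp
  have "emeasure (point_measure I p) (space (point_measure I p)) = 1"
    using I p sum by (simp add: emeasure_point_measure_finite space_point_measure)
  then interpret P: prob_space "point_measure I p" by (rule prob_spaceI)
  have "prob_space M" unfolding M_def by (rule P.prob_space_distr) simp
  then show "real_distribution M"
    unfolding real_distribution_def real_distribution_axioms_def by (simp add: M_def)
  fix g :: "real \<Rightarrow> 'b" assume "g \<in> borel_measurable borel"
  then show "(LINT \<xi>|M. g \<xi>) = (\<Sum>n\<in>I. p n *\<^sub>R g (f n))"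
    unfolding M_def using I p by (simp add: integral_distr lebesgue_integral_point_measure_finite)
qed

section \<open>Orthogonality and Parseval over one period of length 2 pi / h\<close>

lemma integral_iexp_period:
  assumes h: "0 < h"
  shows "has_bochner_integral lborel (\<lambda>x. indicator {- pi / h..pi / h} x *\<^sub>R iexp (h * of_int d * x))
    (if d = 0 then complex_of_real (2 * pi / h) else 0)"
proof (cases "d = 0")
  case True
  have "has_bochner_integral lborel (\<lambda>x. indicator {- pi / h..pi / h} x *\<^sub>R (1 :: complex))
    (complex_of_real (pi / h) - complex_of_real (- pi / h))"
    by (rule has_bochner_integral_FTC_Icc) (use h in \<open>auto intro!: derivative_eq_intros simp: divide_right_mono\<close>)
  moreover have "complex_of_real (pi / h) - complex_of_real (- pi / h) = complex_of_real (2 * pi / h)"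
    by (simp add: field_simps)
  ultimately show ?thesis using True by simp
next
  case False
  let ?s = "h * of_int d"
  let ?F = "\<lambda>x. iexp (?s * x) / (\<i> * complex_of_real ?s)"
  have s: "?s \<noteq> 0" using h False by simp
  have dF: "(?F has_vector_derivative iexp (?s * x)) (at x)" for x
  proof -
    have "((\<lambda>x. iexp (?s * x)) has_vector_derivative iexp (?s * x) * (\<i> * complex_of_real ?s)) (at x)"
      by (auto intro!: derivative_eq_intros has_vector_derivative_real_field simp: mult_ac)
    from has_vector_derivative_divide[OF this, of "\<i> * complex_of_real ?s"] s show ?thesis by simp
  qed
  have "has_bochner_integral lborel (\<lambda>x. indicator {- pi / h..pi / h} x *\<^sub>R iexp (?s * x)) (?F (pi / h) - ?F (- pi / h))"
  proof (rule has_bochner_integral_FTC_Icc)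
    show "- pi / h \<le> pi / h" using h by (simp add: divide_right_mono)
    show "(?F has_vector_derivative iexp (?s * x)) (at x within {- pi / h..pi / h})" for x
      by (rule has_vector_derivative_at_within[OF dF])
  qed (intro continuous_intros)
  moreover have "iexp (?s * (pi / h)) = iexp (?s * (- pi / h))"
  proof -
    have "iexp (?s * (pi / h)) = iexp (?s * (- pi / h)) * exp (2 * of_int d * pi * \<i>)"
      unfolding exp_add[symmetric] using h by (simp add: field_simps)
    also have "exp (2 * of_int d * pi * \<i>) = 1" by (rule exp_integer_2pi) simp
    finally show ?thesis by simp
  qed
  ultimately show ?thesis using False by simp
qed

text \<open>The period enters as an indicator inside an integral over the whole line, so that these
  integrands can be passed to Fatou's lemma as the period grows.\<close>

lemma trig_poly_parseval:
  fixes z :: "int \<Rightarrow> complex"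
  assumes h: "0 < h" and I: "finite I"
  shows "integrable lborel (\<lambda>x. indicator {- pi / h..pi / h} x * (cmod (\<Sum>n\<in>I. z n * iexp (h * of_int n * x)))\<^sup>2)"
    and "(LINT x|lborel. indicator {- pi / h..pi / h} x * (cmod (\<Sum>n\<in>I. z n * iexp (h * of_int n * x)))\<^sup>2)
      = 2 * pi / h * (\<Sum>n\<in>I. (cmod (z n))\<^sup>2)"
proof -
  let ?u = "\<lambda>x. \<Sum>n\<in>I. z n * iexp (h * of_int n * x)"
  let ?J = "indicator {- pi / h..pi / h} :: real \<Rightarrow> real"
  have eq: "complex_of_real (?J x * (cmod (?u x))\<^sup>2) = (\<Sum>n\<in>I. \<Sum>m\<in>I. (z n * cnj (z m)) * (?J x *\<^sub>R iexp (h * of_int (n - m) * x)))" for x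
  proof -
    have "complex_of_real ((cmod (?u x))\<^sup>2) = ?u x * cnj (?u x)" by (rule complex_norm_square)
    also have "\<dots> = (\<Sum>n\<in>I. \<Sum>m\<in>I. (z n * iexp (h * of_int n * x)) * cnj (z m * iexp (h * of_int m * x)))"
      by (simp add: sum_product)
    also have "\<dots> = (\<Sum>n\<in>I. \<Sum>m\<in>I. (z n * cnj (z m)) * iexp (h * of_int (n - m) * x))"
    proof (intro sum.cong refl)
      fix n m
      have "iexp (h * of_int n * x) * cnj (iexp (h * of_int m * x)) = iexp (h * of_int (n - m) * x)"
        by (simp add: exp_cnj exp_add[symmetric] algebra_simps)
      then show "(z n * iexp (h * of_int n * x)) * cnj (z m * iexp (h * of_int m * x)) = (z n * cnj (z m)) * iexp (h * of_int (n - m) * x)"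
        by (simp add: mult_ac)
    qed
    finally show ?thesis by (simp add: indicator_def)
  qed
  have "has_bochner_integral lborel (\<lambda>x. complex_of_real (?J x * (cmod (?u x))\<^sup>2))
    (\<Sum>n\<in>I. \<Sum>m\<in>I. (z n * cnj (z m)) * (if n - m = 0 then complex_of_real (2 * pi / h) else 0))"
    unfolding eq by (intro has_bochner_integral_sum has_bochner_integral_mult_right integral_iexp_period h)
  also have "(\<Sum>n\<in>I. \<Sum>m\<in>I. (z n * cnj (z m)) * (if n - m = 0 then complex_of_real (2 * pi / h) else 0))
    = (\<Sum>n\<in>I. complex_of_real ((cmod (z n))\<^sup>2) * complex_of_real (2 * pi / h))"
  proof (rule sum.cong[OF refl])
    fix n assume n: "n \<in> I"
    have "(\<Sum>m\<in>I. (z n * cnj (z m)) * (if n - m = 0 then complex_of_real (2 * pi / h) else 0))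
      = (\<Sum>m\<in>I. if n = m then (z n * cnj (z n)) * complex_of_real (2 * pi / h) else 0)"
      by (intro sum.cong) auto
    then show "(\<Sum>m\<in>I. (z n * cnj (z m)) * (if n - m = 0 then complex_of_real (2 * pi / h) else 0))
      = complex_of_real ((cmod (z n))\<^sup>2) * complex_of_real (2 * pi / h)"
      using n I by (simp add: complex_norm_square[symmetric])
  qed
  also have "\<dots> = complex_of_real (2 * pi / h * (\<Sum>n\<in>I. (cmod (z n))\<^sup>2))"
    by (simp add: sum_distrib_left mult.commute)
  finally have hb: "has_bochner_integral lborel (\<lambda>x. complex_of_real (?J x * (cmod (?u x))\<^sup>2)) (complex_of_real (2 * pi / h * (\<Sum>n\<in>I. (cmod (z n))\<^sup>2)))" .
  from has_bochner_integral_Re[OF this]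
  have "has_bochner_integral lborel (\<lambda>x. ?J x * (cmod (?u x))\<^sup>2) (2 * pi / h * (\<Sum>n\<in>I. (cmod (z n))\<^sup>2))"
    by (simp only: Re_complex_of_real)
  then show "integrable lborel (\<lambda>x. ?J x * (cmod (?u x))\<^sup>2)"
    "(LINT x|lborel. ?J x * (cmod (?u x))\<^sup>2) = 2 * pi / h * (\<Sum>n\<in>I. (cmod (z n))\<^sup>2)"
    by (auto simp: has_bochner_integral_iff)
qed

section \<open>A priori bounds for the periodic approximants and their compactness\<close>

locale discrete_approx =
  fixes w :: "real \<Rightarrow> real" and c \<delta> C0 C1 K :: real and a :: "nat \<Rightarrow> int \<Rightarrow> real"
    and h :: "nat \<Rightarrow> real" and N :: "nat \<Rightarrow> int"
  assumes c: "0 < c" and w_ge: "\<And>\<xi>. c * (1 + \<bar>\<xi>\<bar>) \<le> w \<xi>" and w_cont: "\<And>\<xi>. isCont w \<xi>"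
    and w_le: "\<And>\<xi>. w \<xi> \<le> K * (1 + \<xi>\<^sup>2)"
    and \<delta>: "0 < \<delta>"
    and h: "\<And>j. h j = 1 / real (Suc j)" and N: "\<And>j. N j = (int (Suc j))\<^sup>2"
    and a0: "\<And>j n. 0 \<le> a j n" and supp: "\<And>j. \<forall>n. n \<notin> {-N j..N j} \<longrightarrow> a j n = 0"
    and EL: "\<And>j n. n \<in> {-N j..N j} \<Longrightarrow> w (h j * of_int n) * a j n = (h j)\<^sup>2 * cubic (N j) (a j) n"
    and l2: "\<And>j. (\<Sum>n\<in>{-N j..N j}. h j * (a j n)\<^sup>2) \<le> C1"
    and low: "\<And>j. \<delta> \<le> (\<Sum>n\<in>{-N j..N j}. h j * a j n)"
    and up: "\<And>j. (\<Sum>n\<in>{-N j..N j}. h j * a j n) \<le> C0"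
begin

text \<open>This is the value of the approximant \<open>u j\<close> at 0, and also the total mass of
  its coefficients as a measure.\<close>

definition mass :: "nat \<Rightarrow> real" where
  "mass j = (\<Sum>n\<in>{-N j..N j}. h j * a j n)"

definition u :: "nat \<Rightarrow> real \<Rightarrow> complex" where
  "u j x = (\<Sum>n\<in>{-N j..N j}. complex_of_real (h j * a j n) * iexp (h j * of_int n * x))"

lemma h0: "0 < h j" by (simp add: h)

lemma C0_pos: "0 < C0" using \<delta> low[of 0] up[of 0] by linarith

lemma norm_u: "cmod (u j x) \<le> C0"
proof -
  have "cmod (u j x) \<le> (\<Sum>n\<in>{-N j..N j}. cmod (complex_of_real (h j * a j n) * iexp (h j * of_int n * x)))"
    unfolding u_def by (rule norm_sum)
  also have "\<dots> = (\<Sum>n\<in>{-N j..N j}. h j * a j n)"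
    using a0 h0 by (intro sum.cong) (auto simp: norm_mult less_imp_le)
  finally show ?thesis using up[of j] by linarith
qed

text \<open>The linear growth of w gains one power per step: the equation replaces w a by the cubic
  term, and the submultiplicative weight bounds the latter by the cube of the previous moment. If B
  bounds moment m, then B^3 / c bounds moment m + 1.\<close>

lemma moment_bound: "\<exists>B. \<forall>j. (\<Sum>n\<in>{-N j..N j}. h j * a j n * (1 + \<bar>h j * of_int n\<bar>) ^ m) \<le> B"
proof (induction m)
  case 0
  then show ?case using up by auto
next
  case (Suc m)
  then obtain B where B: "\<And>j. (\<Sum>n\<in>{-N j..N j}. h j * a j n * (1 + \<bar>h j * of_int n\<bar>) ^ m) \<le> B" by blast
  have "(\<Sum>n\<in>{-N j..N j}. h j * a j n * (1 + \<bar>h j * of_int n\<bar>) ^ Suc m) \<le> B ^ 3 / c" for j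
  proof -
    define v where "v n = (1 + \<bar>h j * of_int n\<bar>) ^ m" for n :: int
    have v0: "0 \<le> v n" for n by (simp add: v_def)
    have v: "v (i + k - l) \<le> v i * v k * v l" for i k l
    proof -
      have "1 + \<bar>h j * of_int (i + k - l)\<bar> \<le> 1 + (\<bar>h j * of_int i\<bar> + \<bar>h j * of_int k\<bar> + \<bar>h j * of_int l\<bar>)"
        by (simp add: algebra_simps)
      also have "\<dots> \<le> (1 + \<bar>h j * of_int i\<bar>) * (1 + \<bar>h j * of_int k\<bar>) * (1 + \<bar>h j * of_int l\<bar>)"
        by (simp add: distrib_left distrib_right)
      finally show ?thesis unfolding v_def power_mult_distrib[symmetric] by (intro power_mono) auto
    qed
    have S0: "0 \<le> (\<Sum>n\<in>{-N j..N j}. h j * a j n * v n)"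
      using a0 h0 v0 by (intro sum_nonneg mult_nonneg_nonneg) (auto simp: less_imp_le)
    have "c * (\<Sum>n\<in>{-N j..N j}. h j * a j n * (1 + \<bar>h j * of_int n\<bar>) ^ Suc m)
      = (\<Sum>n\<in>{-N j..N j}. h j * v n * a j n * (c * (1 + \<bar>h j * of_int n\<bar>)))"
      by (simp add: sum_distrib_left v_def mult_ac)
    also have "\<dots> \<le> (\<Sum>n\<in>{-N j..N j}. h j * v n * a j n * w (h j * of_int n))"
      using h0 v0 a0 by (intro sum_mono mult_left_mono w_ge mult_nonneg_nonneg) (auto simp: less_imp_le)
    also have "\<dots> = (\<Sum>n\<in>{-N j..N j}. (h j) ^ 3 * (v n * cubic (N j) (a j) n))"
    proof (rule sum.cong[OF refl])
      fix n assume "n \<in> {-N j..N j}"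
      have "h j * v n * a j n * w (h j * of_int n) = h j * v n * (w (h j * of_int n) * a j n)"
        by (simp only: mult_ac)
      also have "\<dots> = h j * v n * ((h j)\<^sup>2 * cubic (N j) (a j) n)"
        using EL[OF \<open>n \<in> {-N j..N j}\<close>] by simp
      also have "\<dots> = (h j) ^ 3 * (v n * cubic (N j) (a j) n)"
        by (simp add: power2_eq_square power3_eq_cube)
      finally show "h j * v n * a j n * w (h j * of_int n) = (h j) ^ 3 * (v n * cubic (N j) (a j) n)" .
    qed
    also have "\<dots> = (h j) ^ 3 * (\<Sum>n\<in>{-N j..N j}. v n * cubic (N j) (a j) n)"
      by (simp add: sum_distrib_left)
    also have "\<dots> \<le> (h j) ^ 3 * (\<Sum>n\<in>{-N j..N j}. v n * a j n) ^ 3"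
      using h0[of j] by (intro mult_left_mono sum_weight_cubic_le a0 supp v0 v) (auto simp: less_imp_le)
    also have "\<dots> = (\<Sum>n\<in>{-N j..N j}. h j * a j n * v n) ^ 3"
      by (simp add: power_mult_distrib[symmetric] sum_distrib_left mult_ac)
    also have "\<dots> \<le> B ^ 3" using B[of j] S0 by (intro power_mono) (auto simp: v_def)
    finally show ?thesis using c by (simp add: field_simps)
  qed
  then show ?case by blast
qed

lemma moment_bound_abs: "\<exists>B. \<forall>j. (\<Sum>n\<in>{-N j..N j}. h j * a j n * \<bar>h j * of_int n\<bar> ^ m) \<le> B"
proof -
  obtain B where B: "\<And>j. (\<Sum>n\<in>{-N j..N j}. h j * a j n * (1 + \<bar>h j * of_int n\<bar>) ^ m) \<le> B"
    using moment_bound by blast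
  have "(\<Sum>n\<in>{-N j..N j}. h j * a j n * \<bar>h j * of_int n\<bar> ^ m) \<le> B" for j
    by (rule order_trans[OF sum_mono B[of j]])
      (use a0 h0 in \<open>auto intro!: mult_left_mono power_mono mult_nonneg_nonneg less_imp_le[OF h0]\<close>)
  then show ?thesis by blast
qed

text \<open>By the equation a coefficient is at most h^2 / c times its cubic term, which
  \<open>cubic_le\<close> controls. The bound later replaces one factor of a^2, so that square sums
  are estimated by moments.\<close>

lemma coeff_bound: "a j n \<le> C1 * C0 / c"
proof (cases "n \<in> {-N j..N j}")
  case True
  have S2: "0 \<le> (\<Sum>n\<in>{-N j..N j}. h j * (a j n)\<^sup>2)" "0 \<le> (\<Sum>n\<in>{-N j..N j}. h j * a j n)"
    using a0 h0 by (auto intro!: sum_nonneg mult_nonneg_nonneg less_imp_le[OF h0])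
  have "c * a j n \<le> w (h j * of_int n) * a j n"
  proof (rule mult_right_mono)
    have "c * 1 \<le> c * (1 + \<bar>h j * of_int n\<bar>)" using c by (intro mult_left_mono) auto
    then show "c \<le> w (h j * of_int n)" using w_ge[of "h j * of_int n"] by linarith
  qed (rule a0)
  also have "\<dots> = (h j)\<^sup>2 * cubic (N j) (a j) n" using EL[OF True] .
  also have "\<dots> \<le> (h j)\<^sup>2 * ((\<Sum>n\<in>{-N j..N j}. (a j n)\<^sup>2) * (\<Sum>n\<in>{-N j..N j}. a j n))"
    by (intro mult_left_mono cubic_le a0 supp) auto
  also have "\<dots> = (\<Sum>n\<in>{-N j..N j}. h j * (a j n)\<^sup>2) * (\<Sum>n\<in>{-N j..N j}. h j * a j n)"
    by (simp add: sum_distrib_left[symmetric] power2_eq_square)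
  also have "\<dots> \<le> C1 * C0" using S2 l2[of j] up[of j] by (intro mult_mono) auto
  finally show ?thesis using c by (simp add: field_simps)
next
  case False
  have "0 \<le> C1" using l2[of 0] a0 h0 by (intro order_trans[OF sum_nonneg l2[of 0]]) (auto simp: less_imp_le)
  then show ?thesis using False supp c C0_pos by (auto simp del: atLeastAtMost_iff)
qed

text \<open>The nonnegativity of the coefficients makes them into finite measures, so that the weak limit
  exists and has total mass at least \<open>\<delta>\<close>.\<close>
lemma limit_exists:
  "\<exists>t A M. strict_mono (t :: nat \<Rightarrow> nat) \<and> real_distribution M \<and> \<delta> \<le> A \<and>
     (\<forall>f B. (\<forall>x. isCont f x) \<longrightarrow> (\<forall>x. cmod (f x) \<le> B) \<longrightarrow>
       (\<lambda>j. \<Sum>n\<in>{-N (t j)..N (t j)}. complex_of_real (h (t j) * a (t j) n) * f (h (t j) * of_int n))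
         \<longlonglongrightarrow> complex_of_real A * (LINT \<xi>|M. f \<xi>))"
proof -
  have mass: "\<delta> \<le> mass j" "mass j \<le> C0" "0 < mass j" for j
    using low[of j] up[of j] \<delta> by (auto simp: mass_def)
  \<comment> \<open>Weak compactness is for probability laws, so the total mass is divided out and
    followed separately; it stays in the compact interval from \<delta> to
    \<open>C0\<close>.\<close>
  define p where "p j n = h j * a j n / mass j" for j n
  have p0: "0 \<le> p j n" for j n using a0 h0 mass by (simp add: p_def less_imp_le)
  have p1: "sum (p j) {-N j..N j} = 1" for j
    using mass(3)[of j] by (simp add: p_def sum_divide_distrib[symmetric] mass_def)
  define P where "P j = distr (point_measure {-N j..N j} (p j)) borel (\<lambda>n. h j * of_int n)" for j
  have P: "real_distribution (P j)" for j
    unfolding P_def by (rule real_distribution_point) (use p0 p1 in auto)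
  have PI: "(LINT \<xi>|P j. g \<xi>) = (\<Sum>n\<in>{-N j..N j}. p j n *\<^sub>R g (h j * of_int n))"
    if "g \<in> borel_measurable borel" for j and g :: "real \<Rightarrow> 'z::{banach,second_countable_topology}"
    unfolding P_def by (rule real_distribution_point) (use p0 p1 that in auto)
  obtain B where B: "\<And>j. (\<Sum>n\<in>{-N j..N j}. h j * a j n * \<bar>h j * of_int n\<bar> ^ 1) \<le> B"
    using moment_bound_abs[of 1] by blast
  have "tight P"
    unfolding tight_def
  proof (intro conjI allI impI P)
    fix \<epsilon> :: real assume \<epsilon>: "0 < \<epsilon>"
    \<comment> \<open>Chosen for Markov's inequality: the mass outside (-R, R] is at most |B| /
      (\<delta> R), and this R makes that smaller than \<epsilon>.\<close>
    define R where "R = \<bar>B\<bar> / (\<delta> * \<epsilon>) + 1"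
    have R: "0 < R" using \<delta> \<epsilon> by (auto simp: R_def intro!: add_nonneg_pos)
    have "1 - \<epsilon> < measure (P j) {- R<..R}" for j
    proof -
      interpret P: real_distribution "P j" by (rule P)
      have "measure (P j) (UNIV - {- R<..R}) = (LINT \<xi>|P j. indicator (UNIV - {- R<..R}) \<xi>)" by simp
      also have "\<dots> = (\<Sum>n\<in>{-N j..N j}. p j n *\<^sub>R indicator (UNIV - {- R<..R}) (h j * of_int n))"
        by (rule PI) auto
      also have "\<dots> \<le> (\<Sum>n\<in>{-N j..N j}. p j n * (\<bar>h j * of_int n\<bar> / R))"
        unfolding real_scaleR_def
        by (intro sum_mono mult_left_mono p0) (use R in \<open>auto simp: indicator_def field_simps\<close>)
      also have "\<dots> = (\<Sum>n\<in>{-N j..N j}. h j * a j n * \<bar>h j * of_int n\<bar> ^ 1) / (mass j * R)"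
        by (simp add: p_def sum_divide_distrib)
      also have "\<dots> \<le> \<bar>B\<bar> / (\<delta> * R)"
        using B[of j] mass[of j] R \<delta> by (intro frac_le mult_right_mono) auto
      also have "\<dots> < \<epsilon>"
      proof -
        have "\<bar>B\<bar> < \<delta> * \<epsilon> * R" unfolding R_def using \<delta> \<epsilon> by (simp add: distrib_left)
        then show ?thesis using \<delta> R by (simp add: divide_less_eq mult_ac)
      qed
      finally have "measure (P j) (UNIV - {- R<..R}) < \<epsilon>" .
      moreover have "measure (P j) (UNIV - {- R<..R}) = 1 - measure (P j) {- R<..R}"
        using P.prob_compl[of "{- R<..R}"] by simp
      ultimately show ?thesis by linarith
    qed
    then show "\<exists>a b. a < b \<and> (\<forall>n. 1 - \<epsilon> < measure (P n) {a<..b})"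
      using R by (intro exI[of _ "-R"] exI[of _ R]) auto
  qed
  \<comment> \<open>First a subsequence along which the total masses converge, then a further one
    along which the normalised laws converge weakly.\<close>
  have "seq_compact {\<delta>..C0}" by (intro compact_imp_seq_compact compact_Icc)
  then obtain A s where A: "A \<in> {\<delta>..C0}" and s: "strict_mono (s :: nat \<Rightarrow> nat)" "(mass \<circ> s) \<longlonglongrightarrow> A"
    unfolding seq_compact_def using mass by (meson atLeastAtMost_iff)
  obtain r M where r: "strict_mono (r :: nat \<Rightarrow> nat)" and M: "real_distribution M" and wc: "weak_conv_m (P \<circ> s \<circ> r) M"
    using tight_imp_convergent_subsubsequence[OF \<open>tight P\<close> s(1)] by blast
  define t where "t = s \<circ> r"
  have "(\<lambda>j. \<Sum>n\<in>{-N (t j)..N (t j)}. complex_of_real (h (t j) * a (t j) n) * f (h (t j) * of_int n))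
         \<longlonglongrightarrow> complex_of_real A * (LINT \<xi>|M. f \<xi>)" if f: "\<forall>x. isCont f x" "\<forall>x. cmod (f x) \<le> B" for f B
  proof -
    have "(\<lambda>j. LINT \<xi>|(P \<circ> s \<circ> r) j. f \<xi>) \<longlonglongrightarrow> (LINT \<xi>|M. f \<xi>)"
      by (rule weak_conv_imp_integral_bdd_continuous_conv) (use P M wc f in \<open>auto simp: o_def\<close>)
    moreover have "(\<lambda>j. mass (t j)) \<longlonglongrightarrow> A"
      using LIMSEQ_subseq_LIMSEQ[OF s(2) r] by (simp add: t_def o_def)
    ultimately have "(\<lambda>j. complex_of_real (mass (t j)) * (LINT \<xi>|P (t j). f \<xi>)) \<longlonglongrightarrow> complex_of_real A * (LINT \<xi>|M. f \<xi>)"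
      by (intro tendsto_mult tendsto_of_real) (auto simp: t_def o_def)
    moreover have "complex_of_real (mass j) * (LINT \<xi>|P j. f \<xi>)
      = (\<Sum>n\<in>{-N j..N j}. complex_of_real (h j * a j n) * f (h j * of_int n))" for j
    proof -
      have "f \<in> borel_measurable borel"
        using f by (intro borel_measurable_continuous_onI) (simp add: continuous_at_imp_continuous_on)
      from PI[OF this, of j] show ?thesis
        using mass(3)[of j] by (simp add: sum_distrib_left p_def scaleR_conv_of_real)
    qed
    ultimately show ?thesis by simp
  qed
  moreover have "strict_mono t" using s r by (simp add: t_def strict_mono_o)
  ultimately show ?thesis using M A by (intro exI[of _ t] exI[of _ A] exI[of _ M]) auto
qed

end

section \<open>The limit profile: smoothness, square integrability and the limit equation\<close>

lemma norm_iexp_minus_1: "cmod (iexp x - 1) \<le> \<bar>x\<bar>"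
  using iexp_approx1[of x 0] by simp

lemma integral_iexp_cnj: "(LINT x|lborel. iexp (\<xi> * x) * cnj (\<phi> x)) = cnj (fourier \<phi> \<xi>)"
proof -
  have "cnj (fourier \<phi> \<xi>) = (LINT x|lborel. cnj (exp (- \<i> * complex_of_real (x * \<xi>)) * \<phi> x))"
    unfolding fourier_def by (rule Bochner_Integration.integral_cnj[symmetric])
  also have "\<dots> = (LINT x|lborel. iexp (\<xi> * x) * cnj (\<phi> x))"
    by (intro Bochner_Integration.integral_cong refl) (simp add: exp_cnj mult_ac)
  finally show ?thesis ..
qed

locale limit_approx = discrete_approx +
  fixes t :: "nat \<Rightarrow> nat" and A :: real and M :: "real measure"
  assumes t: "strict_mono t" and M: "real_distribution M" and A: "\<delta> \<le> A"
    and conv: "\<And>f B. (\<And>x. isCont f x) \<Longrightarrow> (\<And>x. cmod (f x) \<le> B) \<Longrightarrow>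
       (\<lambda>j. \<Sum>n\<in>{-N (t j)..N (t j)}. complex_of_real (h (t j) * a (t j) n) * f (h (t j) * of_int n))
         \<longlonglongrightarrow> complex_of_real A * (LINT \<xi>|M. f \<xi>)"
begin

sublocale M: real_distribution M by (rule M)

text \<open>The case m = 0 is A times the characteristic function of \<open>M\<close>; the factor
  inside is what m differentiations under the integral produce.\<close>

definition D :: "nat \<Rightarrow> real \<Rightarrow> complex" where
  "D m x = complex_of_real A * (LINT \<xi>|M. iexp (x * \<xi>) * (\<i> * complex_of_real \<xi>) ^ m)"

abbreviation Q :: "real \<Rightarrow> complex" where "Q \<equiv> D 0"

lemma A_pos: "0 < A" using A \<delta> by linarith

text \<open>Weak convergence only tests bounded continuous functions, so the power is cut off at
  height i. The uniform moment bound passes to the limit for each i, and Fatou removes the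
  cutoff.\<close>

lemma moment_integrable: "integrable M (\<lambda>\<xi>. \<bar>\<xi>\<bar> ^ m)"
proof -
  obtain B where B: "\<And>j. (\<Sum>n\<in>{-N j..N j}. h j * a j n * \<bar>h j * of_int n\<bar> ^ m) \<le> B"
    using moment_bound_abs by blast
  define f where "f i \<xi> = min (\<bar>\<xi>\<bar> ^ m) (real i)" for i and \<xi> :: real
  have f0: "0 \<le> f i \<xi>" for i \<xi> by (simp add: f_def)
  have fi: "integrable M (f i)" for i
    by (rule M.integrable_const_bound[of _ "real i"]) (auto simp: f_def[abs_def])
  have fB: "(LINT \<xi>|M. f i \<xi>) \<le> B / A" for i
  proof -
    have "(\<lambda>j. \<Sum>n\<in>{-N (t j)..N (t j)}. complex_of_real (h (t j) * a (t j) n) * complex_of_real (f i (h (t j) * of_int n)))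
         \<longlonglongrightarrow> complex_of_real A * (LINT \<xi>|M. complex_of_real (f i \<xi>))"
    proof (rule conv[where B="real i"])
      show "isCont (\<lambda>\<xi>. complex_of_real (f i \<xi>)) x" for x
        unfolding f_def by (intro continuous_intros)
      show "cmod (complex_of_real (f i x)) \<le> real i" for x
        using f0[of i x] unfolding norm_of_real by (simp add: f_def)
    qed
    then have "(\<lambda>j. Re (\<Sum>n\<in>{-N (t j)..N (t j)}. complex_of_real (h (t j) * a (t j) n) * complex_of_real (f i (h (t j) * of_int n))))
         \<longlonglongrightarrow> Re (complex_of_real A * (LINT \<xi>|M. complex_of_real (f i \<xi>)))"
      by (rule tendsto_Re)
    then have "(\<lambda>j. \<Sum>n\<in>{-N (t j)..N (t j)}. h (t j) * a (t j) n * f i (h (t j) * of_int n)) \<longlonglongrightarrow> A * (LINT \<xi>|M. f i \<xi>)"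
      by (simp del: of_real_mult add: of_real_mult[symmetric])
    moreover have "(\<Sum>n\<in>{-N j..N j}. h j * a j n * f i (h j * of_int n)) \<le> B" for j
    proof (rule order_trans[OF sum_mono B[of j]])
      show "h j * a j n * f i (h j * of_int n) \<le> h j * a j n * \<bar>h j * of_int n\<bar> ^ m" for n
        using a0 h0[of j] by (intro mult_left_mono) (auto simp: f_def)
    qed
    ultimately have "A * (LINT \<xi>|M. f i \<xi>) \<le> B"
      by (intro LIMSEQ_le_const2) auto
    then show ?thesis using A_pos by (simp add: field_simps)
  qed
  have lim: "(\<lambda>i. f i \<xi>) \<longlonglongrightarrow> \<bar>\<xi>\<bar> ^ m" for \<xi>
  proof (rule tendsto_eventually)
    obtain k where k: "\<bar>\<xi>\<bar> ^ m \<le> real k" using real_arch_simple by blast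
    show "\<forall>\<^sub>F i in sequentially. f i \<xi> = \<bar>\<xi>\<bar> ^ m"
      using eventually_ge_at_top[of k] by eventually_elim (use k in \<open>auto simp: f_def min_def\<close>)
  qed
  show ?thesis by (rule integrable_fatou(1)[OF fi f0 fB lim])
qed

lemma moment_integrable_complex: "integrable M (\<lambda>\<xi>. (\<i> * complex_of_real \<xi>) ^ m)"
  by (rule Bochner_Integration.integrable_bound[OF moment_integrable[of m]]) (auto simp: norm_power norm_mult)

lemma D_deriv: "(D m has_vector_derivative D (Suc m) x) (at x)"
proof -
  let ?f = "\<lambda>\<xi>. (\<i> * complex_of_real \<xi>) ^ m"
  have "integrable M (\<lambda>\<xi>. (- \<i>) * (\<i> * complex_of_real \<xi>) ^ Suc m)"
    by (rule integrable_mult_right[OF moment_integrable_complex])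
  moreover have "(\<lambda>\<xi>. (- \<i>) * (\<i> * complex_of_real \<xi>) ^ Suc m) = (\<lambda>\<xi>. complex_of_real \<xi> * ?f \<xi>)"
    by (rule ext) (simp add: mult.assoc[symmetric])
  ultimately have i1: "integrable M (\<lambda>\<xi>. complex_of_real \<xi> * ?f \<xi>)" by (simp only:)
  have "integrable M (\<lambda>\<xi>. (- 1) * (\<i> * complex_of_real \<xi>) ^ Suc (Suc m))"
    by (rule integrable_mult_right[OF moment_integrable_complex])
  moreover have "(\<lambda>\<xi>. (- 1) * (\<i> * complex_of_real \<xi>) ^ Suc (Suc m)) = (\<lambda>\<xi>. complex_of_real (\<xi>\<^sup>2) * ?f \<xi>)"
    by (rule ext) (simp add: mult_ac power2_eq_square)
  ultimately have i2: "integrable M (\<lambda>\<xi>. complex_of_real (\<xi>\<^sup>2) * ?f \<xi>)" by (simp only:)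
  have "((\<lambda>x. LINT \<xi>|M. exp (\<i> * complex_of_real (1 * x * \<xi>)) * ?f \<xi>) has_vector_derivative
      (LINT \<xi>|M. exp (\<i> * complex_of_real (1 * x * \<xi>)) * (\<i> * complex_of_real (1 * \<xi>) * ?f \<xi>))) (at x)"
    by (rule has_vector_derivative_integral_iexp[OF _ moment_integrable_complex i1 i2]) simp
  then have "((\<lambda>x. complex_of_real A * (LINT \<xi>|M. exp (\<i> * complex_of_real (1 * x * \<xi>)) * ?f \<xi>)) has_vector_derivative
      complex_of_real A * (LINT \<xi>|M. exp (\<i> * complex_of_real (1 * x * \<xi>)) * (\<i> * complex_of_real (1 * \<xi>) * ?f \<xi>))) (at x)"
    by (rule has_vector_derivative_mult_right)
  then show ?thesis
    unfolding D_def[abs_def] power_Suc by (simp only: mult_1)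
qed

lemma smooth_D: "smooth_fun (D m)"
  unfolding smooth_fun_def by (rule exI[of _ "\<lambda>n. D (m + n)"]) (use D_deriv in auto)

lemma D_measurable [measurable]: "D m \<in> borel_measurable borel"
  by (intro smooth_fun_measurable smooth_D)

lemma Q_0: "Q 0 = complex_of_real A"
  using M.prob_space by (simp add: D_def)

lemma u_conv: "(\<lambda>j. u (t j) x) \<longlonglongrightarrow> Q x"
proof -
  have "(\<lambda>j. \<Sum>n\<in>{-N (t j)..N (t j)}. complex_of_real (h (t j) * a (t j) n) * iexp (x * (h (t j) * of_int n)))
         \<longlonglongrightarrow> complex_of_real A * (LINT \<xi>|M. iexp (x * \<xi>))"
    by (rule conv[where B=1]) (auto intro!: continuous_intros)
  moreover have "x * (h j * of_int n) = h j * of_int n * x" for j n by (rule mult.commute)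
  ultimately show ?thesis by (simp only: u_def D_def power_0 mult_1_right)
qed

lemma h_tendsto: "(\<lambda>j. h (t j)) \<longlonglongrightarrow> 0"
proof -
  have "h \<longlonglongrightarrow> 0"
    using LIMSEQ_inverse_real_of_nat by (simp add: h[abs_def] inverse_eq_divide)
  from LIMSEQ_subseq_LIMSEQ[OF this t] show ?thesis by (simp add: o_def)
qed

lemma indicator_period: "(\<lambda>j. indicator {- pi / h (t j)..pi / h (t j)} x :: real) \<longlonglongrightarrow> 1"
proof (rule tendsto_eventually)
  have "(\<lambda>j. h (t j) * \<bar>x\<bar>) \<longlonglongrightarrow> 0 * \<bar>x\<bar>" by (intro tendsto_intros h_tendsto)
  then have "\<forall>\<^sub>F j in sequentially. h (t j) * \<bar>x\<bar> < pi" by (intro order_tendstoD(2)) auto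
  then show "\<forall>\<^sub>F j in sequentially. indicator {- pi / h (t j)..pi / h (t j)} x = (1 :: real)"
  proof eventually_elim
    case (elim j)
    then have "\<bar>x\<bar> \<le> pi / h (t j)" using h0[of "t j"] by (simp add: pos_le_divide_eq mult.commute)
    then show ?case by (auto simp: indicator_def abs_le_iff)
  qed
qed

text \<open>Parseval computes the square integral over one period, the periods exhaust the line as h
  tends to 0, and Fatou transfers the uniform bound to the pointwise limit.\<close>

lemma trig_limit_L2:
  fixes z :: "nat \<Rightarrow> int \<Rightarrow> complex"
  assumes lim: "\<And>x. (\<lambda>j. \<Sum>n\<in>{-N (t j)..N (t j)}. z (t j) n * iexp (h (t j) * of_int n * x)) \<longlonglongrightarrow> F x"
    and B: "\<And>j. 2 * pi / h j * (\<Sum>n\<in>{-N j..N j}. (cmod (z j n))\<^sup>2) \<le> B"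
  shows "integrable lborel (\<lambda>x. (cmod (F x))\<^sup>2)" "(LINT x|lborel. (cmod (F x))\<^sup>2) \<le> B"
proof -
  let ?f = "\<lambda>j x. indicator {- pi / h (t j)..pi / h (t j)} x * (cmod (\<Sum>n\<in>{-N (t j)..N (t j)}. z (t j) n * iexp (h (t j) * of_int n * x)))\<^sup>2"
  have f: "integrable lborel (?f j)" for j by (rule trig_poly_parseval(1)[OF h0]) simp
  have fB: "(LINT x|lborel. ?f j x) \<le> B" for j
    using B[of "t j"] by (subst trig_poly_parseval(2)[OF h0]) auto
  have "(\<lambda>j. ?f j x) \<longlonglongrightarrow> 1 * (cmod (F x))\<^sup>2" for x
    by (intro tendsto_intros indicator_period lim)
  then have flim: "(\<lambda>j. ?f j x) \<longlonglongrightarrow> (cmod (F x))\<^sup>2" for x by simp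
  show "integrable lborel (\<lambda>x. (cmod (F x))\<^sup>2)" "(LINT x|lborel. (cmod (F x))\<^sup>2) \<le> B"
    by (rule integrable_fatou[OF f _ fB flim]; simp)+
qed

lemma Q_L2: "integrable lborel (\<lambda>x. (cmod (Q x))\<^sup>2)"
proof (rule trig_limit_L2(1))
  show "(\<lambda>j. \<Sum>n\<in>{-N (t j)..N (t j)}. complex_of_real (h (t j) * a (t j) n) * iexp (h (t j) * of_int n * x)) \<longlonglongrightarrow> Q x" for x
    using u_conv unfolding u_def .
  show "2 * pi / h j * (\<Sum>n\<in>{-N j..N j}. (cmod (complex_of_real (h j * a j n)))\<^sup>2) \<le> 2 * pi * C1" for j
  proof -
    have "2 * pi / h j * (\<Sum>n\<in>{-N j..N j}. (cmod (complex_of_real (h j * a j n)))\<^sup>2) = 2 * pi * (\<Sum>n\<in>{-N j..N j}. h j * (a j n)\<^sup>2)"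
      unfolding sum_distrib_left norm_of_real power2_abs using h0[of j]
      by (intro sum.cong refl) (simp add: power2_eq_square)
    then show ?thesis using l2[of j] by simp
  qed
qed

text \<open>The symbol i \<xi> of the derivative is unbounded and thus out of reach of weak
  convergence, whereas an increment is a difference of two values covered by \<open>u_conv\<close>.
  The linear bound |exp(i y) - 1| <= |y| provides the factor s^2.\<close>

lemma Q_difference_L2:
  "\<exists>G. \<forall>s. integrable lborel (\<lambda>x. (cmod (Q (x + s) - Q x))\<^sup>2) \<and> (LINT x|lborel. (cmod (Q (x + s) - Q x))\<^sup>2) \<le> G * s\<^sup>2"
proof -
  obtain B where B: "\<And>j. (\<Sum>n\<in>{-N j..N j}. h j * a j n * \<bar>h j * of_int n\<bar> ^ 2) \<le> B"
    using moment_bound_abs by blast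
  define G where "G = 2 * pi * (C1 * C0 / c) * B"
  have "integrable lborel (\<lambda>x. (cmod (Q (x + s) - Q x))\<^sup>2) \<and> (LINT x|lborel. (cmod (Q (x + s) - Q x))\<^sup>2) \<le> G * s\<^sup>2" for s
  proof -
    define z where "z j n = complex_of_real (h j * a j n) * (iexp (h j * of_int n * s) - 1)" for j n
    have lim: "(\<lambda>j. \<Sum>n\<in>{-N (t j)..N (t j)}. z (t j) n * iexp (h (t j) * of_int n * x)) \<longlonglongrightarrow> Q (x + s) - Q x" for x
    proof -
      have "(\<lambda>j. u (t j) (x + s) - u (t j) x) \<longlonglongrightarrow> Q (x + s) - Q x" by (intro tendsto_diff u_conv)
      moreover have "u j (x + s) - u j x = (\<Sum>n\<in>{-N j..N j}. z j n * iexp (h j * of_int n * x))" for j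
        unfolding u_def sum_subtractf[symmetric]
      proof (intro sum.cong refl)
        fix n
        have "iexp (h j * of_int n * (x + s)) = iexp (h j * of_int n * s) * iexp (h j * of_int n * x)"
          unfolding exp_add[symmetric] by (simp add: algebra_simps)
        then show "complex_of_real (h j * a j n) * iexp (h j * of_int n * (x + s)) - complex_of_real (h j * a j n) * iexp (h j * of_int n * x)
          = z j n * iexp (h j * of_int n * x)"
          unfolding z_def by (simp only: left_diff_distrib right_diff_distrib mult.assoc mult_1)
      qed
      ultimately show ?thesis by simp
    qed
    have zB: "2 * pi / h j * (\<Sum>n\<in>{-N j..N j}. (cmod (z j n))\<^sup>2) \<le> G * s\<^sup>2" for j
    proof -
      \<comment> \<open>Of the square of the coefficient one factor a is bounded by
        \<open>coeff_bound\<close>; the remaining factor with its weight is a summand of the second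
        moment.\<close>
      have zn: "(cmod (z j n))\<^sup>2 \<le> h j * ((C1 * C0 / c) * s\<^sup>2) * (h j * a j n * \<bar>h j * of_int n\<bar> ^ 2)" for n
      proof -
        have "cmod (z j n) = h j * a j n * cmod (iexp (h j * of_int n * s) - 1)"
          using a0[of j n] h0[of j] unfolding z_def norm_mult norm_of_real by simp
        also have "\<dots> \<le> h j * a j n * \<bar>h j * of_int n * s\<bar>"
          using a0[of j n] h0[of j] by (intro mult_left_mono norm_iexp_minus_1) auto
        finally have "(cmod (z j n))\<^sup>2 \<le> (h j * a j n * \<bar>h j * of_int n * s\<bar>)\<^sup>2"
          by (rule power_mono) simp
        also have "\<dots> = a j n * (h j * s\<^sup>2 * (h j * a j n * \<bar>h j * of_int n\<bar> ^ 2))"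
          by (simp add: power_mult_distrib abs_mult power2_eq_square mult_ac)
        also have "\<dots> \<le> (C1 * C0 / c) * (h j * s\<^sup>2 * (h j * a j n * \<bar>h j * of_int n\<bar> ^ 2))"
          using a0[of j n] h0[of j] by (intro mult_right_mono coeff_bound) auto
        finally show ?thesis by (simp only: mult_ac)
      qed
      have CC: "0 \<le> C1 * C0 / c" using a0[of 0 0] coeff_bound[of 0 0] by linarith
      have "2 * pi / h j * (\<Sum>n\<in>{-N j..N j}. (cmod (z j n))\<^sup>2)
        \<le> 2 * pi / h j * (\<Sum>n\<in>{-N j..N j}. h j * ((C1 * C0 / c) * s\<^sup>2) * (h j * a j n * \<bar>h j * of_int n\<bar> ^ 2))"
        using h0[of j] by (intro mult_left_mono sum_mono zn) auto
      also have "\<dots> = 2 * pi * (C1 * C0 / c) * s\<^sup>2 * (\<Sum>n\<in>{-N j..N j}. h j * a j n * \<bar>h j * of_int n\<bar> ^ 2)"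
        using h0[of j] unfolding sum_distrib_left[symmetric] by simp
      also have "\<dots> \<le> 2 * pi * (C1 * C0 / c) * s\<^sup>2 * B"
        using CC by (intro mult_left_mono B mult_nonneg_nonneg) auto
      also have "\<dots> = G * s\<^sup>2" by (simp only: G_def mult_ac)
      finally show ?thesis .
    qed
    show ?thesis using trig_limit_L2[OF lim zB] by blast
  qed
  then show ?thesis by blast
qed

text \<open>The difference quotients with step 1/(i + 1) converge pointwise to the derivative, and
  \<open>Q_difference_L2\<close> bounds their square integrals uniformly, so Fatou applies.\<close>

lemma D1_L2: "integrable lborel (\<lambda>x. (cmod (D 1 x))\<^sup>2)"
proof -
  obtain G where G: "\<And>s. integrable lborel (\<lambda>x. (cmod (Q (x + s) - Q x))\<^sup>2)" "\<And>s. (LINT x|lborel. (cmod (Q (x + s) - Q x))\<^sup>2) \<le> G * s\<^sup>2"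
    using Q_difference_L2 by blast
  define s where "s i = inverse (real (Suc i))" for i
  have s: "0 < s i" for i by (simp add: s_def)
  have slim: "s \<longlonglongrightarrow> 0" unfolding s_def by (rule LIMSEQ_inverse_real_of_nat)
  let ?f = "\<lambda>i x. (cmod (Q (x + s i) - Q x))\<^sup>2 / (s i)\<^sup>2"
  have f: "integrable lborel (?f i)" for i by (intro integrable_divide G)
  have fB: "(LINT x|lborel. ?f i x) \<le> G" for i
    using G(2)[of "s i"] s[of i] by (simp add: field_simps)
  have lim: "(\<lambda>i. ?f i x) \<longlonglongrightarrow> (cmod (D 1 x))\<^sup>2" for x
  proof -
    have "((\<lambda>e. norm (Q (x + e) - Q x - e *\<^sub>R D 1 x) / norm e) \<longlongrightarrow> 0) (at 0)"
      using D_deriv[of 0 x] by (simp add: has_vector_derivative_def has_derivative_at)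
    then have "((\<lambda>e. (Q (x + e) - Q x) /\<^sub>R e - D 1 x) \<longlongrightarrow> 0) (at 0)"
    proof (rule Lim_null_comparison[rotated])
      have "norm ((Q (x + e) - Q x) /\<^sub>R e - D 1 x) = norm (Q (x + e) - Q x - e *\<^sub>R D 1 x) / norm e" if "e \<noteq> 0" for e
      proof -
        have "(Q (x + e) - Q x) /\<^sub>R e - D 1 x = (Q (x + e) - Q x - e *\<^sub>R D 1 x) /\<^sub>R e"
          using that by (simp add: scaleR_diff_right)
        then show ?thesis by (simp add: divide_inverse mult.commute)
      qed
      then show "\<forall>\<^sub>F e in at 0. norm ((Q (x + e) - Q x) /\<^sub>R e - D 1 x) \<le> norm (Q (x + e) - Q x - e *\<^sub>R D 1 x) / norm e"
        by (auto simp: eventually_at_filter)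
    qed
    then have "((\<lambda>e. (Q (x + e) - Q x) /\<^sub>R e) \<longlongrightarrow> D 1 x) (at 0)"
      by (rule LIM_zero_cancel)
    then have "(\<lambda>i. (Q (x + s i) - Q x) /\<^sub>R s i) \<longlonglongrightarrow> D 1 x"
      by (rule filterlim_compose) (use slim s in \<open>auto simp: filterlim_at less_imp_neq[THEN not_sym]\<close>)
    then have "(\<lambda>i. (cmod ((Q (x + s i) - Q x) /\<^sub>R s i))\<^sup>2) \<longlonglongrightarrow> (cmod (D 1 x))\<^sup>2"
      by (intro tendsto_intros)
    moreover have "(cmod ((Q (x + s i) - Q x) /\<^sub>R s i))\<^sup>2 = ?f i x" for i
      by (simp add: power_mult_distrib power_inverse divide_inverse mult.commute)
    ultimately show ?thesis by simp
  qed
  show ?thesis by (rule integrable_fatou(1)[OF f _ fB lim]) simp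
qed

text \<open>All output frequencies up to 3N are kept here; the comparison with the truncated
  equation, which only knows those up to N, is made in the next lemma.\<close>

lemma cubic_u:
  assumes \<phi>: "integrable lborel \<phi>"
  shows "(LINT x|lborel. complex_of_real ((cmod (u j x))\<^sup>2) * u j x * cnj (\<phi> x))
    = (\<Sum>n\<in>{-3 * N j..3 * N j}. complex_of_real ((h j) ^ 3 * cubic (N j) (a j) n) * cnj (fourier \<phi> (h j * of_int n)))"
proof -
  let ?I = "{-N j..N j}"
  let ?e = "\<lambda>n x. iexp (h j * of_int n * x)"
  have i: "integrable lborel (\<lambda>x. ?e n x * cnj (\<phi> x))" for n
    by (intro integrable_iexp_mult) (use \<phi> in auto)
  have "complex_of_real ((cmod (u j x))\<^sup>2) * u j x * cnj (\<phi> x)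
    = (\<Sum>i\<in>?I. \<Sum>k\<in>?I. \<Sum>l\<in>?I. complex_of_real ((h j) ^ 3 * (a j i * a j k * a j l)) * (?e (i + k - l) x * cnj (\<phi> x)))" for x
  proof -
    have "complex_of_real ((cmod (u j x))\<^sup>2) * u j x = u j x * (u j x * cnj (u j x))"
      unfolding complex_norm_square by (simp only: mult_ac)
    also have "\<dots> = (\<Sum>i\<in>?I. \<Sum>k\<in>?I. \<Sum>l\<in>?I. (complex_of_real (h j * a j i) * ?e i x) *
        ((complex_of_real (h j * a j k) * ?e k x) * (complex_of_real (h j * a j l) * cnj (?e l x))))"
      unfolding u_def cnj_sum complex_cnj_mult complex_cnj_complex_of_real sum_product
      by (simp only: sum_distrib_left sum_distrib_right)
    also have "\<dots> = (\<Sum>i\<in>?I. \<Sum>k\<in>?I. \<Sum>l\<in>?I. complex_of_real ((h j) ^ 3 * (a j i * a j k * a j l)) * ?e (i + k - l) x)"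
    proof (intro sum.cong refl)
      fix i k l
      have "?e i x * (?e k x * cnj (?e l x)) = ?e (i + k - l) x"
        by (simp add: exp_cnj exp_add[symmetric] algebra_simps)
      then show "(complex_of_real (h j * a j i) * ?e i x) *
        ((complex_of_real (h j * a j k) * ?e k x) * (complex_of_real (h j * a j l) * cnj (?e l x)))
        = complex_of_real ((h j) ^ 3 * (a j i * a j k * a j l)) * ?e (i + k - l) x"
        by (simp add: power3_eq_cube mult_ac)
    qed
    finally show ?thesis by (simp only: sum_distrib_right mult.assoc)
  qed
  then have "(LINT x|lborel. complex_of_real ((cmod (u j x))\<^sup>2) * u j x * cnj (\<phi> x))
    = (LINT x|lborel. (\<Sum>i\<in>?I. \<Sum>k\<in>?I. \<Sum>l\<in>?I. complex_of_real ((h j) ^ 3 * (a j i * a j k * a j l)) * (?e (i + k - l) x * cnj (\<phi> x))))"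
    by (intro Bochner_Integration.integral_cong refl)
  also have "\<dots> = (\<Sum>i\<in>?I. \<Sum>k\<in>?I. \<Sum>l\<in>?I. complex_of_real ((h j) ^ 3 * (a j i * a j k * a j l)) * (LINT x|lborel. ?e (i + k - l) x * cnj (\<phi> x)))"
    by (simp only: Bochner_Integration.integral_sum Bochner_Integration.integrable_sum integrable_mult_right i integral_mult_right_zero)
  also have "\<dots> = (\<Sum>i\<in>?I. \<Sum>k\<in>?I. \<Sum>l\<in>?I. complex_of_real (a j i * a j k * a j l) *
      (complex_of_real ((h j) ^ 3) * cnj (fourier \<phi> (h j * of_int (i + k - l)))))"
    unfolding integral_iexp_cnj by (simp only: of_real_mult mult_ac)
  also have "\<dots> = (\<Sum>n\<in>{-3 * N j..3 * N j}. complex_of_real (cubic (N j) (a j) n) *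
      (complex_of_real ((h j) ^ 3) * cnj (fourier \<phi> (h j * of_int n))))"
    by (rule sum_triple_cubic[OF supp])
  finally show ?thesis by (simp only: of_real_mult mult_ac)
qed

text \<open>For finite j the two sides agree on all frequencies up to the cutoff by the discrete
  equation. The left side converges weakly, the right side by dominated convergence, and the
  frequencies beyond the cutoff contribute O(h).\<close>

lemma limit_equation:
  assumes \<phi>: "test_fun \<phi>"
  shows "complex_of_real A * (LINT \<xi>|M. complex_of_real (w \<xi>) * cnj (fourier \<phi> \<xi>))
    = (LINT x|lborel. complex_of_real ((cmod (Q x))\<^sup>2) * Q x * cnj (\<phi> x))"
proof -
  obtain C where C: "0 \<le> C" "\<And>\<xi>. cmod (fourier \<phi> \<xi>) * (1 + \<xi> ^ 4) \<le> C"
    using fourier_decay[OF \<phi>] by metis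
  have K0: "0 \<le> K"
  proof -
    have "0 < c * (1 + \<bar>0\<bar>)" using c by simp
    then show ?thesis using w_ge[of 0] w_le[of 0] by simp
  qed
  have w0: "0 \<le> w \<xi>" for \<xi>
    using w_ge[of \<xi>] c by (smt (verit) mult_nonneg_nonneg)
  have c\<Phi>: "isCont (fourier \<phi>) \<xi>" for \<xi>
    using fourier_deriv[OF \<phi>] has_vector_derivative_continuous by blast
  have pos4: "1 \<le> 1 + \<xi> ^ 4" for \<xi> :: real by simp
  define LHS where "LHS j = (\<Sum>n\<in>{-N j..N j}. complex_of_real (h j * a j n) * (complex_of_real (w (h j * of_int n)) * cnj (fourier \<phi> (h j * of_int n))))" for j
  \<comment> \<open>The quadratic growth of w is beaten by the fourth-order decay of the transform,
    so the integrand is bounded and continuous as weak convergence demands.\<close>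
  have L: "(\<lambda>j. LHS (t j)) \<longlonglongrightarrow> complex_of_real A * (LINT \<xi>|M. complex_of_real (w \<xi>) * cnj (fourier \<phi> \<xi>))"
    unfolding LHS_def
  proof (rule conv[where B="2 * K * C"])
    show "isCont (\<lambda>\<xi>. complex_of_real (w \<xi>) * cnj (fourier \<phi> \<xi>)) x" for x
      by (intro continuous_intros w_cont c\<Phi>)
    show "cmod (complex_of_real (w x) * cnj (fourier \<phi> x)) \<le> 2 * K * C" for x
    proof -
      have "cmod (complex_of_real (w x) * cnj (fourier \<phi> x)) = w x * cmod (fourier \<phi> x)"
        using w0[of x] by (simp add: norm_mult)
      also have "\<dots> \<le> (K * (1 + x\<^sup>2)) * cmod (fourier \<phi> x)"
        by (intro mult_right_mono w_le) auto
      also have "\<dots> \<le> (K * (2 * (1 + x ^ 4))) * cmod (fourier \<phi> x)"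
      proof (intro mult_right_mono mult_left_mono K0)
        have "x\<^sup>2 \<le> 1 + x ^ 4" using zero_le_power2[of "x\<^sup>2 - 1"] zero_le_power2[of "x\<^sup>2"]
          by (simp add: power2_eq_square power4_eq_xxxx algebra_simps)
        then show "1 + x\<^sup>2 \<le> 2 * (1 + x ^ 4)" unfolding mult_2 by (rule add_mono[OF pos4])
      qed auto
      also have "\<dots> = 2 * K * (cmod (fourier \<phi> x) * (1 + x ^ 4))" by (simp only: mult_ac)
      also have "\<dots> \<le> 2 * K * C" using K0 by (intro mult_left_mono C) auto
      finally show ?thesis .
    qed
  qed
  define NL where "NL j = (LINT x|lborel. complex_of_real ((cmod (u j x))\<^sup>2) * u j x * cnj (\<phi> x))" for j
  have [measurable]: "\<phi> \<in> borel_measurable borel" using \<phi> by (intro smooth_fun_measurable test_fun_smooth)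
  have [measurable]: "(\<lambda>x. cnj (\<phi> x)) \<in> borel_measurable borel"
    by (intro borel_measurable_continuous_onI continuous_on_cnj smooth_fun_continuous test_fun_smooth \<phi>)
  have i\<phi>: "integrable lborel \<phi>" by (rule test_fun_integrable[OF \<phi>])
  \<comment> \<open>The uniform bound \<open>norm_u\<close> makes a constant multiple of |\<phi>| a
    dominating function.\<close>
  have R: "(\<lambda>j. NL (t j)) \<longlonglongrightarrow> (LINT x|lborel. complex_of_real ((cmod (Q x))\<^sup>2) * Q x * cnj (\<phi> x))"
    unfolding NL_def
  proof (rule integral_dominated_convergence[where w="\<lambda>x. C0\<^sup>2 * C0 * cmod (\<phi> x)"])
    show "AE x in lborel. (\<lambda>j. complex_of_real ((cmod (u (t j) x))\<^sup>2) * u (t j) x * cnj (\<phi> x)) \<longlonglongrightarrow> complex_of_real ((cmod (Q x))\<^sup>2) * Q x * cnj (\<phi> x)"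
      by (intro AE_I2 tendsto_intros u_conv)
    show "AE x in lborel. norm (complex_of_real ((cmod (u (t j) x))\<^sup>2) * u (t j) x * cnj (\<phi> x)) \<le> C0\<^sup>2 * C0 * cmod (\<phi> x)" for j
    proof (rule AE_I2)
      fix x
      have "norm (complex_of_real ((cmod (u (t j) x))\<^sup>2) * u (t j) x * cnj (\<phi> x)) = (cmod (u (t j) x))\<^sup>2 * cmod (u (t j) x) * cmod (\<phi> x)"
        by (simp add: norm_mult norm_power)
      also have "\<dots> \<le> C0\<^sup>2 * C0 * cmod (\<phi> x)"
        using C0_pos by (intro mult_right_mono mult_mono power_mono norm_u) auto
      finally show "norm (complex_of_real ((cmod (u (t j) x))\<^sup>2) * u (t j) x * cnj (\<phi> x)) \<le> C0\<^sup>2 * C0 * cmod (\<phi> x)" .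
    qed
    show "integrable lborel (\<lambda>x. C0\<^sup>2 * C0 * cmod (\<phi> x))" using i\<phi> by (intro integrable_mult_right integrable_norm)
    show "(\<lambda>x. complex_of_real ((cmod (u (t j) x))\<^sup>2) * u (t j) x * cnj (\<phi> x)) \<in> borel_measurable lborel" for j
      unfolding u_def by measurable
  qed measurable
  \<comment> \<open>The total cubic mass at the discarded frequencies is at most
    \<open>C0 ^ 3\<close>, and there the transform of the test function is at most C h.\<close>
  have diff: "cmod (NL j - LHS j) \<le> C0 ^ 3 * C * h j" for j
  proof -
    let ?T = "\<lambda>n. complex_of_real ((h j) ^ 3 * cubic (N j) (a j) n) * cnj (fourier \<phi> (h j * of_int n))"
    have N0: "0 \<le> N j" by (simp add: N)
    have LHS: "LHS j = sum ?T {-N j..N j}"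
      unfolding LHS_def
    proof (intro sum.cong refl)
      fix n assume n: "n \<in> {-N j..N j}"
      have "h j * a j n * w (h j * of_int n) = h j * (w (h j * of_int n) * a j n)" by (simp only: mult_ac)
      also have "\<dots> = (h j) ^ 3 * cubic (N j) (a j) n"
        unfolding EL[OF n] by (simp add: power2_eq_square power3_eq_cube)
      finally show "complex_of_real (h j * a j n) * (complex_of_real (w (h j * of_int n)) * cnj (fourier \<phi> (h j * of_int n))) = ?T n"
        by (simp only: mult.assoc[symmetric] of_real_mult[symmetric])
    qed
    have "NL j = sum ?T {-3 * N j..3 * N j}" unfolding NL_def by (rule cubic_u[OF i\<phi>])
    also have "\<dots> = sum ?T ({-3 * N j..3 * N j} - {-N j..N j}) + sum ?T {-N j..N j}"
      by (rule sum.subset_diff) (use N0 in auto)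
    finally have "NL j - LHS j = sum ?T ({-3 * N j..3 * N j} - {-N j..N j})" using LHS by simp
    then have "cmod (NL j - LHS j) \<le> (\<Sum>n\<in>{-3 * N j..3 * N j} - {-N j..N j}. cmod (?T n))"
      by (simp only: norm_sum)
    also have "\<dots> \<le> (\<Sum>n\<in>{-3 * N j..3 * N j} - {-N j..N j}. (h j) ^ 3 * cubic (N j) (a j) n * (C * h j))"
    proof (rule sum_mono)
      fix n assume n: "n \<in> {-3 * N j..3 * N j} - {-N j..N j}"
      have cub: "0 \<le> (h j) ^ 3 * cubic (N j) (a j) n" using h0[of j] cubic_nonneg[of "a j"] a0 by simp
      have "real_of_int (N j) \<le> \<bar>of_int n\<bar>" using n by auto
      then have "h j * real_of_int (N j) \<le> \<bar>h j * of_int n\<bar>" using h0[of j] by (simp add: abs_mult)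
      \<comment> \<open>The cutoff index is the square of \<open>Suc j\<close> while the spacing is
        its inverse, so discarded frequencies are at least \<open>Suc j\<close> in modulus and move
        to infinity.\<close>
      moreover have "h j * real_of_int (N j) = real (Suc j)" by (simp add: h N power2_eq_square)
      ultimately have xi: "real (Suc j) \<le> \<bar>h j * of_int n\<bar>" by simp
      then have "1 \<le> \<bar>h j * of_int n\<bar>" by simp
      then have "\<bar>h j * of_int n\<bar> ^ 1 \<le> \<bar>h j * of_int n\<bar> ^ 4" by (intro power_increasing) auto
      then have x4: "real (Suc j) \<le> 1 + (h j * of_int n) ^ 4" using xi by (simp add: power_even_abs)
      have "cmod (fourier \<phi> (h j * of_int n)) * real (Suc j) \<le> cmod (fourier \<phi> (h j * of_int n)) * (1 + (h j * of_int n) ^ 4)"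
        by (intro mult_left_mono x4) simp
      then have "cmod (fourier \<phi> (h j * of_int n)) * real (Suc j) \<le> C" using C(2)[of "h j * of_int n"] by linarith
      then have F: "cmod (fourier \<phi> (h j * of_int n)) \<le> C * h j" by (simp add: h field_simps)
      have "cmod (?T n) = (h j) ^ 3 * cubic (N j) (a j) n * cmod (fourier \<phi> (h j * of_int n))"
        using cub unfolding norm_mult norm_of_real complex_mod_cnj by simp
      also have "\<dots> \<le> (h j) ^ 3 * cubic (N j) (a j) n * (C * h j)"
        by (rule mult_left_mono[OF F cub])
      finally show "cmod (?T n) \<le> (h j) ^ 3 * cubic (N j) (a j) n * (C * h j)" .
    qed
    also have "\<dots> = (h j) ^ 3 * (\<Sum>n\<in>{-3 * N j..3 * N j} - {-N j..N j}. 1 * cubic (N j) (a j) n) * (C * h j)"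
      by (simp only: sum_distrib_left sum_distrib_right mult_1)
    also have "\<dots> \<le> (h j) ^ 3 * (\<Sum>n\<in>{-N j..N j}. 1 * a j n) ^ 3 * (C * h j)"
      using h0[of j] C(1)
      by (intro mult_right_mono mult_left_mono sum_weight_cubic_le a0 supp) auto
    also have "\<dots> = (\<Sum>n\<in>{-N j..N j}. h j * a j n) ^ 3 * (C * h j)"
      by (simp add: power_mult_distrib[symmetric] sum_distrib_left)
    also have "\<dots> \<le> C0 ^ 3 * (C * h j)"
      using h0[of j] C(1) up[of j] low[of j] \<delta> by (intro mult_right_mono power_mono) auto
    finally show ?thesis by simp
  qed
  have "(\<lambda>j. C0 ^ 3 * C * h (t j)) \<longlonglongrightarrow> C0 ^ 3 * C * 0" by (intro tendsto_intros h_tendsto)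
  then have "(\<lambda>j. NL (t j) - LHS (t j)) \<longlonglongrightarrow> 0"
    by (intro Lim_null_comparison[of "\<lambda>j. NL (t j) - LHS (t j)" "\<lambda>j. C0 ^ 3 * C * h (t j)"]) (auto simp: diff)
  from tendsto_diff[OF R this] have "(\<lambda>j. LHS (t j)) \<longlonglongrightarrow> (LINT x|lborel. complex_of_real ((cmod (Q x))\<^sup>2) * Q x * cnj (\<phi> x))"
    by simp
  with L show ?thesis by (rule LIMSEQ_unique)
qed

end

section \<open>Travelling waves\<close>

text \<open>Either y^(r - 1) is at least 8 b and the power absorbs the linear term, or y is at most
  (8 b)^(1/(r - 1)) and the constant L does.\<close>

lemma linear_le_powr:
  fixes r b :: real
  assumes r: "1 < r" and b: "0 \<le> b"
  shows "\<exists>L\<ge>0. \<forall>y\<ge>1. b * y \<le> y powr r / 8 + L"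
proof -
  define L where "L = b * (8 * b) powr (1 / (r - 1))"
  have "b * y \<le> y powr r / 8 + L" if y: "1 \<le> y" for y
  proof (cases "8 * b \<le> y powr (r - 1)")
    case True
    have "y powr r = y * y powr (r - 1)" using y by (simp add: powr_diff)
    moreover have "y * (8 * b) \<le> y * y powr (r - 1)" using True y by (intro mult_left_mono) auto
    moreover have "0 \<le> L" using b by (simp add: L_def)
    ultimately show ?thesis by (simp add: mult_ac)
  next
    case False
    have "y = (y powr (r - 1)) powr (1 / (r - 1))" using y r by (simp add: powr_powr)
    also have "\<dots> \<le> (8 * b) powr (1 / (r - 1))" using False r by (intro powr_mono2) auto
    finally have "b * y \<le> L" unfolding L_def using b by (intro mult_left_mono)
    moreover have "0 \<le> y powr r" by simp
    ultimately show ?thesis by linarith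
  qed
  moreover have "0 \<le> L" using b by (simp add: L_def)
  ultimately show ?thesis by blast
qed

text \<open>The leading power dominates the drift since 2 \<sigma> > 1. A quarter of (1 +
  |\<xi>|)^(2 \<sigma>) is recovered from |\<xi> + k|^(2 \<sigma>), the drift consumes an eighth,
  and an eighth remains; \<Omega> covers all bounded errors.\<close>

lemma symP_coercive:
  assumes \<sigma>: "1/2 < \<sigma>" "\<sigma> < 1"
  shows "\<exists>\<Omega>>0. \<forall>\<xi>. 1/8 * (1 + \<bar>\<xi>\<bar>) powr (2 * \<sigma>) \<le> symP \<sigma> k \<xi> + \<Omega>"
proof -
  define r where "r = 2 * \<sigma>"
  have r: "1 < r" "r < 2" using \<sigma> by (auto simp: r_def)
  define c where "c = r * \<bar>k\<bar> powr (r - 2) * k"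
  obtain L where L: "0 \<le> L" "\<And>y. 1 \<le> y \<Longrightarrow> \<bar>c\<bar> * y \<le> y powr r / 8 + L"
    using linear_le_powr[OF r(1), of "\<bar>c\<bar>"] by auto
  define \<Omega> where "\<Omega> = (1 + \<bar>k\<bar>) powr r + \<bar>k\<bar> powr r + L + 1"
  have "0 < \<Omega>" using L(1) by (simp add: \<Omega>_def add_nonneg_pos)
  moreover have "1/8 * (1 + \<bar>\<xi>\<bar>) powr r \<le> symP \<sigma> k \<xi> + \<Omega>" for \<xi>
  proof -
    \<comment> \<open>Since 1 + |\<xi>| is at most twice this maximum and 2^r <= 4, the shift by k
      costs a factor 4 and the constant (1 + |k|)^r.\<close>
    let ?m = "max (1 + \<bar>k\<bar>) \<bar>\<xi> + k\<bar>"
    have "1 + \<bar>\<xi>\<bar> \<le> 2 * ?m"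
    proof -
      have "1 + \<bar>\<xi>\<bar> \<le> (1 + \<bar>k\<bar>) + \<bar>\<xi> + k\<bar>" by linarith
      also have "\<dots> \<le> ?m + ?m" by (intro add_mono) auto
      finally show ?thesis by simp
    qed
    then have "(1 + \<bar>\<xi>\<bar>) powr r \<le> (2 * ?m) powr r" using r by (intro powr_mono2) auto
    also have "\<dots> = 2 powr r * ?m powr r" by (rule powr_mult)
    also have "\<dots> \<le> 4 * ?m powr r"
    proof (rule mult_right_mono)
      have "2 powr r \<le> 2 powr (2::real)" using r by (intro powr_mono) auto
      then show "2 powr r \<le> (4::real)" by simp
    qed simp
    also have "?m powr r \<le> (1 + \<bar>k\<bar>) powr r + \<bar>\<xi> + k\<bar> powr r"
      by (auto simp: max_def)
    finally have 1: "(1 + \<bar>\<xi>\<bar>) powr r \<le> 4 * ((1 + \<bar>k\<bar>) powr r + \<bar>\<xi> + k\<bar> powr r)" by simp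
    have "c * \<xi> \<le> \<bar>c\<bar> * \<bar>\<xi>\<bar>" by (metis abs_ge_self abs_mult)
    also have "\<dots> \<le> \<bar>c\<bar> * (1 + \<bar>\<xi>\<bar>)" by (intro mult_left_mono) auto
    also have "\<dots> \<le> (1 + \<bar>\<xi>\<bar>) powr r / 8 + L" by (rule L(2)) simp
    finally have 2: "c * \<xi> \<le> (1 + \<bar>\<xi>\<bar>) powr r / 8 + L" .
    have "symP \<sigma> k \<xi> = \<bar>\<xi> + k\<bar> powr r - \<bar>k\<bar> powr r - c * \<xi>" by (simp add: symP_def r_def c_def)
    moreover have "1/8 * Z \<le> p + (Y + K + L + 1)" if "p = X - K - y" "Z \<le> 4 * (Y + X)" "y \<le> Z / 8 + L" for p X K y Z Y :: real
      using that unfolding distrib_left by linarith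
    ultimately show ?thesis using 1 2 unfolding \<Omega>_def by blast
  qed
  ultimately show ?thesis unfolding r_def by blast
qed

text \<open>Moving a test function into the frame of the wave shifts the frequency by k. This is how
  the symbol of the fractional Laplacian becomes |\<xi> + k|^(2 \<sigma>).\<close>

lemma fourier_modulate_shift:
  "fourier (\<lambda>y. iexp (- k * y) * f (y + s)) \<xi> = iexp ((\<xi> + k) * s) * fourier f (\<xi> + k)"
proof -
  let ?g = "\<lambda>x. exp (- \<i> * complex_of_real (x * (\<xi> + k))) * f x"
  have "fourier f (\<xi> + k) = \<bar>1\<bar> *\<^sub>R (LINT y|lborel. ?g (s + 1 * y))"
    unfolding fourier_def by (rule lborel_integral_real_affine) simp
  then have "iexp ((\<xi> + k) * s) * fourier f (\<xi> + k) = (LINT y|lborel. iexp ((\<xi> + k) * s) * ?g (s + 1 * y))"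
    by simp
  also have "\<dots> = fourier (\<lambda>y. iexp (- k * y) * f (y + s)) \<xi>"
    unfolding fourier_def
  proof (intro Bochner_Integration.integral_cong refl)
    fix y
    have "iexp ((\<xi> + k) * s) * exp (- \<i> * complex_of_real ((s + 1 * y) * (\<xi> + k))) = exp (- \<i> * complex_of_real (y * \<xi>)) * iexp (- k * y)"
      unfolding exp_add[symmetric] by (simp add: algebra_simps)
    then show "iexp ((\<xi> + k) * s) * ?g (s + 1 * y) = exp (- \<i> * complex_of_real (y * \<xi>)) * (iexp (- k * y) * f (y + s))"
      by (simp only: mult.assoc[symmetric] mult_1 add.commute)
  qed
  finally show ?thesis ..
qed

text \<open>Parseval for a function given as the transform of a weighted measure; it moves every
  linear pairing to the frequency side, where multipliers are plain factors.\<close>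

lemma integral_mult_cnj_fourier:
  fixes B \<psi> :: "real \<Rightarrow> complex"
  assumes "sigma_finite_measure M" "sets M = sets borel" "integrable M B" and \<psi>: "integrable lborel \<psi>"
  shows "(LINT x|lborel. (LINT \<xi>|M. iexp (x * \<xi>) * B \<xi>) * cnj (\<psi> x)) = (LINT \<xi>|M. B \<xi> * cnj (fourier \<psi> \<xi>))"
proof -
  have "(LINT x|lborel. (LINT \<xi>|M. iexp (x * \<xi>) * B \<xi>) * cnj (\<psi> x)) = (LINT x|lborel. cnj (\<psi> x) * (LINT \<xi>|M. iexp (x * \<xi>) * B \<xi>))"
    by (simp only: mult.commute)
  also have "\<dots> = (LINT \<xi>|M. B \<xi> * (LINT x|lborel. iexp (x * \<xi>) * cnj (\<psi> x)))"
    by (rule fubini_iexp) (use assms in auto)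
  also have "\<dots> = (LINT \<xi>|M. B \<xi> * cnj (fourier \<psi> \<xi>))"
    unfolding integral_iexp_cnj[symmetric] by (simp only: mult.commute)
  finally show ?thesis .
qed

lemma continuous_not_AE_zero:
  fixes f :: "real \<Rightarrow> complex"
  assumes "continuous_on UNIV f" "f x0 \<noteq> 0"
  shows "\<not> (AE x in lborel. f x = 0)"
proof
  assume ae: "AE x in lborel. f x = 0"
  have "open {x. f x \<noteq> 0}"
    using assms(1) by (intro open_Collect_neq) auto
  have "{x. f x \<noteq> 0} \<in> null_sets lborel"
    using ae \<open>open {x. f x \<noteq> 0}\<close> by (subst (asm) AE_iff_null) (auto intro!: borel_open)
  then have "negligible {x. f x \<noteq> 0}"
    unfolding negligible_iff_null_sets by (rule null_sets_completionI)
  then show False using open_not_negligible[OF \<open>open {x. f x \<noteq> 0}\<close>] assms(2) by blast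
qed

section \<open>Weak form of the profile equation and of the travelling wave\<close>

context limit_approx
begin

lemma integrable_cnj_fourier:
  assumes \<phi>: "test_fun \<phi>" and f: "\<And>\<xi>. isCont f \<xi>" and b: "\<And>\<xi>. \<bar>f \<xi>\<bar> \<le> G * (1 + \<xi>\<^sup>2)"
  shows "integrable M (\<lambda>\<xi>. complex_of_real (f \<xi>) * cnj (fourier \<phi> \<xi>))"
proof -
  obtain C where C: "\<And>\<xi>. cmod (fourier \<phi> \<xi>) * (1 + \<xi> ^ 4) \<le> C"
    using fourier_decay[OF \<phi>] by metis
  have G0: "0 \<le> G" using b[of 0] by (simp add: order_trans[OF abs_ge_zero])
  have c\<Phi>: "isCont (fourier \<phi>) \<xi>" for \<xi>
    using fourier_deriv[OF \<phi>] has_vector_derivative_continuous by blast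
  show ?thesis
  proof (rule M.integrable_const_bound[of _ "2 * G * C"])
    have "cmod (complex_of_real (f \<xi>) * cnj (fourier \<phi> \<xi>)) \<le> 2 * G * C" for \<xi>
    proof -
      have "cmod (complex_of_real (f \<xi>) * cnj (fourier \<phi> \<xi>)) * 1 \<le> cmod (complex_of_real (f \<xi>) * cnj (fourier \<phi> \<xi>)) * (1 + \<xi>\<^sup>2)"
        by (intro mult_left_mono) auto
      also have "\<dots> \<le> 2 * G * C"
        by (rule norm_mult_decay) (use b C G0 in auto)
      finally show ?thesis by simp
    qed
    then show "AE \<xi> in M. norm (complex_of_real (f \<xi>) * cnj (fourier \<phi> \<xi>)) \<le> 2 * G * C" by simp
    have "continuous_on UNIV (\<lambda>\<xi>. complex_of_real (f \<xi>) * cnj (fourier \<phi> \<xi>))"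
      by (intro continuous_at_imp_continuous_on ballI continuous_intros f c\<Phi>)
    then show "(\<lambda>\<xi>. complex_of_real (f \<xi>) * cnj (fourier \<phi> \<xi>)) \<in> borel_measurable M"
      by (simp add: borel_measurable_continuous_onI measurable_cong_sets[OF M.events_eq_borel refl])
  qed
qed

lemma integral_D_cnj:
  assumes "integrable lborel \<psi>"
  shows "(LINT x|lborel. D m x * cnj (\<psi> x)) = complex_of_real A * (LINT \<xi>|M. (\<i> * complex_of_real \<xi>) ^ m * cnj (fourier \<psi> \<xi>))"
proof -
  have "(LINT x|lborel. D m x * cnj (\<psi> x)) = complex_of_real A * (LINT x|lborel. (LINT \<xi>|M. iexp (x * \<xi>) * (\<i> * complex_of_real \<xi>) ^ m) * cnj (\<psi> x))"
    unfolding D_def mult.assoc by (rule integral_mult_right_zero)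
  then show ?thesis
    using integral_mult_cnj_fourier[OF M.sigma_finite_measure_axioms M.events_eq_borel moment_integrable_complex assms] by simp
qed

lemma H1_Q: "H1 Q"
proof -
  have "(LINT x|lborel. Q x * vector_derivative \<phi> (at x)) = - (LINT x|lborel. D 1 x * \<phi> x)" if \<phi>: "test_fun \<phi>" for \<phi>
  proof (rule test_fun_integrate_by_parts[OF smooth_D \<phi>])
    show "(Q has_vector_derivative D 1 x) (at x)" for x using D_deriv[of 0 x] by simp
    obtain \<phi>' where d: "\<And>x. (\<phi> has_vector_derivative \<phi>' x) (at x)" using test_fun_derivE[OF \<phi>] by metis
    show "(\<phi> has_vector_derivative vector_derivative \<phi> (at x)) (at x)" for x
      using d[of x] vector_derivative_at[OF d[of x]] by simp
  qed
  then show ?thesis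
    unfolding H1_def L2_def using Q_L2 D1_L2 D_measurable by (auto intro!: exI[of _ "D 1"])
qed

text \<open>Both linear terms become integrals of a symbol against \<open>M\<close>; the symbols add
  up to w, and \<open>limit_equation\<close> equates the result with the cubic term.\<close>

lemma weak_standing_Q:
  assumes \<sigma>: "1/2 < \<sigma>" "\<sigma> < 1" and w: "\<And>\<xi>. w \<xi> = symP \<sigma> k \<xi> + \<omega> powr (2 * \<sigma>)"
  shows "weak_standing \<sigma> k \<omega> Q"
  unfolding weak_standing_def
proof (intro allI impI)
  fix \<phi> assume \<phi>: "test_fun \<phi>"
  let ?F = "\<lambda>\<xi>. cnj (fourier \<phi> \<xi>)"
  have i1: "integrable M (\<lambda>\<xi>. complex_of_real (symP \<sigma> k \<xi>) * ?F \<xi>)"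
    by (rule integrable_cnj_fourier[OF \<phi> isCont_symP[OF \<sigma>(1)] symP_bound[OF \<sigma>]])
  have i2: "integrable M (\<lambda>\<xi>. complex_of_real (\<omega> powr (2 * \<sigma>)) * ?F \<xi>)"
    by (rule integrable_cnj_fourier[OF \<phi>, of _ "\<omega> powr (2 * \<sigma>)"]) (auto simp: distrib_left)
  have "(LINT x|lborel. Q x * cnj (fmult (symP \<sigma> k) \<phi> x)) = complex_of_real A * (LINT \<xi>|M. complex_of_real (symP \<sigma> k \<xi>) * ?F \<xi>)"
    unfolding integral_D_cnj[OF integrable_fmult_symP[OF \<sigma> \<phi>]] fourier_fmult_symP[OF \<sigma> \<phi>] by simp
  moreover have "complex_of_real (\<omega> powr (2 * \<sigma>)) * (LINT x|lborel. Q x * cnj (\<phi> x)) = complex_of_real A * (LINT \<xi>|M. complex_of_real (\<omega> powr (2 * \<sigma>)) * ?F \<xi>)"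
    unfolding integral_D_cnj[OF test_fun_integrable[OF \<phi>]] by simp
  moreover have "(LINT x|lborel. complex_of_real ((cmod (Q x))\<^sup>2) * Q x * cnj (\<phi> x))
    = complex_of_real A * ((LINT \<xi>|M. complex_of_real (symP \<sigma> k \<xi>) * ?F \<xi>) + (LINT \<xi>|M. complex_of_real (\<omega> powr (2 * \<sigma>)) * ?F \<xi>))"
    unfolding limit_equation[OF \<phi>, symmetric] w of_real_add distrib_right
    by (subst Bochner_Integration.integral_add[OF i1 i2]) (rule refl)
  ultimately show "(LINT x|lborel. Q x * cnj (fmult (symP \<sigma> k) \<phi> x))
      + complex_of_real (\<omega> powr (2 * \<sigma>)) * (LINT x|lborel. Q x * cnj (\<phi> x))
      - (LINT x|lborel. complex_of_real ((cmod (Q x))\<^sup>2) * Q x * cnj (\<phi> x)) = 0"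
    by (simp only: distrib_left diff_self)
qed

text \<open>After the substitution x = y + s v every term is a common phase times a pairing with the
  modulated test function. The identity |\<xi> + k|^(2 \<sigma>) = w + \<theta> + v \<xi> then
  matches them: the time derivative supplies \<theta> + v \<xi>, the nonlinearity supplies
  w.\<close>

lemma nls_solution_Q:
  assumes \<sigma>: "1/2 < \<sigma>" "\<sigma> < 1" and w: "\<And>\<xi>. w \<xi> = symP \<sigma> k \<xi> + \<Omega>"
    and \<theta>: "\<theta> = \<bar>k\<bar> powr (2 * \<sigma>) - \<Omega>" and v: "v = 2 * \<sigma> * \<bar>k\<bar> powr (2 * \<sigma> - 2) * k"
  shows "nls_solution \<sigma> (\<lambda>s x. exp (- \<i> * complex_of_real (s * \<theta>)) * exp (\<i> * complex_of_real (k * x)) * Q (x - s * v))"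
    (is "nls_solution \<sigma> ?u")
proof -
  let ?E = "\<lambda>s x. exp (- \<i> * complex_of_real (s * \<theta>)) * exp (\<i> * complex_of_real (k * x))"
  define ut where "ut s x = ?E s x * (- \<i> * complex_of_real \<theta> * Q (x - s * v) - complex_of_real v * D 1 (x - s * v))" for s x
  have ut: "((\<lambda>s. ?u s x) has_vector_derivative ut s x) (at s)" for s x
  proof -
    have e: "((\<lambda>s. ?E s x) has_vector_derivative ?E s x * (- \<i> * complex_of_real \<theta>)) (at s)"
      by (auto intro!: derivative_eq_intros has_vector_derivative_real_field simp: mult_ac)
    have "((\<lambda>s. x - s * v) has_vector_derivative - v) (at s)"
      by (auto intro!: derivative_eq_intros)
    from vector_diff_chain_at[OF this D_deriv[of 0]]
    have "((\<lambda>s. Q (x - s * v)) has_vector_derivative (- v) *\<^sub>R D 1 (x - s * v)) (at s)" by (simp add: o_def)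
    from has_vector_derivative_mult[OF e this] show ?thesis
      by (rule has_vector_derivative_eq_rhs) (simp add: ut_def scaleR_conv_of_real algebra_simps)
  qed
  have "(LINT x|lborel. \<i> * ut s x * cnj (\<phi> x)) - (LINT x|lborel. ?u s x * cnj (fmult (symL \<sigma>) \<phi> x))
     + (LINT x|lborel. complex_of_real ((cmod (?u s x))\<^sup>2) * ?u s x * cnj (\<phi> x)) = 0" if \<phi>: "test_fun \<phi>" for s \<phi>
  proof -
    define E where "E = ?E s (s * v)"
    have E: "?E s (s * v + 1 * y) = E * iexp (k * y)" for y
    proof -
      have "iexp (k * (s * v + 1 * y)) = iexp (k * (s * v)) * iexp (k * y)"
        unfolding exp_add[symmetric] by (simp add: algebra_simps)
      then show ?thesis unfolding E_def by (simp only: mult.assoc)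
    qed
    have normE: "cmod (?E s x) = 1" for x by (simp add: norm_mult)
    \<comment> \<open>The modulation and translation of the wave moved onto the test function; the
      constant phase \<open>E\<close> stays outside the integral.\<close>
    define shf where "shf f y = iexp (- k * y) * f (y + s * v)" for f :: "real \<Rightarrow> complex" and y
    have shift: "(LINT x|lborel. ?E s x * R (x - s * v) * cnj (f x)) = E * (LINT y|lborel. R y * cnj (shf f y))" for R f
    proof -
      have "(LINT x|lborel. ?E s x * R (x - s * v) * cnj (f x))
        = \<bar>1\<bar> *\<^sub>R (LINT y|lborel. ?E s (s * v + 1 * y) * R (s * v + 1 * y - s * v) * cnj (f (s * v + 1 * y)))"
        by (rule lborel_integral_real_affine) simp
      also have "\<dots> = (LINT y|lborel. E * (R y * cnj (shf f y)))"
        unfolding E by (simp add: shf_def exp_cnj add.commute mult_ac)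
      also have "\<dots> = E * (LINT y|lborel. R y * cnj (shf f y))" by (rule integral_mult_right_zero)
      finally show ?thesis .
    qed
    define \<zeta> where "\<zeta> = shf \<phi>"
    have \<zeta>: "test_fun \<zeta>"
      unfolding \<zeta>_def shf_def[abs_def] by (intro test_fun_mult smooth_fun_iexp test_fun_shift \<phi>)
    have i\<zeta>: "integrable lborel \<zeta>" by (rule test_fun_integrable[OF \<zeta>])
    \<comment> \<open>The fractional Laplacian is the case k = 0 of the symbol, so the results on
      \<open>symP\<close> cover its action on test functions.\<close>
    have symL: "symL \<sigma> = symP \<sigma> 0" by (simp add: fun_eq_iff symL_def symP_def)
    define \<psi> where "\<psi> = fmult (symL \<sigma>) \<phi>"
    have i\<psi>: "integrable lborel \<psi>" unfolding \<psi>_def symL by (rule integrable_fmult_symP[OF \<sigma> \<phi>])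
    have f\<psi>: "fourier \<psi> \<xi> = complex_of_real (symL \<sigma> \<xi>) * fourier \<phi> \<xi>" for \<xi>
      unfolding \<psi>_def symL by (rule fourier_fmult_symP[OF \<sigma> \<phi>])
    have fmod: "fourier (shf f) \<xi> = iexp ((\<xi> + k) * (s * v)) * fourier f (\<xi> + k)" for f \<xi>
      unfolding shf_def[abs_def] by (rule fourier_modulate_shift)
    have fmod\<psi>: "fourier (shf \<psi>) \<xi> = complex_of_real (symL \<sigma> (\<xi> + k)) * fourier \<zeta> \<xi>" for \<xi>
      unfolding \<zeta>_def fmod f\<psi> by (simp only: mult_ac)
    have imod: "integrable lborel (shf \<psi>)"
      unfolding shf_def[abs_def]
      using integrable_iexp_mult[of lborel "\<lambda>y. \<psi> (y + s * v)" "-k"] lborel_integrable_real_affine[OF i\<psi>, of 1 "s * v"]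
      by (simp add: add.commute)
    let ?F = "\<lambda>\<xi>. cnj (fourier \<zeta> \<xi>)"
    define J where "J f = complex_of_real A * (LINT \<xi>|M. complex_of_real (f \<xi>) * ?F \<xi>)" for f :: "real \<Rightarrow> real"
    have iw: "integrable M (\<lambda>\<xi>. complex_of_real (w \<xi>) * ?F \<xi>)"
    proof (rule integrable_cnj_fourier[OF \<zeta> w_cont])
      show "\<bar>w \<xi>\<bar> \<le> K * (1 + \<xi>\<^sup>2)" for \<xi>
      proof -
        have "0 \<le> c * (1 + \<bar>\<xi>\<bar>)" using c by simp
        then show ?thesis using w_ge[of \<xi>] w_le[of \<xi>] by linarith
      qed
    qed
    have i1: "integrable M (\<lambda>\<xi>. complex_of_real 1 * ?F \<xi>)"
      by (rule integrable_cnj_fourier[OF \<zeta>, of _ 1]) auto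
    have ix: "integrable M (\<lambda>\<xi>. complex_of_real \<xi> * ?F \<xi>)"
      by (rule integrable_cnj_fourier[OF \<zeta>, of _ 1]) (auto intro: abs_le_1_plus_square)
    have JL: "J (\<lambda>\<xi>. symL \<sigma> (\<xi> + k)) = J w + (complex_of_real \<theta> * J (\<lambda>_. 1) + complex_of_real v * J (\<lambda>\<xi>. \<xi>))"
    proof -
      have sL: "symL \<sigma> (\<xi> + k) = w \<xi> + \<theta> + v * \<xi>" for \<xi>
        by (simp add: w symL_def symP_def \<theta> v)
      have "(LINT \<xi>|M. complex_of_real (symL \<sigma> (\<xi> + k)) * ?F \<xi>)
        = (LINT \<xi>|M. complex_of_real (w \<xi>) * ?F \<xi> + (complex_of_real \<theta> * (complex_of_real 1 * ?F \<xi>) + complex_of_real v * (complex_of_real \<xi> * ?F \<xi>)))"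
        unfolding sL by (simp only: of_real_add of_real_mult distrib_right of_real_1 mult_1 mult.assoc add.assoc)
      also have "\<dots> = (LINT \<xi>|M. complex_of_real (w \<xi>) * ?F \<xi>) + (complex_of_real \<theta> * (LINT \<xi>|M. complex_of_real 1 * ?F \<xi>) + complex_of_real v * (LINT \<xi>|M. complex_of_real \<xi> * ?F \<xi>))"
        using iw i1 ix by (simp only: Bochner_Integration.integral_add Bochner_Integration.integrable_add integrable_mult_right integral_mult_right_zero)
      finally show ?thesis unfolding J_def by (simp only: distrib_left mult_ac)
    qed
    have Q\<zeta>: "(LINT y|lborel. Q y * cnj (\<zeta> y)) = J (\<lambda>_. 1)"
      unfolding integral_D_cnj[OF i\<zeta>] J_def by simp
    have D\<zeta>: "(LINT y|lborel. D 1 y * cnj (\<zeta> y)) = \<i> * J (\<lambda>\<xi>. \<xi>)"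
      unfolding integral_D_cnj[OF i\<zeta>] J_def by (simp add: mult.assoc)
    have iD: "integrable lborel (\<lambda>y. D m y * cnj (\<zeta> y))" for m
    proof -
      have "integrable lborel (\<lambda>y. D m y * \<zeta> y)" by (intro test_fun_integrable test_fun_mult smooth_D \<zeta>)
      moreover have "(\<lambda>y. cnj (\<zeta> y)) \<in> borel_measurable borel"
        by (intro borel_measurable_continuous_onI continuous_on_cnj smooth_fun_continuous test_fun_smooth \<zeta>)
      ultimately show ?thesis
        by (elim Bochner_Integration.integrable_bound) (auto simp: norm_mult)
    qed
    have T1: "(LINT x|lborel. \<i> * ut s x * cnj (\<phi> x)) = E * (complex_of_real \<theta> * J (\<lambda>_. 1) + complex_of_real v * J (\<lambda>\<xi>. \<xi>))"
    proof -
      \<comment> \<open>The factor i turns the time derivative into \<theta> Q - i v Q'. In the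
        pairing Q' brings another factor i \<xi>, so the drift ends up with the real symbol v
        \<xi>.\<close>
      let ?R = "\<lambda>y. complex_of_real \<theta> * Q y - \<i> * complex_of_real v * D 1 y"
      have "(LINT x|lborel. \<i> * ut s x * cnj (\<phi> x)) = (LINT x|lborel. ?E s x * ?R (x - s * v) * cnj (\<phi> x))"
        unfolding ut_def by (intro Bochner_Integration.integral_cong refl) (simp add: algebra_simps)
      also have "\<dots> = E * (LINT y|lborel. ?R y * cnj (\<zeta> y))" unfolding \<zeta>_def by (rule shift)
      finally have 1: "(LINT x|lborel. \<i> * ut s x * cnj (\<phi> x)) = E * (LINT y|lborel. ?R y * cnj (\<zeta> y))" .
      have "(LINT y|lborel. ?R y * cnj (\<zeta> y))
        = (LINT y|lborel. complex_of_real \<theta> * (Q y * cnj (\<zeta> y)) - \<i> * complex_of_real v * (D 1 y * cnj (\<zeta> y)))"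
        by (simp only: left_diff_distrib mult.assoc)
      also have "\<dots> = complex_of_real \<theta> * (LINT y|lborel. Q y * cnj (\<zeta> y)) - \<i> * complex_of_real v * (LINT y|lborel. D 1 y * cnj (\<zeta> y))"
        using iD by (simp only: Bochner_Integration.integral_diff integrable_mult_right integral_mult_right_zero)
      also have "\<dots> = complex_of_real \<theta> * J (\<lambda>_. 1) + complex_of_real v * J (\<lambda>\<xi>. \<xi>)"
        unfolding Q\<zeta> D\<zeta> by (simp add: mult_ac)
      finally show ?thesis using 1 by simp
    qed
    have T2: "(LINT x|lborel. ?u s x * cnj (\<psi> x)) = E * J (\<lambda>\<xi>. symL \<sigma> (\<xi> + k))"
      unfolding shift integral_D_cnj[OF imod] fmod\<psi> J_def by simp
    have T3: "(LINT x|lborel. complex_of_real ((cmod (?u s x))\<^sup>2) * ?u s x * cnj (\<phi> x)) = E * J w"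
    proof -
      have "complex_of_real ((cmod (?u s x))\<^sup>2) * ?u s x = ?E s x * (complex_of_real ((cmod (Q (x - s * v)))\<^sup>2) * Q (x - s * v))" for x
        unfolding norm_mult[of "?E s x"] normE by (simp only: mult_1 mult_ac)
      then have "(LINT x|lborel. complex_of_real ((cmod (?u s x))\<^sup>2) * ?u s x * cnj (\<phi> x))
        = E * (LINT y|lborel. complex_of_real ((cmod (Q y))\<^sup>2) * Q y * cnj (\<zeta> y))"
        unfolding \<zeta>_def using shift[of "\<lambda>y. complex_of_real ((cmod (Q y))\<^sup>2) * Q y" \<phi>] by (simp only:)
      then show ?thesis unfolding limit_equation[OF \<zeta>, symmetric] J_def .
    qed
    show ?thesis
      unfolding \<psi>_def[symmetric] T1 T2 T3 JL by (simp add: algebra_simps)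
  qed
  then show ?thesis unfolding nls_solution_def using ut by blast
qed

end

theorem theorem1p1:
  fixes \<sigma> k :: real
  assumes "1/2 < \<sigma>" and "\<sigma> < 1"
  shows "\<exists>\<omega>>0. \<exists>Q. H1 Q \<and> \<not> (AE x in lborel. Q x = 0) \<and> weak_standing \<sigma> k \<omega> Q
     \<and> smooth_fun Q
     \<and> nls_solution \<sigma> (\<lambda>t x. exp (- \<i> * complex_of_real (t * (\<bar>k\<bar> powr (2 * \<sigma>) - \<omega> powr (2 * \<sigma>))))
            * exp (\<i> * complex_of_real (k * x))
            * Q (x - 2 * t * \<sigma> * \<bar>k\<bar> powr (2 * \<sigma> - 2) * k))"
proof -
  obtain \<Omega> where \<Omega>: "0 < \<Omega>" "\<And>\<xi>. 1/8 * (1 + \<bar>\<xi>\<bar>) powr (2 * \<sigma>) \<le> symP \<sigma> k \<xi> + \<Omega>"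
    using symP_coercive[OF assms] by blast
  define w where "w \<xi> = symP \<sigma> k \<xi> + \<Omega>" for \<xi>
  define G where "G = 2 + 2 * k\<^sup>2 + \<bar>k\<bar> powr (2 * \<sigma>) + \<bar>2 * \<sigma> * \<bar>k\<bar> powr (2 * \<sigma> - 2) * k\<bar>"
  have wG: "w \<xi> \<le> (G + \<Omega>) * (1 + \<xi>\<^sup>2)" for \<xi>
  proof -
    have "symP \<sigma> k \<xi> \<le> G * (1 + \<xi>\<^sup>2)" using symP_bound[OF assms, of k \<xi>] unfolding G_def by linarith
    moreover have "\<Omega> * 1 \<le> \<Omega> * (1 + \<xi>\<^sup>2)" using \<Omega>(1) by (intro mult_left_mono) auto
    ultimately show ?thesis by (simp add: w_def distrib_right)
  qed
  have G0: "0 \<le> G" by (simp add: G_def)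
  \<comment> \<open>The quadratic upper bound on w at |\<xi>| <= 1, where 1 + \<xi>^2 is at most
    2.\<close>
  define W where "W = 2 * (G + \<Omega>)"
  have W: "w \<xi> \<le> W" if "\<bar>\<xi>\<bar> \<le> 1" for \<xi>
  proof -
    have "\<xi>\<^sup>2 \<le> 1" using that by (simp add: abs_square_le_1)
    then have "(G + \<Omega>) * (1 + \<xi>\<^sup>2) \<le> (G + \<Omega>) * 2" using G0 \<Omega>(1) by (intro mult_left_mono) auto
    then show ?thesis using wG[of \<xi>] by (simp add: W_def mult.commute)
  qed
  define h where "h j = 1 / real (Suc j)" for j
  define N where "N j = (int (Suc j))\<^sup>2" for j
  define C1 where "C1 = 9 * W\<^sup>2 / (1/8)"
  define C0 where "C0 = sqrt (9 * W\<^sup>2 / (1/8) * (1 + 2 / (2 * \<sigma> - 1)))"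
  have "\<exists>a. (\<forall>n. 0 \<le> a n) \<and> (\<forall>n. n \<notin> {-N j..N j} \<longrightarrow> a n = 0) \<and>
    (\<forall>n\<in>{-N j..N j}. w (h j * of_int n) * a n = (h j)\<^sup>2 * cubic (N j) a n) \<and>
    (\<Sum>n\<in>{-N j..N j}. h j * (a n)\<^sup>2) \<le> C1 \<and> sqrt (1/8) \<le> (\<Sum>n\<in>{-N j..N j}. h j * a n) \<and>
    (\<Sum>n\<in>{-N j..N j}. h j * a n) \<le> C0" for j
    unfolding h_def N_def C0_def C1_def
  proof (rule discrete_ground_state[of "1/8" "2 * \<sigma>" w W "Suc j"])
    show "1/8 * (1 + \<bar>\<xi>\<bar>) powr (2 * \<sigma>) \<le> w \<xi>" for \<xi> using \<Omega>(2) by (simp add: w_def)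
    show "w \<xi> \<le> W" if "\<bar>\<xi>\<bar> \<le> 1" for \<xi> by (rule W[OF that])
    show "1 < 2 * \<sigma>" using assms by simp
  qed (simp, simp, blast)
  then obtain a where a: "\<And>j. (\<forall>n. 0 \<le> a j n) \<and> (\<forall>n. n \<notin> {-N j..N j} \<longrightarrow> a j n = 0) \<and>
    (\<forall>n\<in>{-N j..N j}. w (h j * of_int n) * a j n = (h j)\<^sup>2 * cubic (N j) (a j) n) \<and>
    (\<Sum>n\<in>{-N j..N j}. h j * (a j n)\<^sup>2) \<le> C1 \<and> sqrt (1/8) \<le> (\<Sum>n\<in>{-N j..N j}. h j * a j n) \<and>
    (\<Sum>n\<in>{-N j..N j}. h j * a j n) \<le> C0"
    by metis
  \<comment> \<open>The coercivity constant is the 1/8 of \<open>symP_coercive\<close>, and its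
    square root is the lower bound for the value at 0 from \<open>discrete_ground_state\<close>. The
    exponent 2 \<sigma> is relaxed to 1, the form used by the moment bootstrap.\<close>
  interpret discrete_approx w "1/8" "sqrt (1/8)" C0 C1 "G + \<Omega>" a h N
  proof
    show "1/8 * (1 + \<bar>\<xi>\<bar>) \<le> w \<xi>" for \<xi>
    proof -
      have "(1 + \<bar>\<xi>\<bar>) powr 1 \<le> (1 + \<bar>\<xi>\<bar>) powr (2 * \<sigma>)" using assms by (intro powr_mono) auto
      then show ?thesis using \<Omega>(2)[of \<xi>] by (simp add: w_def)
    qed
    show "isCont w \<xi>" for \<xi> unfolding w_def[abs_def] by (intro continuous_intros isCont_symP assms)
  qed (use a wG in \<open>auto simp: h_def N_def\<close>)
  obtain t A M where "strict_mono (t :: nat \<Rightarrow> nat)" "real_distribution M" "sqrt (1/8) \<le> A"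
    and cv: "\<forall>f B. (\<forall>x. isCont f x) \<longrightarrow> (\<forall>x. cmod (f x) \<le> B) \<longrightarrow>
       (\<lambda>j. \<Sum>n\<in>{-N (t j)..N (t j)}. complex_of_real (h (t j) * a (t j) n) * f (h (t j) * of_int n))
         \<longlonglongrightarrow> complex_of_real A * (LINT \<xi>|M. f \<xi>)"
    using limit_exists by blast
  interpret limit_approx w "1/8" "sqrt (1/8)" C0 C1 "G + \<Omega>" a h N t A M
  proof (rule limit_approx.intro[OF discrete_approx_axioms], rule limit_approx_axioms.intro)
    show "(\<lambda>j. \<Sum>n\<in>{-N (t j)..N (t j)}. complex_of_real (h (t j) * a (t j) n) * f (h (t j) * of_int n))
         \<longlonglongrightarrow> complex_of_real A * (LINT \<xi>|M. f \<xi>)" if "\<And>x. isCont f x" "\<And>x. cmod (f x) \<le> B" for f B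
      using cv that by blast
  qed fact+
  \<comment> \<open>Coercivity fixes \<Omega>, the constant added to the symbol; its root of order 2
    \<sigma> is the frequency parameter of the equation.\<close>
  define \<omega> where "\<omega> = \<Omega> powr (1 / (2 * \<sigma>))"
  have \<omega>: "\<omega> powr (2 * \<sigma>) = \<Omega>" using assms \<Omega>(1) by (simp add: \<omega>_def powr_powr)
  have w: "w \<xi> = symP \<sigma> k \<xi> + \<omega> powr (2 * \<sigma>)" for \<xi> by (simp add: w_def \<omega>)
  have speed: "2 * t * \<sigma> * \<bar>k\<bar> powr (2 * \<sigma> - 2) * k = t * (2 * \<sigma> * \<bar>k\<bar> powr (2 * \<sigma> - 2) * k)" for t
    by (simp only: mult_ac)
  have "0 < \<omega>" using \<Omega>(1) by (simp add: \<omega>_def)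
  moreover have "\<not> (AE x in lborel. Q x = 0)"
    by (rule continuous_not_AE_zero[of _ 0]) (use Q_0 A_pos smooth_D in \<open>auto intro: smooth_fun_continuous\<close>)
  moreover have "nls_solution \<sigma> (\<lambda>t x. exp (- \<i> * complex_of_real (t * (\<bar>k\<bar> powr (2 * \<sigma>) - \<omega> powr (2 * \<sigma>))))
            * exp (\<i> * complex_of_real (k * x))
            * Q (x - 2 * t * \<sigma> * \<bar>k\<bar> powr (2 * \<sigma> - 2) * k))"
    unfolding speed by (rule nls_solution_Q[OF assms w refl refl])
  ultimately show ?thesis
    using H1_Q weak_standing_Q[OF assms w] smooth_D by blast
qed

end
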